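(* Let $h$ be an affine $\varrho$-connection on the affine bundle $\pi:E\to M$, with associated covariant derivative operators $(\nabla,\overline\nabla)$. For all $\mathsf{s}\in Sec(\tau)$, $\overline\sigma\in Sec(\overline\pi)$ and $\sigma\in Sec(\pi)$, the brackets $[h\mathsf{s},v\overline\sigma]$ and $[h\mathsf{s},v\sigma]$ of vector fields on $E$ are vertical and $$\overline\nabla_{\mathsf{s}}\overline\sigma=[h\mathsf{s},v\overline\sigma]_v,\qquad \nabla_{\mathsf{s}}\sigma=[h\mathsf{s},v\sigma]_v .$$
   Context: Everything is smooth. $\pi:E\to M$ is an affine bundle modelled on the vector bundle $\overline\pi:\overline E\to M$; $\tau:\mathsf{V}\to M$ is a vector bundle with anchor, i.e. a vector bundle map $\varrho:\mathsf{V}\to TM$ over the identity. $Sec(\cdot)$ denotes sections; $\pi^*\mathsf{V}=E\times_M\mathsf{V}$, $\pi^*\overline E=E\times_M\overline E$. Sections of $\overline\pi$ are identified with sections of $\pi^*\overline E\to E$ by composition with $\pi$ (the equalities in the claim are understood with this identification). Vertical lift: for $e\in E_m$, $\overline e\in\overline E_m$, $v(e,\overline e)\in T_eE$ is the tangent vector at $t=0$ of $t\mapsto e+t\overline e$. For $\overline\sigma\in Sec(\overline\pi)$, $(v\overline\sigma)(e)=v(e,\overline\sigma(\pi(e)))$; for $\sigma\in Sec(\pi)$, $(v\sigma)(e)=v(e,\sigma(\pi(e))-e)$. For $Q\in TE$ vertical, $Q_v$ is the unique element of $\pi^*\overline E$ with $v(Q_v)=Q$ (and similarly for vertical vector fields).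 A $\varrho$-connection on $\pi$ is a linear bundle map $h:\pi^*\mathsf{V}\to TE$ over $E$ with $T\pi\circ h=\varrho\circ p_{\mathsf V}$, with $p_{\mathsf V}:\pi^*\mathsf{V}\to\mathsf{V}$ the projection; $h\mathsf{s}$ is the vector field $e\mapsto h(e,\mathsf{s}(\pi(e)))$. A $\varrho$-connection $\overline h:\overline\pi^*\mathsf{V}\to T\overline E$ on $\overline\pi$ is linear if its connection coefficients are linear in the linear fibre coordinates of $\overline E$. $h$ is affine if there is a linear $\varrho$-connection $\overline h$ on $\overline\pi$ such that, with $\Sigma:E\times_M\overline E\to E$, $\Sigma(e,\overline e)=e+\overline e$, one has $h(e+\overline e,\mathsf{v})=T\Sigma_{(e,\overline e)}\big(h(e,\mathsf{v}),\overline h(\overline e,\mathsf{v})\big)$ for all $e\in E_m,\overline e\in\overline E_m,\mathsf{v}\in\mathsf{V}_m$. The operator $\nabla:Sec(\tau)\times Sec(\pi)\to Sec(\overline\pi)$ is defined by $\nabla_{\mathsf{s}}\sigma(m)=$ the element of $\overline E_m$ whose vertical lift at $\sigma(m)$ is $T\sigma(\varrho(\mathsf{s}(m)))-h(\sigma(m),\mathsf{s}(m))$, and $\overline\nabla:Sec(\tau)\times Sec(\overline\pi)\to Sec(\overline\pi)$ is the covariant derivative operator of $\overline h$, defined in the same way with $\overline h$, $\overline\sigma$ in place of $h$, $\sigma$. *)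

theory Defs
  imports "HOL-Analysis.Analysis"
begin

text \<open>Finite-dimensional Euclidean model spaces. In contrast to \<open>euclidean_space\<close>, dimension zero
  is allowed, so that zero-dimensional manifolds and bundles of rank zero are covered.\<close>

class finite_dim_inner = real_inner +
  assumes finite_dim: "\<exists>B. finite B \<and> (\<forall>x. \<exists>u. x = (\<Sum>b\<in>B. u b *\<^sub>R b))"

lemma finite_dim_span: "\<exists>B :: 'a::finite_dim_inner set. finite B \<and> span B = UNIV"
proof -
  obtain B :: "'a set" where B: "finite B" "\<forall>x. \<exists>u. x = (\<Sum>b\<in>B. u b *\<^sub>R b)"
    using finite_dim by blast
  have "span B = UNIV"
    unfolding span_finite[OF B(1)] using B(2) by auto
  then show ?thesis using B(1) by blast
qed

lemma finite_dimI:
  fixes B :: "'a::real_vector set"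
  assumes "finite B" "span B = UNIV"
  shows "\<exists>B :: 'a set. finite B \<and> (\<forall>x. \<exists>u. x = (\<Sum>b\<in>B. u b *\<^sub>R b))"
proof (intro exI[of _ B] conjI allI)
  fix x
  have "x \<in> range (\<lambda>u. \<Sum>b\<in>B. u b *\<^sub>R b)"
    using assms(2) unfolding span_finite[OF assms(1)] by simp
  then show "\<exists>u. x = (\<Sum>b\<in>B. u b *\<^sub>R b)" by blast
qed (rule assms(1))

instance euclidean_space \<subseteq> finite_dim_inner
  by standard (rule finite_dimI[OF finite_Basis span_Basis])

instance prod :: (finite_dim_inner, finite_dim_inner) finite_dim_inner
proof
  obtain A :: "'a set" where A: "finite A" "span A = UNIV" using finite_dim_span by blast
  obtain B :: "'b set" where B: "finite B" "span B = UNIV" using finite_dim_span by blast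
  let ?C = "(\<lambda>a. (a, 0)) ` A \<union> (\<lambda>b. (0, b)) ` B :: ('a \<times> 'b) set"
  have l1: "linear (\<lambda>a::'a. (a, 0::'b))" and l2: "linear (\<lambda>b::'b. (0::'a, b))"
    by (auto intro!: linearI)
  have "(a, b) \<in> span ?C" for a :: 'a and b :: 'b
  proof -
    have "(a, 0) \<in> (\<lambda>a. (a, 0)) ` span A" "(0, b) \<in> (\<lambda>b. (0, b)) ` span B"
      using A B by auto
    moreover have "(\<lambda>a. (a, 0)) ` span A \<subseteq> span ?C" "(\<lambda>b. (0, b)) ` span B \<subseteq> span ?C"
      unfolding linear_span_image[OF l1, symmetric] linear_span_image[OF l2, symmetric]
      by (rule span_mono, simp)+
    ultimately have "(a, 0) \<in> span ?C" "(0, b) \<in> span ?C" by blast+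
    then have "(a, 0) + (0, b) \<in> span ?C" by (rule span_add)
    then show ?thesis by simp
  qed
  then have "span ?C = UNIV" by auto
  with A B show "\<exists>C :: ('a \<times> 'b) set. finite C \<and> (\<forall>x. \<exists>u. x = (\<Sum>c\<in>C. u c *\<^sub>R c))"
    by (intro finite_dimI[of ?C]) auto
qed

text \<open>For open \<open>S\<close> in a finite-dimensional space this is the usual notion of class \<open>C\<^sup>k\<close>:
  all directional derivatives of order at most \<open>k\<close> exist and are continuous.\<close>

primrec Ck_on :: "nat \<Rightarrow> 'a::real_normed_vector set \<Rightarrow> ('a \<Rightarrow> 'b::real_normed_vector) \<Rightarrow> bool"
  where
    "Ck_on 0 S f \<longleftrightarrow> continuous_on S f"
  | "Ck_on (Suc k) S f \<longleftrightarrow>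
       (\<forall>x\<in>S. f differentiable (at x)) \<and>
       (\<forall>v. Ck_on k S (\<lambda>x. frechet_derivative f (at x) v))"

definition smooth_on :: "'a::real_normed_vector set \<Rightarrow> ('a \<Rightarrow> 'b::real_normed_vector) \<Rightarrow> bool"
  where "smooth_on S f \<longleftrightarrow> (\<forall>k. Ck_on k S f)"

text \<open>A manifold is given by an atlas of charts \<open>(U, \<phi>)\<close>; its points and its topology are determined
  by the atlas. Atlases are not required to be maximal.\<close>

type_synonym ('p, 'm) chart = "'p set \<times> ('p \<Rightarrow> 'm)"
type_synonym ('p, 'm) atlas = "('p, 'm) chart set"

definition points :: "('p, 'm) atlas \<Rightarrow> 'p set"
  where "points A = (\<Union>c\<in>A. fst c)"

definition chart_inv :: "('p, 'm) chart \<Rightarrow> 'm \<Rightarrow> 'p"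
  where "chart_inv c = inv_into (fst c) (snd c)"

definition smooth_atlas :: "('p, 'm::real_normed_vector) atlas \<Rightarrow> bool"
  where "smooth_atlas A \<longleftrightarrow>
    (\<forall>c\<in>A. inj_on (snd c) (fst c)) \<and>
    (\<forall>c\<in>A. \<forall>d\<in>A. open (snd c ` (fst c \<inter> fst d)) \<and>
       smooth_on (snd c ` (fst c \<inter> fst d)) (snd d \<circ> chart_inv c))"

definition atlas_topology :: "('p, 'm::real_normed_vector) atlas \<Rightarrow> 'p topology"
  where "atlas_topology A =
    topology (\<lambda>W. W \<subseteq> points A \<and> (\<forall>c\<in>A. open (snd c ` (fst c \<inter> W))))"

lemma openin_atlas_topology:
  assumes "smooth_atlas A"
  shows "openin (atlas_topology A) W \<longleftrightarrow>
    W \<subseteq> points A \<and> (\<forall>c\<in>A. open (snd c ` (fst c \<inter> W)))"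
proof -
  let ?L = "\<lambda>W. W \<subseteq> points A \<and> (\<forall>c\<in>A. open (snd c ` (fst c \<inter> W)))"
  have "?L (S \<inter> T)" if "?L S" "?L T" for S T
  proof -
    have "snd c ` (fst c \<inter> (S \<inter> T)) = snd c ` (fst c \<inter> S) \<inter> snd c ` (fst c \<inter> T)" if "c \<in> A" for c
    proof -
      have "inj_on (snd c) (fst c)"
        using assms that by (auto simp: smooth_atlas_def)
      then have "snd c ` ((fst c \<inter> S) \<inter> (fst c \<inter> T)) = snd c ` (fst c \<inter> S) \<inter> snd c ` (fst c \<inter> T)"
        by (rule inj_on_image_Int) auto
      moreover have "(fst c \<inter> S) \<inter> (fst c \<inter> T) = fst c \<inter> (S \<inter> T)" by blast
      ultimately show ?thesis by simp
    qed
    then show ?thesis using that by (auto intro!: open_Int)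
  qed
  moreover have "?L (\<Union>K)" if "\<forall>S\<in>K. ?L S" for K
  proof -
    have eq: "snd c ` (fst c \<inter> \<Union>K) = (\<Union>S\<in>K. snd c ` (fst c \<inter> S))" for c by blast
    have "open (snd c ` (fst c \<inter> \<Union>K))" if "c \<in> A" for c
      unfolding eq using that \<open>\<forall>S\<in>K. ?L S\<close> by (intro open_UN) blast
    then show ?thesis using that by blast
  qed
  ultimately have "istopology ?L" unfolding istopology_def by blast
  then show ?thesis unfolding atlas_topology_def by (simp add: topology_inverse')
qed

lemma topspace_atlas_topology:
  assumes "smooth_atlas A"
  shows "topspace (atlas_topology A) = points A"
proof
  show "topspace (atlas_topology A) \<subseteq> points A"
    using openin_topspace[of "atlas_topology A"] openin_atlas_topology[OF assms] by blast
  have "open (snd c ` (fst c \<inter> points A))" if "c \<in> A" for c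
  proof -
    have "fst c \<inter> points A = fst c \<inter> fst c" using that by (auto simp: points_def)
    moreover have "open (snd c ` (fst c \<inter> fst c))" using assms that unfolding smooth_atlas_def by blast
    ultimately show ?thesis by simp
  qed
  then have "openin (atlas_topology A) (points A)"
    unfolding openin_atlas_topology[OF assms] by blast
  then show "points A \<subseteq> topspace (atlas_topology A)" by (rule openin_subset)
qed

definition smooth_manifold :: "('p, 'm::finite_dim_inner) atlas \<Rightarrow> bool"
  where "smooth_manifold A \<longleftrightarrow> smooth_atlas A \<and>
    Hausdorff_space (atlas_topology A) \<and> second_countable (atlas_topology A)"

definition smooth_map ::
    "('p, 'm::real_normed_vector) atlas \<Rightarrow> ('q, 'n::real_normed_vector) atlas \<Rightarrow> ('p \<Rightarrow> 'q) \<Rightarrow> bool"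
  where "smooth_map A B f \<longleftrightarrow>
    continuous_map (atlas_topology A) (atlas_topology B) f \<and>
    (\<forall>c\<in>A. \<forall>d\<in>B. smooth_on (snd c ` (fst c \<inter> f -` fst d)) (snd d \<circ> f \<circ> chart_inv c))"

definition diffeo ::
    "('p, 'm::real_normed_vector) atlas \<Rightarrow> ('q, 'n::real_normed_vector) atlas \<Rightarrow> ('p \<Rightarrow> 'q) \<Rightarrow> bool"
  where "diffeo A B f \<longleftrightarrow> bij_betw f (points A) (points B) \<and>
    smooth_map A B f \<and> smooth_map B A (inv_into (points A) f)"

definition restrict_atlas :: "('p, 'm) atlas \<Rightarrow> 'p set \<Rightarrow> ('p, 'm) atlas"
  where "restrict_atlas A W = {(U \<inter> W, \<phi>) |U \<phi>. (U, \<phi>) \<in> A}"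

definition prod_atlas :: "('p, 'm) atlas \<Rightarrow> ('q, 'n) atlas \<Rightarrow> ('p \<times> 'q, 'm \<times> 'n) atlas"
  where "prod_atlas A B = {(U \<times> V, map_prod \<phi> \<psi>) |U \<phi> V \<psi>. (U, \<phi>) \<in> A \<and> (V, \<psi>) \<in> B}"

definition model_atlas :: "('f, 'f) atlas"
  where "model_atlas = {(UNIV, id)}"

text \<open>A tangent vector at \<open>p\<close> assigns to each chart around \<open>p\<close> its vector of components, and these
  transform by the derivative of the transition map. Outside the charts around \<open>p\<close> it is zero by
  convention, so that equality of tangent vectors is equality of functions; the vector space
  operations are chartwise. Elements of the tangent bundle are pairs \<open>(p, \<xi>)\<close>.\<close>

type_synonym ('p, 'm) tvec = "('p, 'm) chart \<Rightarrow> 'm"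

definition tangent_space :: "('p, 'm::real_normed_vector) atlas \<Rightarrow> 'p \<Rightarrow> ('p, 'm) tvec set"
  where "tangent_space A p =
    {\<xi>. (\<forall>c\<in>A. \<forall>d\<in>A. p \<in> fst c \<inter> fst d \<longrightarrow>
            \<xi> d = frechet_derivative (snd d \<circ> chart_inv c) (at (snd c p)) (\<xi> c)) \<and>
         (\<forall>c. \<not> (c \<in> A \<and> p \<in> fst c) \<longrightarrow> \<xi> c = 0)}"

definition tangent_atlas ::
    "('p, 'm::real_normed_vector) atlas \<Rightarrow> ('p \<times> ('p, 'm) tvec, 'm \<times> 'm) atlas"
  where "tangent_atlas A =
    {({(p, \<xi>). p \<in> fst c \<and> \<xi> \<in> tangent_space A p}, \<lambda>(p, \<xi>). (snd c p, \<xi> c)) |c. c \<in> A}"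

text \<open>The derivative at \<open>p\<close> of a vector-valued function \<open>g\<close>, defined near \<open>p\<close>, in the direction of
  the tangent vector \<open>\<xi>\<close>; the result does not depend on the chosen chart.\<close>

definition differential ::
    "('p, 'm::real_normed_vector) atlas \<Rightarrow> ('p \<Rightarrow> 'n::real_normed_vector) \<Rightarrow> 'p \<Rightarrow> ('p, 'm) tvec \<Rightarrow> 'n"
  where "differential A g p \<xi> =
    (let c = (SOME c. c \<in> A \<and> p \<in> fst c)
     in frechet_derivative (g \<circ> chart_inv c) (at (snd c p)) (\<xi> c))"

definition tangent_map ::
    "('p, 'm::real_normed_vector) atlas \<Rightarrow> ('q, 'n::real_normed_vector) atlas \<Rightarrow> ('p \<Rightarrow> 'q) \<Rightarrow>
     'p \<Rightarrow> ('p, 'm) tvec \<Rightarrow> ('q, 'n) tvec"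
  where "tangent_map A B f p \<xi> =
    (\<lambda>d. if d \<in> B \<and> f p \<in> fst d then differential A (snd d \<circ> f) p \<xi> else 0)"

definition velocity ::
    "('p, 'm::real_normed_vector) atlas \<Rightarrow> (real \<Rightarrow> 'p) \<Rightarrow> real \<Rightarrow> ('p, 'm) tvec"
  where "velocity A \<gamma> t =
    (\<lambda>c. if c \<in> A \<and> \<gamma> t \<in> fst c then vector_derivative (\<lambda>r. snd c (\<gamma> r)) (at t) else 0)"

text \<open>In each chart, \<open>[X, Y]\<^sup>i = X(Y\<^sup>i) - Y(X\<^sup>i)\<close>.\<close>

definition lie_bracket ::
    "('p, 'm::real_normed_vector) atlas \<Rightarrow> ('p \<Rightarrow> ('p, 'm) tvec) \<Rightarrow> ('p \<Rightarrow> ('p, 'm) tvec) \<Rightarrow>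
     'p \<Rightarrow> ('p, 'm) tvec"
  where "lie_bracket A X Y p =
    (\<lambda>c. if c \<in> A \<and> p \<in> fst c
         then differential A (\<lambda>q. Y q c) p (X p) - differential A (\<lambda>q. X q c) p (Y p)
         else 0)"

text \<open>In the type parameters, \<open>'p\<close> stands for the points of the base, \<open>'b\<close> for the points and
  \<open>'n\<close> for the model space of the total space, \<open>'f\<close> for the typical fibre, and \<open>'c\<close> for the
  points of the total space of the model vector bundle of an affine bundle.\<close>

record ('p, 'b, 'n) fbundle =
  total_atlas :: "('b, 'n) atlas"
  bproj :: "'b \<Rightarrow> 'p"

record ('p, 'b, 'n, 'f) vbundle = "('p, 'b, 'n) fbundle" +
  vadd :: "'b \<Rightarrow> 'b \<Rightarrow> 'b"
  vscale :: "real \<Rightarrow> 'b \<Rightarrow> 'b"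
  vtrivs :: "('p set \<times> ('b \<Rightarrow> 'f)) set"

record ('p, 'b, 'n, 'c) abundle = "('p, 'b, 'n) fbundle" +
  translate :: "'b \<Rightarrow> 'c \<Rightarrow> 'b"

definition fibre :: "('p, 'b, 'n, 'z) fbundle_scheme \<Rightarrow> 'p \<Rightarrow> 'b set"
  where "fibre B m = {e \<in> points (total_atlas B). bproj B e = m}"

definition Sec ::
    "('p, 'm::real_normed_vector) atlas \<Rightarrow> ('p, 'b, 'n::real_normed_vector, 'z) fbundle_scheme \<Rightarrow>
     ('p \<Rightarrow> 'b) set"
  where "Sec M B = {\<sigma>. smooth_map M (total_atlas B) \<sigma> \<and> (\<forall>m\<in>points M. bproj B (\<sigma> m) = m)}"

definition local_triv ::
    "('p, 'm::real_normed_vector) atlas \<Rightarrow> ('p, 'b, 'n::real_normed_vector, 'z) fbundle_scheme \<Rightarrow>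
     'p set \<Rightarrow> ('b \<Rightarrow> 'f::real_normed_vector) \<Rightarrow> bool"
  where "local_triv M B W \<Phi> \<longleftrightarrow> openin (atlas_topology M) W \<and>
    diffeo (restrict_atlas (total_atlas B) (bproj B -` W))
           (prod_atlas (restrict_atlas M W) model_atlas)
           (\<lambda>e. (bproj B e, \<Phi> e))"

definition vector_space_on :: "'b set \<Rightarrow> ('b \<Rightarrow> 'b \<Rightarrow> 'b) \<Rightarrow> (real \<Rightarrow> 'b \<Rightarrow> 'b) \<Rightarrow> bool"
  where "vector_space_on S add smul \<longleftrightarrow>
    (\<forall>x\<in>S. \<forall>y\<in>S. add x y \<in> S \<and> add x y = add y x) \<and>
    (\<forall>x\<in>S. \<forall>y\<in>S. \<forall>z\<in>S. add (add x y) z = add x (add y z)) \<and>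
    (\<exists>z\<in>S. \<forall>x\<in>S. add z x = x \<and> (\<exists>y\<in>S. add x y = z)) \<and>
    (\<forall>r. \<forall>x\<in>S. smul r x \<in> S) \<and>
    (\<forall>r. \<forall>x\<in>S. \<forall>y\<in>S. smul r (add x y) = add (smul r x) (smul r y)) \<and>
    (\<forall>r q. \<forall>x\<in>S. smul (r + q) x = add (smul r x) (smul q x) \<and>
        smul (r * q) x = smul r (smul q x)) \<and>
    (\<forall>x\<in>S. smul 1 x = x)"

definition affine_space_on ::
    "'b set \<Rightarrow> 'c set \<Rightarrow> ('b \<Rightarrow> 'c \<Rightarrow> 'b) \<Rightarrow> ('c \<Rightarrow> 'c \<Rightarrow> 'c) \<Rightarrow> bool"
  where "affine_space_on P S tr add \<longleftrightarrow> P \<noteq> {} \<and>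
    (\<forall>e\<in>P. \<forall>a\<in>S. tr e a \<in> P) \<and>
    (\<forall>e\<in>P. \<forall>a\<in>S. \<forall>b\<in>S. tr (tr e a) b = tr e (add a b)) \<and>
    (\<forall>e\<in>P. \<forall>e'\<in>P. \<exists>!a. a \<in> S \<and> tr e a = e')"

definition linear_triv ::
    "('p, 'm::real_normed_vector) atlas \<Rightarrow>
     ('p, 'b, 'n::real_normed_vector, 'f::real_normed_vector) vbundle \<Rightarrow>
     'p set \<Rightarrow> ('b \<Rightarrow> 'f) \<Rightarrow> bool"
  where "linear_triv M B W \<Phi> \<longleftrightarrow> local_triv M B W \<Phi> \<and>
    (\<forall>m\<in>W. \<forall>a\<in>fibre B m. (\<forall>b\<in>fibre B m. \<Phi> (vadd B a b) = \<Phi> a + \<Phi> b) \<and>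
       (\<forall>r. \<Phi> (vscale B r a) = r *\<^sub>R \<Phi> a))"

definition vector_bundle ::
    "('p, 'm::finite_dim_inner) atlas \<Rightarrow>
     ('p, 'b, 'n::finite_dim_inner, 'f::finite_dim_inner) vbundle \<Rightarrow> bool"
  where "vector_bundle M B \<longleftrightarrow>
    smooth_manifold M \<and> smooth_manifold (total_atlas B) \<and>
    smooth_map (total_atlas B) M (bproj B) \<and>
    (\<forall>m\<in>points M. vector_space_on (fibre B m) (vadd B) (vscale B)) \<and>
    (\<forall>(W, \<Phi>)\<in>vtrivs B. linear_triv M B W \<Phi>) \<and>
    points M \<subseteq> (\<Union>(W, \<Phi>)\<in>vtrivs B. W)"

definition affine_bundle ::
    "('p, 'm::finite_dim_inner) atlas \<Rightarrow> ('p, 'b, 'n::finite_dim_inner, 'c) abundle \<Rightarrow>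
     ('p, 'c, 'k::finite_dim_inner, 'f::finite_dim_inner) vbundle \<Rightarrow> bool"
  where "affine_bundle M E Eb \<longleftrightarrow>
    vector_bundle M Eb \<and> smooth_manifold (total_atlas E) \<and>
    smooth_map (total_atlas E) M (bproj E) \<and>
    (\<forall>m\<in>points M. affine_space_on (fibre E m) (fibre Eb m) (translate E) (vadd Eb)) \<and>
    (\<forall>m\<in>points M. \<exists>W \<Phi> \<Phi>b. m \<in> W \<and> local_triv M E W \<Phi> \<and> linear_triv M Eb W \<Phi>b \<and>
       (\<forall>x\<in>W. \<forall>e\<in>fibre E x. \<forall>a\<in>fibre Eb x. \<Phi> (translate E e a) = \<Phi> e + \<Phi>b a))"

text \<open>A vector bundle, regarded as an affine bundle modelled on itself.\<close>

definition self_affine :: "('p, 'c, 'k, 'f) vbundle \<Rightarrow> ('p, 'c, 'k, 'c) abundle"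
  where "self_affine B = \<lparr>total_atlas = total_atlas B, bproj = bproj B, translate = vadd B\<rparr>"

text \<open>The fibre product \<open>B \<times>\<^sub>M V\<close> as the pullback of \<open>V\<close> along the projection of \<open>B\<close>: a chart of
  \<open>B\<close> together with the fibre coordinate of a local trivialization of \<open>V\<close>.\<close>

definition pullback_atlas ::
    "('p, 'b, 'n, 'z) fbundle_scheme \<Rightarrow> ('p, 'd, 'l, 'w) vbundle \<Rightarrow> ('b \<times> 'd, 'n \<times> 'w) atlas"
  where "pullback_atlas B V =
    {({(e, v). e \<in> U \<and> bproj B e \<in> W \<and> v \<in> fibre V (bproj B e)}, map_prod \<phi> \<Psi>) |U \<phi> W \<Psi>.
       (U, \<phi>) \<in> total_atlas B \<and> (W, \<Psi>) \<in> vtrivs V}"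

definition fibre_linear ::
    "('p, 'd, 'l, 'w) vbundle \<Rightarrow> 'p \<Rightarrow> ('d \<Rightarrow> ('q, 'n::real_vector) tvec) \<Rightarrow> bool"
  where "fibre_linear V m L \<longleftrightarrow>
    (\<forall>v\<in>fibre V m. (\<forall>w\<in>fibre V m. L (vadd V v w) = (\<lambda>c. L v c + L w c)) \<and>
       (\<forall>r. L (vscale V r v) = (\<lambda>c. r *\<^sub>R L v c)))"

definition anchor ::
    "('p, 'm::real_normed_vector) atlas \<Rightarrow> ('p, 'd, 'l::real_normed_vector, 'w) vbundle \<Rightarrow>
     ('d \<Rightarrow> ('p, 'm) tvec) \<Rightarrow> bool"
  where "anchor M V \<rho> \<longleftrightarrow>
    smooth_map (total_atlas V) (tangent_atlas M) (\<lambda>v. (bproj V v, \<rho> v)) \<and>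
    (\<forall>m\<in>points M. fibre_linear V m \<rho>)"

definition rho_connection ::
    "('p, 'm::real_normed_vector) atlas \<Rightarrow>
     ('p, 'd, 'l::real_normed_vector, 'w::real_normed_vector) vbundle \<Rightarrow>
     ('d \<Rightarrow> ('p, 'm) tvec) \<Rightarrow> ('p, 'b, 'n::real_normed_vector, 'z) fbundle_scheme \<Rightarrow>
     ('b \<Rightarrow> 'd \<Rightarrow> ('b, 'n) tvec) \<Rightarrow> bool"
  where "rho_connection M V \<rho> B h \<longleftrightarrow>
    smooth_map (pullback_atlas B V) (tangent_atlas (total_atlas B)) (\<lambda>(e, v). (e, h e v)) \<and>
    (\<forall>e\<in>points (total_atlas B). fibre_linear V (bproj B e) (h e) \<and>
       (\<forall>v\<in>fibre V (bproj B e). tangent_map (total_atlas B) M (bproj B) e (h e v) = \<rho> v))"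

text \<open>The connection coefficients over \<open>m\<close> with respect to fibre coordinates \<open>\<Phi>\<close> on the bundle and
  \<open>\<Psi>\<close> on the anchored bundle: the \<open>\<Phi>\<close>-component of \<open>h(e, v)\<close>, where \<open>e\<close> and \<open>v\<close> are the points
  over \<open>m\<close> with coordinates \<open>y\<close> and \<open>w\<close>. Inserting basis vectors for \<open>w\<close> gives the
  coefficients with indices.\<close>

definition conn_coeff ::
    "('p, 'd, 'l, 'w) vbundle \<Rightarrow> ('p, 'b, 'n::real_normed_vector, 'z) fbundle_scheme \<Rightarrow>
     ('b \<Rightarrow> 'd \<Rightarrow> ('b, 'n) tvec) \<Rightarrow> ('b \<Rightarrow> 'f::real_normed_vector) \<Rightarrow> ('d \<Rightarrow> 'w) \<Rightarrow>
     'p \<Rightarrow> 'f \<Rightarrow> 'w \<Rightarrow> 'f"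
  where "conn_coeff V B h \<Phi> \<Psi> m y w =
    (let e = inv_into (fibre B m) \<Phi> y; v = inv_into (fibre V m) \<Psi> w
     in differential (total_atlas B) \<Phi> e (h e v))"

definition linear_rho_connection ::
    "('p, 'm::real_normed_vector) atlas \<Rightarrow>
     ('p, 'd, 'l::real_normed_vector, 'w::real_normed_vector) vbundle \<Rightarrow>
     ('d \<Rightarrow> ('p, 'm) tvec) \<Rightarrow> ('p, 'c, 'k::real_normed_vector, 'f::real_normed_vector) vbundle \<Rightarrow>
     ('c \<Rightarrow> 'd \<Rightarrow> ('c, 'k) tvec) \<Rightarrow> bool"
  where "linear_rho_connection M V \<rho> B h \<longleftrightarrow> rho_connection M V \<rho> B h \<and>
    (\<forall>(W, \<Phi>)\<in>vtrivs B. \<forall>(W', \<Psi>)\<in>vtrivs V. \<forall>m\<in>W \<inter> W'. \<forall>w.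
       linear (\<lambda>y. conn_coeff V B h \<Phi> \<Psi> m y w))"

text \<open>\<open>h\<close> is affine, with associated linear connection \<open>hb\<close>. A pair \<open>(X, Y)\<close> of tangent vectors with
  the same projection to \<open>TM\<close> is identified with the unique tangent vector \<open>\<zeta>\<close> of the fibre product
  whose projections are \<open>X\<close> and \<open>Y\<close>.\<close>

definition affine_rho_connection ::
    "('p, 'm::real_normed_vector) atlas \<Rightarrow>
     ('p, 'd, 'l::real_normed_vector, 'w::real_normed_vector) vbundle \<Rightarrow>
     ('d \<Rightarrow> ('p, 'm) tvec) \<Rightarrow> ('p, 'b, 'n::real_normed_vector, 'c) abundle \<Rightarrow>
     ('p, 'c, 'k::real_normed_vector, 'f::real_normed_vector) vbundle \<Rightarrow>
     ('b \<Rightarrow> 'd \<Rightarrow> ('b, 'n) tvec) \<Rightarrow> ('c \<Rightarrow> 'd \<Rightarrow> ('c, 'k) tvec) \<Rightarrow> bool"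
  where "affine_rho_connection M V \<rho> E Eb h hb \<longleftrightarrow>
    rho_connection M V \<rho> E h \<and> linear_rho_connection M V \<rho> Eb hb \<and>
    (\<forall>m\<in>points M. \<forall>e\<in>fibre E m. \<forall>a\<in>fibre Eb m. \<forall>v\<in>fibre V m.
       \<exists>\<zeta>\<in>tangent_space (pullback_atlas E Eb) (e, a).
         tangent_map (pullback_atlas E Eb) (total_atlas E) fst (e, a) \<zeta> = h e v \<and>
         tangent_map (pullback_atlas E Eb) (total_atlas Eb) snd (e, a) \<zeta> = hb a v \<and>
         h (translate E e a) v =
           tangent_map (pullback_atlas E Eb) (total_atlas E) (\<lambda>(x, y). translate E x y) (e, a) \<zeta>)"

definition hor_field ::
    "('p, 'b, 'n, 'z) fbundle_scheme \<Rightarrow> ('b \<Rightarrow> 'd \<Rightarrow> ('b, 'n) tvec) \<Rightarrow> ('p \<Rightarrow> 'd) \<Rightarrow>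
     'b \<Rightarrow> ('b, 'n) tvec"
  where "hor_field B h s e = h e (s (bproj B e))"

definition vlift ::
    "('p, 'b, 'n::real_normed_vector, 'c) abundle \<Rightarrow> ('p, 'c, 'k, 'f) vbundle \<Rightarrow>
     'b \<Rightarrow> 'c \<Rightarrow> ('b, 'n) tvec"
  where "vlift E Eb e a = velocity (total_atlas E) (\<lambda>t. translate E e (vscale Eb t a)) 0"

definition point_diff ::
    "('p, 'b, 'n, 'c) abundle \<Rightarrow> ('p, 'c, 'k, 'f) vbundle \<Rightarrow> 'b \<Rightarrow> 'b \<Rightarrow> 'c"
  where "point_diff E Eb e' e = (THE a. a \<in> fibre Eb (bproj E e) \<and> translate E e a = e')"

definition vlift_vsec ::
    "('p, 'b, 'n::real_normed_vector, 'c) abundle \<Rightarrow> ('p, 'c, 'k, 'f) vbundle \<Rightarrow>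
     ('p \<Rightarrow> 'c) \<Rightarrow> 'b \<Rightarrow> ('b, 'n) tvec"
  where "vlift_vsec E Eb \<sigma>b e = vlift E Eb e (\<sigma>b (bproj E e))"

definition vlift_asec ::
    "('p, 'b, 'n::real_normed_vector, 'c) abundle \<Rightarrow> ('p, 'c, 'k, 'f) vbundle \<Rightarrow>
     ('p \<Rightarrow> 'b) \<Rightarrow> 'b \<Rightarrow> ('b, 'n) tvec"
  where "vlift_asec E Eb \<sigma> e = vlift E Eb e (point_diff E Eb (\<sigma> (bproj E e)) e)"

definition vertical ::
    "('p, 'm::real_normed_vector) atlas \<Rightarrow> ('p, 'b, 'n::real_normed_vector, 'z) fbundle_scheme \<Rightarrow>
     'b \<Rightarrow> ('b, 'n) tvec \<Rightarrow> bool"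
  where "vertical M B e Q \<longleftrightarrow> Q \<in> tangent_space (total_atlas B) e \<and>
    tangent_map (total_atlas B) M (bproj B) e Q = (\<lambda>_. 0)"

definition vert_part ::
    "('p, 'b, 'n::real_normed_vector, 'c) abundle \<Rightarrow> ('p, 'c, 'k, 'f) vbundle \<Rightarrow>
     'b \<Rightarrow> ('b, 'n) tvec \<Rightarrow> 'c"
  where "vert_part E Eb e Q = (THE a. a \<in> fibre Eb (bproj E e) \<and> vlift E Eb e a = Q)"

definition nabla ::
    "('p, 'm::real_normed_vector) atlas \<Rightarrow> ('d \<Rightarrow> ('p, 'm) tvec) \<Rightarrow>
     ('p, 'b, 'n::real_normed_vector, 'c) abundle \<Rightarrow> ('p, 'c, 'k, 'f) vbundle \<Rightarrow>
     ('b \<Rightarrow> 'd \<Rightarrow> ('b, 'n) tvec) \<Rightarrow> ('p \<Rightarrow> 'd) \<Rightarrow> ('p \<Rightarrow> 'b) \<Rightarrow> 'p \<Rightarrow> 'c"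
  where "nabla M \<rho> E Eb h s \<sigma> m =
    vert_part E Eb (\<sigma> m)
      (\<lambda>c. tangent_map M (total_atlas E) \<sigma> m (\<rho> (s m)) c - h (\<sigma> m) (s m) c)"

definition nabla_bar ::
    "('p, 'm::real_normed_vector) atlas \<Rightarrow> ('d \<Rightarrow> ('p, 'm) tvec) \<Rightarrow>
     ('p, 'c, 'k::real_normed_vector, 'f) vbundle \<Rightarrow>
     ('c \<Rightarrow> 'd \<Rightarrow> ('c, 'k) tvec) \<Rightarrow> ('p \<Rightarrow> 'd) \<Rightarrow> ('p \<Rightarrow> 'c) \<Rightarrow> 'p \<Rightarrow> 'c"
  where "nabla_bar M \<rho> Eb hb = nabla M \<rho> (self_affine Eb) Eb hb"

end

theory Submission
  imports Defs
begin

text \<open>For a \<open>C\<^sup>2\<close> function \<open>g\<close> on \<open>E\<close> with values in a vector space, symmetry of second derivatives gives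
  \<open>dg([X, Y]) = X(dg(Y)) - Y(dg(X))\<close> (\<open>differential_lie_bracket\<close>). Everything follows by choosing \<open>g\<close>.
  Charts of \<open>E\<close> show that the bracket is a tangent vector. Charts of \<open>M\<close> composed with \<open>\<pi>\<close> show that it
  is vertical: there \<open>dg(Y) = 0\<close> because \<open>Y\<close> is a vertical lift, and \<open>dg(X)\<close> is constant along the fibres
  because \<open>X = hs\<close> projects to the section \<open>\<rho>(s)\<close> (\<open>bracket_vertical\<close>).

  The vertical part is read off with \<open>g = \<Phi>\<close>, the fibre coordinate of an affine trivialization whose
  linear part is \<open>\<Phi>b\<close>, so that \<open>\<Phi>(e + a) = \<Phi> e + \<Phi>b a\<close>. Let \<open>Y\<close> be the field \<open>q \<mapsto> v(q, b q)\<close>, where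
  \<open>b q\<close> is \<open>\<sigma>b(\<pi> q)\<close> or \<open>\<sigma>(\<pi> q) - q\<close>. Then \<open>d\<Phi>(Y) = \<Phi>b \<circ> b\<close>. For \<open>H = d\<Phi>(X)\<close> the defining identity of an
  affine connection says \<open>H(q + a) = H q + \<beta> a\<close> on the fibre through \<open>e\<close>, with \<open>\<beta> a = d\<Phi>b(hb(a, s))\<close>
  (\<open>affine_connection_components\<close>). Hence \<open>t \<mapsto> \<beta>(t a)\<close> is additive and differentiable at \<open>0\<close>, so its
  derivative there is \<open>\<beta> a\<close>, and \<open>d\<Phi>([X, Y]) = X(\<Phi>b \<circ> b) - \<beta>(b e)\<close> (\<open>bracket_fibre_component\<close>).

  Write \<open>m = \<pi> e\<close>. For \<open>b = \<sigma>b \<circ> \<pi>\<close> the value is \<open>d\<Phi>b(T\<sigma>b(\<rho> s) - hb(\<sigma>b m, s))\<close>. For \<open>b = \<sigma> \<circ> \<pi> - id\<close> it is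
  \<open>d\<Phi>(T\<sigma>(\<rho> s)) - H e - \<beta>(\<sigma> m - e)\<close>, which equals \<open>d\<Phi>(T\<sigma>(\<rho> s) - h(\<sigma> m, s))\<close> because \<open>H e + \<beta>(\<sigma> m - e) = H(\<sigma> m)\<close>.
  A vertical vector \<open>Q\<close> is determined by its base point and \<open>d\<Phi>(Q)\<close>, and \<open>d\<Phi>(v(e, a)) = \<Phi>b a\<close>; so the
  vertical part of \<open>Q\<close> is the element \<open>a\<close> of the fibre with \<open>\<Phi>b a = d\<Phi>(Q)\<close> (\<open>vert_part_eq_THE\<close>). The
  covariant derivative at \<open>m\<close> and the vertical part of the bracket at \<open>e\<close> thus have the same
  description, although they are vertical parts at different points of \<open>E\<close>.\<close>

section \<open>Second derivatives\<close>

abbreviation fderiv :: "('a::real_normed_vector \<Rightarrow> 'b::real_normed_vector) \<Rightarrow> 'a \<Rightarrow> 'a \<Rightarrow> 'b"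
  where "fderiv f x \<equiv> frechet_derivative f (at x)"

lemma fderiv_eqI: "(f has_derivative f') (at x) \<Longrightarrow> fderiv f x = f'"
  using frechet_derivative_at by metis

lemma fderiv_works: "f differentiable (at x) \<Longrightarrow> (f has_derivative fderiv f x) (at x)"
  using frechet_derivative_works by blast

lemma has_derivative_transform_ev:
  assumes "eventually (\<lambda>y. f y = g y) (nhds x)" "(f has_derivative f') (at x)"
  shows "(g has_derivative f') (at x)"
proof -
  obtain S where "open S" "x \<in> S" "\<forall>y\<in>S. f y = g y"
    using assms(1) unfolding eventually_nhds by blast
  then show ?thesis using has_derivative_transform_within_open[OF assms(2)] by metis
qed

lemma fderiv_cong:
  assumes "eventually (\<lambda>y. f y = g y) (nhds x)"
  shows "fderiv f x = fderiv g x"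
proof -
  have "eventually (\<lambda>y. g y = f y) (nhds x)"
    using assms by (rule eventually_mono) simp
  then have "(f has_derivative f') (at x) \<longleftrightarrow> (g has_derivative f') (at x)" for f'
    using has_derivative_transform_ev assms by metis
  then show ?thesis unfolding frechet_derivative_def by simp
qed

lemma differentiable_cong_ev:
  assumes "eventually (\<lambda>y. f y = g y) (nhds x)" "f differentiable (at x)"
  shows "g differentiable (at x)"
  using assms has_derivative_transform_ev unfolding differentiable_def by blast

lemma eventually_nhds_isCont:
  assumes "isCont r z" "open S" "r z \<in> S"
  shows "eventually (\<lambda>y. r y \<in> S) (nhds z)"
  using assms by (auto simp: eventually_nhds_conv_at continuous_within intro: topological_tendstoD)

lemma Ck_on_cong:
  assumes "open S" "\<And>x. x \<in> S \<Longrightarrow> f x = g x" "Ck_on k S f"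
  shows "Ck_on k S g"
  using assms(2,3)
proof (induction k arbitrary: f g)
  case 0
  then show ?case using continuous_on_cong[of S S f g] by simp
next
  case (Suc k)
  have ev: "eventually (\<lambda>y. f y = g y) (nhds x)" if "x \<in> S" for x
    unfolding eventually_nhds using assms(1) Suc.prems(1) that by blast
  have "g differentiable (at x)" if "x \<in> S" for x
    using differentiable_cong_ev[OF ev[OF that]] Suc.prems(2) that unfolding Ck_on.simps by blast
  moreover have "Ck_on k S (\<lambda>x. fderiv g x v)" for v
  proof (rule Suc.IH)
    show "fderiv f x v = fderiv g x v" if "x \<in> S" for x
      using fderiv_cong[OF ev[OF that]] by simp
    show "Ck_on k S (\<lambda>x. fderiv f x v)" using Suc.prems(2) by simp
  qed
  ultimately show ?case by simp
qed

lemma Ck_on_bounded_linear: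
  assumes "open S" "bounded_linear L" "Ck_on k S f"
  shows "Ck_on k S (\<lambda>x. L (f x))"
  using assms(3)
proof (induction k arbitrary: f)
  case 0
  then show ?case
    using bounded_linear.continuous_on[OF assms(2)] by simp
next
  case (Suc k)
  have der: "((\<lambda>x. L (f x)) has_derivative (\<lambda>v. L (fderiv f x v))) (at x)" if "x \<in> S" for x
    using bounded_linear.has_derivative[OF assms(2) fderiv_works] Suc.prems that by auto
  have "Ck_on k S (\<lambda>x. fderiv (\<lambda>x. L (f x)) x v)" for v
  proof (rule Ck_on_cong[OF assms(1)])
    show "L (fderiv f x v) = fderiv (\<lambda>x. L (f x)) x v" if "x \<in> S" for x
      using fderiv_eqI[OF der[OF that]] by simp
    show "Ck_on k S (\<lambda>x. L (fderiv f x v))" using Suc.IH Suc.prems by simp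
  qed
  then show ?case using der by (auto simp: differentiable_def)
qed

lemma Ck_on_2D:
  assumes "Ck_on 2 S g" "x \<in> S"
  shows "g differentiable (at x)" "(\<lambda>y. fderiv g y v) differentiable (at x)"
  using assms by (auto simp: numeral_2_eq_2)

text \<open>By the mean value theorem in the direction \<open>u\<close>, the second difference is \<open>h\<close> times an increment
  of \<open>y \<mapsto> Dg(y) u\<close> over \<open>h v\<close>, and differentiability of \<open>y \<mapsto> Dg(y) u\<close> at \<open>x\<close> makes
  that increment \<open>h (P v)\<close> up to \<open>o(h)\<close>.\<close>

lemma second_difference_tendsto:
  fixes g :: "'a::real_normed_vector \<Rightarrow> real"
  assumes "open S" "x \<in> S" and diff: "\<And>y. y \<in> S \<Longrightarrow> g differentiable (at y)"
    and P: "((\<lambda>y. fderiv g y u) has_derivative P) (at x)"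
  shows "((\<lambda>h. (g (x + h *\<^sub>R u + h *\<^sub>R v) - g (x + h *\<^sub>R u) - g (x + h *\<^sub>R v) + g x) / h\<^sup>2)
    \<longlongrightarrow> P v) (at_right 0)"
proof (rule tendstoI)
  fix e :: real assume "e > 0"
  define p where "p = (\<lambda>y. fderiv g y u)"
  \<comment> \<open>for \<open>0 \<le> z \<le> h\<close> the points \<open>a = z u + h v\<close> and \<open>b = z u\<close> below satisfy
    \<open>norm a + norm b \<le> h (2 norm u + norm v) < h N\<close>\<close>
  define N where "N = 2 * norm u + norm v + 1"
  have "N > 0" by (simp add: N_def add_nonneg_pos)
  obtain r where r: "r > 0" "ball x r \<subseteq> S"
    using assms(1,2) openE by blast
  have lin: "linear P" using P has_derivative_linear by blast
  have "e / N > 0" using \<open>e > 0\<close> \<open>N > 0\<close> by simp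
  then obtain d where d: "d > 0"
    "\<And>y. norm (y - x) < d \<Longrightarrow> norm (p y - p x - P (y - x)) \<le> e / N * norm (y - x)"
    using P unfolding has_derivative_at_alt p_def by blast
  define d0 where "d0 = min d r / N"
  have "d0 > 0" using d r \<open>N > 0\<close> by (simp add: d0_def)
  have "dist ((g (x + h *\<^sub>R u + h *\<^sub>R v) - g (x + h *\<^sub>R u) - g (x + h *\<^sub>R v) + g x) / h\<^sup>2) (P v) < e"
    if h: "0 < h" "h < d0" for h
  proof -
    have hN: "h * N < min d r" using h \<open>N > 0\<close> by (simp add: d0_def field_simps)
    have small: "norm (s *\<^sub>R u + t *\<^sub>R v) \<le> h * (norm u + norm v)" if "0 \<le> s" "s \<le> h" "0 \<le> t" "t \<le> h" for s t
    proof -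
      have "norm (s *\<^sub>R u + t *\<^sub>R v) \<le> s * norm u + t * norm v"
        using norm_triangle_ineq[of "s *\<^sub>R u" "t *\<^sub>R v"] that by simp
      also have "\<dots> \<le> h * norm u + h * norm v" using that by (intro add_mono mult_right_mono) auto
      finally show ?thesis by (simp add: algebra_simps)
    qed
    have "h * (norm u + norm v) \<le> h * N" using h by (simp add: N_def)
    then have near: "norm (s *\<^sub>R u + t *\<^sub>R v) < min d r" if "0 \<le> s" "s \<le> h" "0 \<le> t" "t \<le> h" for s t
      using small[OF that] hN by linarith
    have S: "x + s *\<^sub>R u + t *\<^sub>R v \<in> S" if "0 \<le> s" "s \<le> h" "0 \<le> t" "t \<le> h" for s t
      using near[OF that] r(2) by (auto simp: subset_iff dist_norm add.assoc norm_minus_commute)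
    have gd: "((\<lambda>s. g (x + s *\<^sub>R u + t *\<^sub>R v)) has_real_derivative p (x + s *\<^sub>R u + t *\<^sub>R v)) (at s)"
      if "0 \<le> s" "s \<le> h" "0 \<le> t" "t \<le> h" for s t
    proof -
      have *: "((\<lambda>s. x + s *\<^sub>R u + t *\<^sub>R v) has_derivative (\<lambda>k. k *\<^sub>R u)) (at s)"
        by (auto intro!: derivative_eq_intros)
      have g': "(g has_derivative fderiv g (x + s *\<^sub>R u + t *\<^sub>R v)) (at (x + s *\<^sub>R u + t *\<^sub>R v))"
        by (rule fderiv_works[OF diff[OF S[OF that]]])
      have "((\<lambda>s. g (x + s *\<^sub>R u + t *\<^sub>R v)) has_derivative
          (\<lambda>k. fderiv g (x + s *\<^sub>R u + t *\<^sub>R v) (k *\<^sub>R u))) (at s)"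
        using has_derivative_compose[OF * g'] .
      moreover have "fderiv g (x + s *\<^sub>R u + t *\<^sub>R v) (k *\<^sub>R u) = p (x + s *\<^sub>R u + t *\<^sub>R v) * k" for k
        using linear_scale[OF has_derivative_linear[OF g']] by (simp add: p_def mult.commute)
      ultimately show ?thesis by (simp add: has_field_derivative_def)
    qed
    define f where "f = (\<lambda>s. g (x + s *\<^sub>R u + h *\<^sub>R v) - g (x + s *\<^sub>R u))"
    have "(f has_real_derivative p (x + s *\<^sub>R u + h *\<^sub>R v) - p (x + s *\<^sub>R u)) (at s)"
      if "0 \<le> s" "s \<le> h" for s
      using DERIV_diff[OF gd[OF that, of h] gd[OF that, of 0]] h by (simp add: f_def)
    then obtain z where z: "z > 0" "z < h"
      "f h - f 0 = (h - 0) * (p (x + z *\<^sub>R u + h *\<^sub>R v) - p (x + z *\<^sub>R u))"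
      using MVT2[of 0 h f "\<lambda>s. p (x + s *\<^sub>R u + h *\<^sub>R v) - p (x + s *\<^sub>R u)"] h by auto
    define R where "R = (\<lambda>k. p (x + k) - p x - P k)"
    have R: "\<bar>R k\<bar> \<le> e / N * norm k" if "norm k < d" for k
      using d(2)[of "x + k"] that by (simp add: R_def)
    define a where "a = z *\<^sub>R u + h *\<^sub>R v"
    define b where "b = z *\<^sub>R u"
    have ab: "norm a < d" "norm b < d" "norm a \<le> h * (norm u + norm v)" "norm b \<le> h * norm u"
      using near[of z h] near[of z 0] small[of z h] z h by (auto simp: a_def b_def mult_right_mono)
    have "P a - P b = h * P v"
      using linear_add[OF lin] linear_scale[OF lin] by (simp add: a_def b_def)
    then have fh: "f h - f 0 = h * (R a - R b + h * P v)"
      using z(3) by (simp add: R_def a_def b_def add.assoc)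
    have "(f h - f 0) / h\<^sup>2 - P v = (R a - R b) / h"
      unfolding fh using h by (simp add: power2_eq_square field_simps)
    moreover have "\<bar>R a - R b\<bar> \<le> e / N * (norm a + norm b)"
      using R[OF ab(1)] R[OF ab(2)] by (simp add: distrib_left)
    moreover have "e / N * (norm a + norm b) \<le> e / N * (h * (2 * norm u + norm v))"
      using ab \<open>e / N > 0\<close> by (intro mult_left_mono) (auto simp: algebra_simps)
    moreover have "e / N * (h * (2 * norm u + norm v)) < e * h"
      using \<open>e > 0\<close> h \<open>N > 0\<close> by (simp add: N_def field_simps)
    ultimately have "(f h - f 0) / h\<^sup>2 - P v = (R a - R b) / h" "\<bar>R a - R b\<bar> < e * h" by linarith+
    then have "\<bar>(f h - f 0) / h\<^sup>2 - P v\<bar> < e"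
      using h by (simp add: pos_divide_less_eq)
    moreover have "f h - f 0 = g (x + h *\<^sub>R u + h *\<^sub>R v) - g (x + h *\<^sub>R u) - g (x + h *\<^sub>R v) + g x"
      by (simp add: f_def)
    ultimately show ?thesis by (simp only: dist_real_def)
  qed
  then show "eventually (\<lambda>h. dist ((g (x + h *\<^sub>R u + h *\<^sub>R v) - g (x + h *\<^sub>R u) - g (x + h *\<^sub>R v) + g x) / h\<^sup>2) (P v) < e) (at_right 0)"
    using \<open>d0 > 0\<close> unfolding eventually_at_right_field by blast
qed

text \<open>The second difference quotient is symmetric in \<open>u\<close> and \<open>v\<close>, so its two limits agree. Taking inner
  products with fixed vectors reduces the statement to real-valued \<open>g\<close>.\<close>

lemma second_derivative_symmetric:
  fixes g :: "'a::real_normed_vector \<Rightarrow> 'b::real_inner"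
  assumes "open S" "x \<in> S" and diff: "\<And>y. y \<in> S \<Longrightarrow> g differentiable (at y)"
    and P: "((\<lambda>y. fderiv g y u) has_derivative P) (at x)"
    and Q: "((\<lambda>y. fderiv g y v) has_derivative Q) (at x)"
  shows "P v = Q u"
proof -
  have "P v \<bullet> w = Q u \<bullet> w" for w
  proof -
    have D: "((\<lambda>y. g y \<bullet> w) has_derivative (\<lambda>k. fderiv g y k \<bullet> w)) (at y)" if "y \<in> S" for y
      using fderiv_works[OF diff[OF that]] by (auto intro!: derivative_eq_intros)
    have E: "((\<lambda>y. fderiv (\<lambda>y. g y \<bullet> w) y k) has_derivative (\<lambda>l. K l \<bullet> w)) (at x)"
      if "((\<lambda>y. fderiv g y k) has_derivative K) (at x)" for k K
    proof (rule has_derivative_transform_within_open[OF _ assms(1,2)])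
      show "((\<lambda>y. fderiv g y k \<bullet> w) has_derivative (\<lambda>l. K l \<bullet> w)) (at x)"
        using that by (auto intro!: derivative_eq_intros)
    qed (simp add: fderiv_eqI[OF D])
    have dg: "\<And>y. y \<in> S \<Longrightarrow> (\<lambda>y. g y \<bullet> w) differentiable (at y)"
      using D by (auto simp: differentiable_def)
    note 1 = second_difference_tendsto[OF assms(1,2) dg E[OF P], of v]
    note 2 = second_difference_tendsto[OF assms(1,2) dg E[OF Q], of u]
    have "(\<lambda>h. (g (x + h *\<^sub>R v + h *\<^sub>R u) \<bullet> w - g (x + h *\<^sub>R v) \<bullet> w - g (x + h *\<^sub>R u) \<bullet> w + g x \<bullet> w) / h\<^sup>2)
      = (\<lambda>h. (g (x + h *\<^sub>R u + h *\<^sub>R v) \<bullet> w - g (x + h *\<^sub>R u) \<bullet> w - g (x + h *\<^sub>R v) \<bullet> w + g x \<bullet> w) / h\<^sup>2)"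
      by (simp add: algebra_simps)
    with 2 have "((\<lambda>h. (g (x + h *\<^sub>R u + h *\<^sub>R v) \<bullet> w - g (x + h *\<^sub>R u) \<bullet> w - g (x + h *\<^sub>R v) \<bullet> w + g x \<bullet> w) / h\<^sup>2)
        \<longlongrightarrow> Q u \<bullet> w) (at_right 0)" by simp
    then show ?thesis using tendsto_unique[OF _ 1] by simp
  qed
  then show ?thesis
    by (metis inner_diff_left inner_eq_zero_iff right_minus_eq)
qed

text \<open>Coordinates with respect to an orthogonal basis are bounded linear; this allows the derivative
  \<open>Dg(y) w\<close> to be expanded over finitely many fixed directions \<open>w\<close>.\<close>

lemma finite_dim_coordinates:
  "\<exists>B (u :: 'a::finite_dim_inner \<Rightarrow> 'a \<Rightarrow> real).
    finite B \<and> (\<forall>b. bounded_linear (u b)) \<and> (\<forall>x. x = (\<Sum>b\<in>B. u b x *\<^sub>R b))"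
proof -
  obtain A :: "'a set" where A: "finite A" "span A = UNIV" using finite_dim_span by blast
  obtain B :: "'a set" where B: "finite B" "span B = UNIV" "pairwise orthogonal B"
    using basis_orthogonal[OF A(1)] A(2) by auto
  define u where "u = (\<lambda>b x :: 'a. (x \<bullet> b) / (b \<bullet> b))"
  have "bounded_linear (u b)" for b
    unfolding u_def by (intro bounded_linear_divide[THEN bounded_linear_compose] bounded_linear_inner_left)
  moreover have "x = (\<Sum>b\<in>B. u b x *\<^sub>R b)" for x
  proof -
    have "x \<in> range (\<lambda>a. \<Sum>b\<in>B. a b *\<^sub>R b)" using B(2) span_finite[OF B(1)] by auto
    then obtain a where a: "x = (\<Sum>b\<in>B. a b *\<^sub>R b)" by auto
    have "u c x *\<^sub>R c = a c *\<^sub>R c" if c: "c \<in> B" for c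
    proof -
      have "x \<bullet> c = (\<Sum>b\<in>B. a b * (b \<bullet> c))" unfolding a by (simp add: inner_sum_left)
      also have "\<dots> = (\<Sum>b\<in>B. if b = c then a c * (c \<bullet> c) else 0)"
        using B(3) c by (intro sum.cong) (auto simp: pairwise_def orthogonal_def)
      also have "\<dots> = a c * (c \<bullet> c)" using c B(1) by simp
      finally show ?thesis by (cases "c = 0") (simp_all add: u_def)
    qed
    then have "(\<Sum>b\<in>B. u b x *\<^sub>R b) = (\<Sum>b\<in>B. a b *\<^sub>R b)" by (rule sum.cong[OF refl])
    then show ?thesis using a by simp
  qed
  ultimately show ?thesis using B(1) by blast
qed

text \<open>The product rule for the pairing \<open>(y, w) \<mapsto> Dg(y) w\<close> along a curve of base points \<open>r\<close> and vectors \<open>u\<close>.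
  Since \<open>C\<^sup>k\<close> is formulated by directional derivatives in fixed directions, the varying vector is
  first expanded in a basis.\<close>

lemma has_derivative_directional:
  fixes g :: "'a::finite_dim_inner \<Rightarrow> 'b::real_normed_vector"
    and r u :: "'c::real_normed_vector \<Rightarrow> 'a"
  assumes "open S" and g: "Ck_on 2 S g" and "r z \<in> S"
    and r: "(r has_derivative r') (at z)" and u: "(u has_derivative u') (at z)"
  shows "((\<lambda>y. fderiv g (r y) (u y)) has_derivative
    (\<lambda>k. fderiv (\<lambda>y. fderiv g y (u z)) (r z) (r' k) + fderiv g (r z) (u' k))) (at z)"
proof -
  obtain B and c :: "'a \<Rightarrow> 'a \<Rightarrow> real" where B: "finite B" "\<And>b. bounded_linear (c b)"
    "\<And>x. x = (\<Sum>b\<in>B. c b x *\<^sub>R b)"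
    using finite_dim_coordinates by blast
  have expand: "fderiv g y w = (\<Sum>b\<in>B. c b w *\<^sub>R fderiv g y b)" if "y \<in> S" for y w
  proof -
    have lin: "linear (fderiv g y)"
      using has_derivative_linear[OF fderiv_works[OF Ck_on_2D(1)[OF g that]]] .
    have "fderiv g y (\<Sum>b\<in>B. c b w *\<^sub>R b) = (\<Sum>b\<in>B. c b w *\<^sub>R fderiv g y b)"
      by (simp add: linear_sum[OF lin] linear_scale[OF lin])
    then show ?thesis using B(3)[of w] by simp
  qed
  have dd: "((\<lambda>y. fderiv g y b) has_derivative fderiv (\<lambda>y. fderiv g y b) (r z)) (at (r z))" for b
    by (rule fderiv_works[OF Ck_on_2D(2)[OF g \<open>r z \<in> S\<close>]])
  have expand2: "fderiv (\<lambda>y. fderiv g y w) (r z) k = (\<Sum>b\<in>B. c b w *\<^sub>R fderiv (\<lambda>y. fderiv g y b) (r z) k)" for w k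
  proof -
    have "((\<lambda>y. \<Sum>b\<in>B. c b w *\<^sub>R fderiv g y b) has_derivative
        (\<lambda>k. \<Sum>b\<in>B. c b w *\<^sub>R fderiv (\<lambda>y. fderiv g y b) (r z) k)) (at (r z))"
      by (intro has_derivative_sum has_derivative_scaleR_right dd)
    then have "((\<lambda>y. fderiv g y w) has_derivative
        (\<lambda>k. \<Sum>b\<in>B. c b w *\<^sub>R fderiv (\<lambda>y. fderiv g y b) (r z) k)) (at (r z))"
      by (rule has_derivative_transform_within_open[OF _ assms(1,3)]) (simp add: expand[symmetric])
    then show ?thesis by (simp add: fderiv_eqI)
  qed
  have "((\<lambda>y. \<Sum>b\<in>B. c b (u y) *\<^sub>R fderiv g (r y) b) has_derivative
      (\<lambda>k. \<Sum>b\<in>B. c b (u z) *\<^sub>R fderiv (\<lambda>y. fderiv g y b) (r z) (r' k)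
          + c b (u' k) *\<^sub>R fderiv g (r z) b)) (at z)"
    by (intro has_derivative_sum has_derivative_scaleR bounded_linear.has_derivative[OF B(2) u]
        has_derivative_compose[OF r dd])
  moreover have "(\<lambda>k. \<Sum>b\<in>B. c b (u z) *\<^sub>R fderiv (\<lambda>y. fderiv g y b) (r z) (r' k)
          + c b (u' k) *\<^sub>R fderiv g (r z) b)
      = (\<lambda>k. fderiv (\<lambda>y. fderiv g y (u z)) (r z) (r' k) + fderiv g (r z) (u' k))"
    by (simp add: sum.distrib expand2[of "u z", symmetric] expand[OF \<open>r z \<in> S\<close>, symmetric])
  ultimately have *: "((\<lambda>y. \<Sum>b\<in>B. c b (u y) *\<^sub>R fderiv g (r y) b) has_derivative
    (\<lambda>k. fderiv (\<lambda>y. fderiv g y (u z)) (r z) (r' k) + fderiv g (r z) (u' k))) (at z)" by simp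
  have "isCont r z" using r has_derivative_continuous by blast
  then have ev: "eventually (\<lambda>y. r y \<in> S) (nhds z)"
    using eventually_nhds_isCont[of z r S] assms(1,3) by blast
  have "eventually (\<lambda>y. (\<Sum>b\<in>B. c b (u y) *\<^sub>R fderiv g (r y) b) = fderiv g (r y) (u y)) (nhds z)"
    by (rule eventually_mono[OF ev]) (rule expand[symmetric])
  then show ?thesis by (rule has_derivative_transform_ev[OF _ *])
qed

text \<open>The second-order terms \<open>D\<^sup>2g(X, Y)\<close> and \<open>D\<^sup>2g(Y, X)\<close> cancel; what remains of the two product rules
  is \<open>Dg\<close> applied to the bracket in coordinates.\<close>

lemma fderiv_bracket:
  fixes g :: "'a::finite_dim_inner \<Rightarrow> 'b::real_inner"
  assumes "open S" and g: "Ck_on 2 S g" and "z \<in> S"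
    and X: "X differentiable (at z)" and Y: "Y differentiable (at z)"
  shows "fderiv (\<lambda>y. fderiv g y (Y y)) z (X z) - fderiv (\<lambda>y. fderiv g y (X y)) z (Y z)
    = fderiv g z (fderiv Y z (X z) - fderiv X z (Y z))"
proof -
  have lin: "linear (fderiv g z)"
    using has_derivative_linear[OF fderiv_works[OF Ck_on_2D(1)[OF g \<open>z \<in> S\<close>]]] .
  note D = has_derivative_directional[OF \<open>open S\<close> g, of "\<lambda>y. y", OF \<open>z \<in> S\<close> has_derivative_ident fderiv_works]
  have "fderiv (\<lambda>y. fderiv g y (Y z)) z (X z) = fderiv (\<lambda>y. fderiv g y (X z)) z (Y z)"
    by (rule second_derivative_symmetric[OF \<open>open S\<close> \<open>z \<in> S\<close> Ck_on_2D(1)[OF g]])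
      (auto intro!: fderiv_works Ck_on_2D(2)[OF g \<open>z \<in> S\<close>])
  then show ?thesis
    by (simp add: fderiv_eqI[OF D[OF Y]] fderiv_eqI[OF D[OF X]] linear_diff[OF lin])
qed

section \<open>Differentiable maps and tangent vectors\<close>

text \<open>Injectivity of the charts alone makes the chartwise open sets a topology. In this form the
  description of open sets applies directly to the product and restricted atlases that occur in local
  trivializations.\<close>

lemma openin_injective_atlas:
  assumes inj: "\<And>c. c \<in> A \<Longrightarrow> inj_on (snd c) (fst c)"
  shows "openin (atlas_topology A) W \<longleftrightarrow>
    W \<subseteq> points A \<and> (\<forall>c\<in>A. open (snd c ` (fst c \<inter> W)))"
proof -
  let ?L = "\<lambda>W. W \<subseteq> points A \<and> (\<forall>c\<in>A. open (snd c ` (fst c \<inter> W)))"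
  have "?L (S \<inter> T)" if "?L S" "?L T" for S T
  proof -
    have "snd c ` (fst c \<inter> (S \<inter> T)) = snd c ` (fst c \<inter> S) \<inter> snd c ` (fst c \<inter> T)" if "c \<in> A" for c
      using inj_on_image_Int[OF inj[OF that], of "fst c \<inter> S" "fst c \<inter> T"]
      by (simp add: Int_assoc Int_left_commute)
    then show ?thesis using that by (auto intro!: open_Int)
  qed
  moreover have "?L (\<Union>K)" if K: "\<forall>S\<in>K. ?L S" for K
  proof -
    have *: "snd c ` (fst c \<inter> \<Union>K) = (\<Union>S\<in>K. snd c ` (fst c \<inter> S))" for c by blast
    have "open (snd c ` (fst c \<inter> \<Union>K))" if "c \<in> A" for c
      unfolding * using that K by (intro open_UN) blast
    then show ?thesis using K by blast
  qed
  ultimately have "istopology ?L" unfolding istopology_def by blast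
  then show ?thesis unfolding atlas_topology_def by (simp add: topology_inverse')
qed

lemma chart_inv_apply:
  "inj_on (snd c) (fst c) \<Longrightarrow> p \<in> fst c \<Longrightarrow> chart_inv c (snd c p) = p"
  unfolding chart_inv_def by (rule inv_into_f_f)

lemma smooth_onD: "smooth_on S f \<Longrightarrow> x \<in> S \<Longrightarrow> f differentiable (at x)"
  unfolding smooth_on_def by (metis Ck_on.simps(2))

text \<open>Maps from a normed space into a manifold are the basic notion of differentiability here, since
  curves, inverse charts and sections in a chart are all of this kind. The first condition on a chart is
  continuity at \<open>x\<close>, expressed by the chart domains.\<close>

definition diff_into ::
    "('q, 'n::real_normed_vector) atlas \<Rightarrow> ('a::real_normed_vector \<Rightarrow> 'q) \<Rightarrow> 'a \<Rightarrow> bool"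
  where "diff_into B k x \<longleftrightarrow> k x \<in> points B \<and>
    (\<forall>d\<in>B. k x \<in> fst d \<longrightarrow>
      eventually (\<lambda>y. k y \<in> fst d) (nhds x) \<and> (\<lambda>y. snd d (k y)) differentiable (at x))"

text \<open>The value of the derivative of \<open>k\<close> at \<open>x\<close> on \<open>u\<close>, as a tangent vector at \<open>k x\<close>. Both velocities of
  curves and tangent maps are instances.\<close>

definition pushforward ::
    "('q, 'n::real_normed_vector) atlas \<Rightarrow> ('a::real_normed_vector \<Rightarrow> 'q) \<Rightarrow> 'a \<Rightarrow> 'a \<Rightarrow> ('q, 'n) tvec"
  where "pushforward B k x u = (\<lambda>d. if d \<in> B \<and> k x \<in> fst d then fderiv (\<lambda>y. snd d (k y)) x u else 0)"

definition diff_fun ::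
    "('p, 'm::real_normed_vector) atlas \<Rightarrow> ('p \<Rightarrow> 'a::real_normed_vector) \<Rightarrow> 'p \<Rightarrow> bool"
  where "diff_fun A g p \<longleftrightarrow>
    (\<forall>c\<in>A. p \<in> fst c \<longrightarrow> (\<lambda>z. g (chart_inv c z)) differentiable (at (snd c p)))"

definition diff_map ::
    "('p, 'm::real_normed_vector) atlas \<Rightarrow> ('q, 'n::real_normed_vector) atlas \<Rightarrow> ('p \<Rightarrow> 'q) \<Rightarrow> 'p \<Rightarrow> bool"
  where "diff_map A B f p \<longleftrightarrow>
    (\<forall>c\<in>A. p \<in> fst c \<longrightarrow> diff_into B (\<lambda>z. f (chart_inv c z)) (snd c p))"

lemma smooth_atlas_inj: "smooth_atlas A \<Longrightarrow> c \<in> A \<Longrightarrow> inj_on (snd c) (fst c)"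
  unfolding smooth_atlas_def by blast

lemma smooth_atlas_chart_inv:
  "smooth_atlas A \<Longrightarrow> c \<in> A \<Longrightarrow> p \<in> fst c \<Longrightarrow> chart_inv c (snd c p) = p"
  using chart_inv_apply smooth_atlas_inj by metis

lemma smooth_atlas_overlap:
  "smooth_atlas A \<Longrightarrow> c \<in> A \<Longrightarrow> d \<in> A \<Longrightarrow> open (snd c ` (fst c \<inter> fst d))"
  unfolding smooth_atlas_def by blast

lemma smooth_atlas_transition:
  "smooth_atlas A \<Longrightarrow> c \<in> A \<Longrightarrow> d \<in> A \<Longrightarrow> smooth_on (snd c ` (fst c \<inter> fst d)) (snd d \<circ> chart_inv c)"
  unfolding smooth_atlas_def by blast

lemma openin_atlas_chart:
  assumes "smooth_atlas A" "c \<in> A"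
  shows "openin (atlas_topology A) (fst c)"
  unfolding openin_atlas_topology[OF assms(1)]
  using smooth_atlas_overlap[OF assms(1) _ assms(2)] assms(2) by (auto simp: points_def)

lemma tangent_spaceI:
  assumes "\<And>c d. c \<in> A \<Longrightarrow> d \<in> A \<Longrightarrow> p \<in> fst c \<Longrightarrow> p \<in> fst d \<Longrightarrow>
      \<xi> d = fderiv (\<lambda>z. snd d (chart_inv c z)) (snd c p) (\<xi> c)"
    and "\<And>c. \<not> (c \<in> A \<and> p \<in> fst c) \<Longrightarrow> \<xi> c = 0"
  shows "\<xi> \<in> tangent_space A p"
  using assms unfolding tangent_space_def o_def by blast

lemma tangent_spaceD:
  assumes "\<xi> \<in> tangent_space A p"
  shows "\<And>c d. c \<in> A \<Longrightarrow> d \<in> A \<Longrightarrow> p \<in> fst c \<Longrightarrow> p \<in> fst d \<Longrightarrow>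
      \<xi> d = fderiv (\<lambda>z. snd d (chart_inv c z)) (snd c p) (\<xi> c)"
    and "\<And>c. \<not> (c \<in> A \<and> p \<in> fst c) \<Longrightarrow> \<xi> c = 0"
  using assms unfolding tangent_space_def o_def by blast+

lemma diff_into_chart_inv:
  assumes A: "smooth_atlas A" and c: "c \<in> A" and p: "p \<in> fst c"
  shows "diff_into A (chart_inv c) (snd c p)"
proof -
  note inv = smooth_atlas_chart_inv[OF A c]
  have "eventually (\<lambda>y. chart_inv c y \<in> fst d) (nhds (snd c p))"
    "(\<lambda>y. snd d (chart_inv c y)) differentiable (at (snd c p))" if d: "d \<in> A" "p \<in> fst d" for d
  proof -
    have "snd c p \<in> snd c ` (fst c \<inter> fst d)" using p d by blast
    moreover have "\<forall>y\<in>snd c ` (fst c \<inter> fst d). chart_inv c y \<in> fst d" using inv by auto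
    ultimately show "eventually (\<lambda>y. chart_inv c y \<in> fst d) (nhds (snd c p))"
      using smooth_atlas_overlap[OF A c d(1)] unfolding eventually_nhds by blast
    show "(\<lambda>y. snd d (chart_inv c y)) differentiable (at (snd c p))"
      using smooth_onD[OF smooth_atlas_transition[OF A c d(1)]] p d(2) by (auto simp: o_def)
  qed
  then show ?thesis using c p inv[OF p] by (auto simp: diff_into_def points_def)
qed

text \<open>The chain rule, from which the independence of all constructions of the chosen charts follows.\<close>

lemma diff_into_compose_chart:
  assumes B: "smooth_atlas B" and k: "diff_into B k x" and d: "d \<in> B" "k x \<in> fst d"
    and g: "(\<lambda>z. g (chart_inv d z)) differentiable (at (snd d (k x)))"
  shows "((\<lambda>y. g (k y)) has_derivative
    (\<lambda>u. fderiv (\<lambda>z. g (chart_inv d z)) (snd d (k x)) (pushforward B k x u d))) (at x)"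
proof -
  have k': "eventually (\<lambda>y. k y \<in> fst d) (nhds x)" "(\<lambda>y. snd d (k y)) differentiable (at x)"
    using k d unfolding diff_into_def by blast+
  have "((\<lambda>y. g (chart_inv d (snd d (k y)))) has_derivative
    (\<lambda>u. fderiv (\<lambda>z. g (chart_inv d z)) (snd d (k x)) (fderiv (\<lambda>y. snd d (k y)) x u))) (at x)"
    using has_derivative_compose[OF fderiv_works[OF k'(2)] fderiv_works[OF g]] .
  moreover have "eventually (\<lambda>y. g (chart_inv d (snd d (k y))) = g (k y)) (nhds x)"
    by (rule eventually_mono[OF k'(1)]) (simp add: smooth_atlas_chart_inv[OF B d(1)])
  ultimately show ?thesis
    using has_derivative_transform_ev[of "\<lambda>y. g (chart_inv d (snd d (k y)))"] d by (simp add: pushforward_def)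
qed

lemma pushforward_in_tangent_space:
  assumes B: "smooth_atlas B" and k: "diff_into B k x"
  shows "pushforward B k x u \<in> tangent_space B (k x)"
proof -
  show ?thesis
  proof (rule tangent_spaceI)
    fix c d assume c: "c \<in> B" and d: "d \<in> B" and kc: "k x \<in> fst c" and kd: "k x \<in> fst d"
    have "(\<lambda>z. snd d (chart_inv c z)) differentiable (at (snd c (k x)))"
      using diff_into_chart_inv[OF B c kc] d kd smooth_atlas_chart_inv[OF B c kc] by (simp add: diff_into_def)
    from fderiv_eqI[OF diff_into_compose_chart[OF B k c kc, of "snd d", OF this]] d kd
    show "pushforward B k x u d = fderiv (\<lambda>z. snd d (chart_inv c z)) (snd c (k x)) (pushforward B k x u c)"
      by (simp add: pushforward_def)
  qed (auto simp: pushforward_def)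
qed

lemma diff_funI:
  assumes A: "smooth_atlas A" and c: "c \<in> A" "p \<in> fst c"
    and g: "(\<lambda>z. g (chart_inv c z)) differentiable (at (snd c p))"
  shows "diff_fun A g p"
  unfolding diff_fun_def
proof (intro ballI impI)
  fix d assume d: "d \<in> A" "p \<in> fst d"
  note inv = smooth_atlas_chart_inv[OF A d]
  show "(\<lambda>z. g (chart_inv d z)) differentiable (at (snd d p))"
    using diff_into_compose_chart[OF A diff_into_chart_inv[OF A d] c(1), of g] c g
    unfolding inv differentiable_def by blast
qed

text \<open>The chart in the definition of the differential is arbitrary; for a vector that obeys the
  transformation law of tangent vectors, each other chart gives the same value.\<close>

lemma differential_chart:
  assumes A: "smooth_atlas A" and \<xi>: "\<xi> \<in> tangent_space A p" and c: "c \<in> A" "p \<in> fst c"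
    and g: "diff_fun A g p"
  shows "differential A g p \<xi> = fderiv (\<lambda>z. g (chart_inv c z)) (snd c p) (\<xi> c)"
proof -
  define d where "d = (SOME c. c \<in> A \<and> p \<in> fst c)"
  have d: "d \<in> A" "p \<in> fst d" using someI[of "\<lambda>c. c \<in> A \<and> p \<in> fst c" c] c by (auto simp: d_def)
  note inv = smooth_atlas_chart_inv[OF A d]
  have "(\<lambda>z. g (chart_inv c z)) differentiable (at (snd c p))" using g c by (auto simp: diff_fun_def)
  with fderiv_eqI[OF diff_into_compose_chart[OF A diff_into_chart_inv[OF A d] c(1), of g]]
  have "fderiv (\<lambda>z. g (chart_inv d z)) (snd d p) =
    (\<lambda>u. fderiv (\<lambda>z. g (chart_inv c z)) (snd c p) (pushforward A (chart_inv d) (snd d p) u c))"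
    using c by (simp add: inv)
  moreover have "pushforward A (chart_inv d) (snd d p) (\<xi> d) c = \<xi> c"
    using tangent_spaceD(1)[OF \<xi> d(1) c(1) d(2) c(2)] c by (simp add: pushforward_def inv)
  ultimately show ?thesis by (simp add: differential_def Let_def d_def[symmetric] o_def)
qed

lemma has_derivative_diff_fun:
  assumes B: "smooth_atlas B" and k: "diff_into B k x" and g: "diff_fun B g (k x)"
  shows "((\<lambda>y. g (k y)) has_derivative (\<lambda>u. differential B g (k x) (pushforward B k x u))) (at x)"
proof -
  obtain d where d: "d \<in> B" "k x \<in> fst d" using k by (auto simp: diff_into_def points_def)
  then have "(\<lambda>z. g (chart_inv d z)) differentiable (at (snd d (k x)))" using g by (simp add: diff_fun_def)
  from diff_into_compose_chart[OF B k d, of g, OF this] show ?thesis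
    using differential_chart[OF B pushforward_in_tangent_space[OF B k] d g] by simp
qed

lemma diff_fun_chart:
  assumes B: "smooth_atlas B" and d: "d \<in> B" "p \<in> fst d"
  shows "diff_fun B (snd d) p"
  using diff_into_chart_inv[OF B] d smooth_atlas_chart_inv[OF B]
  by (auto simp: diff_fun_def diff_into_def)

lemma diff_fun_diff_map:
  assumes B: "smooth_atlas B" and f: "diff_map A B f p" and g: "diff_fun B g (f p)" and A: "smooth_atlas A"
  shows "diff_fun A (\<lambda>q. g (f q)) p"
  using f g has_derivative_diff_fun[OF B] smooth_atlas_chart_inv[OF A]
  unfolding diff_fun_def[of A] diff_map_def differentiable_def by metis

text \<open>For atlases whose transition maps are not at hand, such as that of a fibre product, this fixes the
  chart selected in the definition of the tangent map; it is the same chart for all maps at \<open>p\<close>.\<close>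

lemma tangent_map_some_chart:
  assumes c: "c = (SOME c. c \<in> A \<and> p \<in> fst c)" and inv: "chart_inv c (snd c p) = p"
  shows "tangent_map A B f p \<xi> = pushforward B (\<lambda>z. f (chart_inv c z)) (snd c p) (\<xi> c)"
  using inv by (auto simp: tangent_map_def pushforward_def differential_def Let_def c[symmetric] o_def)

lemma tangent_map_chart:
  assumes A: "smooth_atlas A" and B: "smooth_atlas B" and \<xi>: "\<xi> \<in> tangent_space A p"
    and c: "c \<in> A" "p \<in> fst c" and f: "diff_map A B f p"
  shows "tangent_map A B f p \<xi> = pushforward B (\<lambda>z. f (chart_inv c z)) (snd c p) (\<xi> c)"
proof
  fix d
  have "differential A (\<lambda>q. snd d (f q)) p \<xi> = fderiv (\<lambda>z. snd d (f (chart_inv c z))) (snd c p) (\<xi> c)"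
    if d: "d \<in> B" "f p \<in> fst d"
    by (rule differential_chart[OF A \<xi> c diff_fun_diff_map[OF B f diff_fun_chart[OF B d] A]])
  then show "tangent_map A B f p \<xi> d = pushforward B (\<lambda>z. f (chart_inv c z)) (snd c p) (\<xi> c) d"
    by (simp add: tangent_map_def pushforward_def o_def smooth_atlas_chart_inv[OF A c])
qed

lemma tangent_map_in_tangent_space:
  assumes A: "smooth_atlas A" and B: "smooth_atlas B" and \<xi>: "\<xi> \<in> tangent_space A p"
    and p: "p \<in> points A" and f: "diff_map A B f p"
  shows "tangent_map A B f p \<xi> \<in> tangent_space B (f p)"
proof -
  obtain c where c: "c \<in> A" "p \<in> fst c" using p by (auto simp: points_def)
  then have "diff_into B (\<lambda>z. f (chart_inv c z)) (snd c p)" using f by (auto simp: diff_map_def)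
  from pushforward_in_tangent_space[OF B this, of "\<xi> c"] show ?thesis
    using tangent_map_chart[OF A B \<xi> c f] smooth_atlas_chart_inv[OF A c] by simp
qed

lemma differential_tangent_map:
  assumes A: "smooth_atlas A" and B: "smooth_atlas B" and \<xi>: "\<xi> \<in> tangent_space A p"
    and p: "p \<in> points A" and f: "diff_map A B f p" and g: "diff_fun B g (f p)"
  shows "differential B g (f p) (tangent_map A B f p \<xi>) = differential A (\<lambda>q. g (f q)) p \<xi>"
proof -
  obtain c where c: "c \<in> A" "p \<in> fst c" using p by (auto simp: points_def)
  note inv = smooth_atlas_chart_inv[OF A c]
  have "diff_into B (\<lambda>z. f (chart_inv c z)) (snd c p)" using f c by (auto simp: diff_map_def)
  from fderiv_eqI[OF has_derivative_diff_fun[OF B this, of g]] g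
  have "fderiv (\<lambda>z. g (f (chart_inv c z))) (snd c p) (\<xi> c)
    = differential B g (f p) (pushforward B (\<lambda>z. f (chart_inv c z)) (snd c p) (\<xi> c))"
    by (simp add: inv)
  then show ?thesis
    using tangent_map_chart[OF A B \<xi> c f] differential_chart[OF A \<xi> c diff_fun_diff_map[OF B f g A]] by simp
qed

lemma tangent_map_pushforward:
  assumes A: "smooth_atlas A" and B: "smooth_atlas B" and k: "diff_into A k x"
    and f: "diff_map A B f (k x)"
  shows "diff_into B (\<lambda>y. f (k y)) x"
    and "tangent_map A B f (k x) (pushforward A k x u) = pushforward B (\<lambda>y. f (k y)) x u"
proof -
  obtain c where c: "c \<in> A" "k x \<in> fst c" using k by (auto simp: diff_into_def points_def)
  note inv = smooth_atlas_chart_inv[OF A c]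
  have fc: "diff_into B (\<lambda>z. f (chart_inv c z)) (snd c (k x))" using f c by (auto simp: diff_map_def)
  have kc: "eventually (\<lambda>y. k y \<in> fst c) (nhds x)" "isCont (\<lambda>y. snd c (k y)) x"
    using k c differentiable_imp_continuous_within by (auto simp: diff_into_def)
  have der: "((\<lambda>y. snd d (f (k y))) has_derivative (\<lambda>u. differential A (\<lambda>q. snd d (f q)) (k x) (pushforward A k x u))) (at x)"
    if d: "d \<in> B" "f (k x) \<in> fst d" for d
    by (rule has_derivative_diff_fun[OF A k diff_fun_diff_map[OF B f diff_fun_chart[OF B d] A]])
  have "eventually (\<lambda>y. f (k y) \<in> fst d) (nhds x)" if d: "d \<in> B" "f (k x) \<in> fst d" for d
  proof -
    have "eventually (\<lambda>z. f (chart_inv c z) \<in> fst d) (nhds (snd c (k x)))"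
      using fc d inv by (auto simp: diff_into_def)
    then obtain S where S: "open S" "snd c (k x) \<in> S" "\<forall>z\<in>S. f (chart_inv c z) \<in> fst d"
      unfolding eventually_nhds by blast
    have "eventually (\<lambda>y. snd c (k y) \<in> S) (nhds x)"
      using eventually_nhds_isCont[of x "\<lambda>y. snd c (k y)" S] kc(2) S by blast
    with kc(1) show ?thesis
      by (rule eventually_elim2) (use S(3) smooth_atlas_chart_inv[OF A c(1)] in force)
  qed
  then show "diff_into B (\<lambda>y. f (k y)) x"
    using fc inv der unfolding diff_into_def differentiable_def by (metis (no_types, lifting))
  show "tangent_map A B f (k x) (pushforward A k x u) = pushforward B (\<lambda>y. f (k y)) x u"
  proof
    fix d
    show "tangent_map A B f (k x) (pushforward A k x u) d = pushforward B (\<lambda>y. f (k y)) x u d"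
      using fderiv_eqI[OF der[of d]] by (simp add: tangent_map_def pushforward_def[of B] o_def)
  qed
qed

lemma smooth_map_points:
  assumes "smooth_atlas A" "smooth_atlas B" "smooth_map A B f" "p \<in> points A"
  shows "f p \<in> points B"
  using assms topspace_atlas_topology[OF assms(1)] topspace_atlas_topology[OF assms(2)]
  by (auto simp: smooth_map_def continuous_map_def)

lemma smooth_map_openin_preimage:
  assumes A: "smooth_atlas A" and f: "smooth_map A B f" and W: "openin (atlas_topology B) W"
  shows "openin (atlas_topology A) {p \<in> points A. f p \<in> W}"
  using openin_continuous_map_preimage[OF _ W, of "atlas_topology A" f] f topspace_atlas_topology[OF A]
  by (simp add: smooth_map_def)

lemma smooth_map_openin:
  assumes A: "smooth_atlas A" and f: "smooth_map A B f"
    and W: "openin (atlas_topology B) W" and c: "c \<in> A"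
  shows "open (snd c ` (fst c \<inter> f -` W))"
proof -
  have "fst c \<inter> {p \<in> points A. f p \<in> W} = fst c \<inter> f -` W" using c by (auto simp: points_def)
  then show ?thesis
    using smooth_map_openin_preimage[OF A f W] c unfolding openin_atlas_topology[OF A] by force
qed

lemma smooth_map_diff_map:
  assumes A: "smooth_atlas A" and B: "smooth_atlas B" and f: "smooth_map A B f" and p: "p \<in> points A"
  shows "diff_map A B f p"
  unfolding diff_map_def
proof (intro ballI impI)
  fix c assume c: "c \<in> A" "p \<in> fst c"
  note inv = smooth_atlas_chart_inv[OF A c(1)]
  have "eventually (\<lambda>y. f (chart_inv c y) \<in> fst d) (nhds (snd c p))"
    "(\<lambda>y. snd d (f (chart_inv c y))) differentiable (at (snd c p))" if d: "d \<in> B" "f p \<in> fst d" for d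
  proof -
    have *: "snd c p \<in> snd c ` (fst c \<inter> f -` fst d)" using c d by blast
    moreover have "\<forall>y\<in>snd c ` (fst c \<inter> f -` fst d). f (chart_inv c y) \<in> fst d" using inv by auto
    moreover have "open (snd c ` (fst c \<inter> f -` fst d))"
      by (rule smooth_map_openin[OF A f openin_atlas_chart[OF B d(1)] c(1)])
    ultimately show "eventually (\<lambda>y. f (chart_inv c y) \<in> fst d) (nhds (snd c p))"
      unfolding eventually_nhds by blast
    have "smooth_on (snd c ` (fst c \<inter> f -` fst d)) (snd d \<circ> f \<circ> chart_inv c)"
      using f c d unfolding smooth_map_def by blast
    from smooth_onD[OF this *] show "(\<lambda>y. snd d (f (chart_inv c y))) differentiable (at (snd c p))"
      by (simp add: o_def)
  qed
  then show "diff_into B (\<lambda>z. f (chart_inv c z)) (snd c p)"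
    using inv[OF c(2)] smooth_map_points[OF A B f p] by (auto simp: diff_into_def)
qed

lemma tangent_space_diff:
  assumes A: "smooth_atlas A" and "\<xi> \<in> tangent_space A p" "\<eta> \<in> tangent_space A p"
  shows "(\<lambda>c. \<xi> c - \<eta> c) \<in> tangent_space A p"
proof -
  note D = tangent_spaceD[OF assms(2)] tangent_spaceD[OF assms(3)]
  show ?thesis
  proof (rule tangent_spaceI)
    fix c d assume c: "c \<in> A" "d \<in> A" "p \<in> fst c" "p \<in> fst d"
    then have "(snd d \<circ> chart_inv c) differentiable (at (snd c p))"
      by (intro smooth_onD[OF smooth_atlas_transition[OF A]]) auto
    then have "linear (fderiv (\<lambda>z. snd d (chart_inv c z)) (snd c p))"
      using has_derivative_linear[OF fderiv_works] by (simp add: o_def)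
    then show "\<xi> d - \<eta> d = fderiv (\<lambda>z. snd d (chart_inv c z)) (snd c p) (\<xi> c - \<eta> c)"
      by (simp only: linear_diff D(1)[OF c] D(3)[OF c])
  qed (simp add: D(2,4))
qed

lemma differential_diff:
  assumes A: "smooth_atlas A" and p: "p \<in> points A" and \<xi>: "\<xi> \<in> tangent_space A p"
    and \<eta>: "\<eta> \<in> tangent_space A p" and g: "diff_fun A g p"
  shows "differential A g p (\<lambda>c. \<xi> c - \<eta> c) = differential A g p \<xi> - differential A g p \<eta>"
proof -
  obtain c where c: "c \<in> A" "p \<in> fst c" using p by (auto simp: points_def)
  have "linear (fderiv (\<lambda>z. g (chart_inv c z)) (snd c p))"
    using g c by (intro has_derivative_linear[OF fderiv_works]) (auto simp: diff_fun_def)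
  then show ?thesis
    by (simp add: differential_chart[OF A \<xi> c g] differential_chart[OF A \<eta> c g]
      differential_chart[OF A tangent_space_diff[OF A \<xi> \<eta>] c g] linear_diff)
qed

lemma tangent_map_diff:
  assumes A: "smooth_atlas A" and B: "smooth_atlas B" and p: "p \<in> points A" and \<xi>: "\<xi> \<in> tangent_space A p"
    and \<eta>: "\<eta> \<in> tangent_space A p" and f: "diff_map A B f p"
  shows "tangent_map A B f p (\<lambda>c. \<xi> c - \<eta> c) = (\<lambda>d. tangent_map A B f p \<xi> d - tangent_map A B f p \<eta> d)"
proof
  fix d
  have "differential A (\<lambda>q. snd d (f q)) p (\<lambda>c. \<xi> c - \<eta> c)
      = differential A (\<lambda>q. snd d (f q)) p \<xi> - differential A (\<lambda>q. snd d (f q)) p \<eta>"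
    if d: "d \<in> B" "f p \<in> fst d"
    by (rule differential_diff[OF A p \<xi> \<eta> diff_fun_diff_map[OF B f diff_fun_chart[OF B d] A]])
  then show "tangent_map A B f p (\<lambda>c. \<xi> c - \<eta> c) d = tangent_map A B f p \<xi> d - tangent_map A B f p \<eta> d"
    by (simp add: tangent_map_def o_def)
qed

lemma differential_cong:
  assumes A: "smooth_atlas A" and N: "openin (atlas_topology A) N" "p \<in> N"
    and eq: "\<And>q. q \<in> N \<Longrightarrow> f q = g q"
  shows "differential A f p \<xi> = differential A g p \<xi>"
proof -
  define c where "c = (SOME c. c \<in> A \<and> p \<in> fst c)"
  have "\<exists>c. c \<in> A \<and> p \<in> fst c"
    using N openin_atlas_topology[OF A] unfolding points_def by blast
  then have c: "c \<in> A" "p \<in> fst c" using someI_ex[of "\<lambda>c. c \<in> A \<and> p \<in> fst c"] by (auto simp: c_def)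
  have "open (snd c ` (fst c \<inter> N))" "snd c p \<in> snd c ` (fst c \<inter> N)"
    using N c openin_atlas_topology[OF A] by blast+
  moreover have "\<forall>z\<in>snd c ` (fst c \<inter> N). f (chart_inv c z) = g (chart_inv c z)"
    using smooth_atlas_chart_inv[OF A c(1)] eq by auto
  ultimately have "fderiv (\<lambda>z. f (chart_inv c z)) (snd c p) = fderiv (\<lambda>z. g (chart_inv c z)) (snd c p)"
    by (intro fderiv_cong) (unfold eventually_nhds, blast)
  then show ?thesis by (simp add: differential_def Let_def c_def[symmetric] o_def)
qed

lemma diff_fun_cong:
  assumes A: "smooth_atlas A" and N: "openin (atlas_topology A) N" "p \<in> N"
    and f: "diff_fun A f p" and eq: "\<And>q. q \<in> N \<Longrightarrow> f q = g q"
  shows "diff_fun A g p"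
  unfolding diff_fun_def
proof (intro ballI impI)
  fix c assume c: "c \<in> A" "p \<in> fst c"
  have "open (snd c ` (fst c \<inter> N))" "snd c p \<in> snd c ` (fst c \<inter> N)"
    using N c openin_atlas_topology[OF A] by blast+
  moreover have "\<forall>z\<in>snd c ` (fst c \<inter> N). f (chart_inv c z) = g (chart_inv c z)"
    using smooth_atlas_chart_inv[OF A c(1)] eq by auto
  ultimately have "eventually (\<lambda>z. f (chart_inv c z) = g (chart_inv c z)) (nhds (snd c p))"
    unfolding eventually_nhds by blast
  then show "(\<lambda>z. g (chart_inv c z)) differentiable (at (snd c p))"
    by (rule differentiable_cong_ev) (use f c in \<open>simp add: diff_fun_def\<close>)
qed

lemma differential_const: "differential A (\<lambda>_. k) p \<xi> = 0"
  by (simp add: differential_def Let_def o_def fderiv_eqI[OF has_derivative_const])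

lemma differential_fun_diff:
  assumes A: "smooth_atlas A" and p: "p \<in> points A" and \<xi>: "\<xi> \<in> tangent_space A p"
    and f: "diff_fun A f p" and g: "diff_fun A g p"
  shows "diff_fun A (\<lambda>q. f q - g q) p"
    and "differential A (\<lambda>q. f q - g q) p \<xi> = differential A f p \<xi> - differential A g p \<xi>"
proof -
  show d: "diff_fun A (\<lambda>q. f q - g q) p" using f g by (simp add: diff_fun_def)
  obtain c where c: "c \<in> A" "p \<in> fst c" using p by (auto simp: points_def)
  have "((\<lambda>z. f (chart_inv c z) - g (chart_inv c z)) has_derivative
      (\<lambda>u. fderiv (\<lambda>z. f (chart_inv c z)) (snd c p) u - fderiv (\<lambda>z. g (chart_inv c z)) (snd c p) u))
      (at (snd c p))"
    using f g c by (intro has_derivative_diff fderiv_works) (simp_all add: diff_fun_def)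
  from fderiv_eqI[OF this] show "differential A (\<lambda>q. f q - g q) p \<xi> = differential A f p \<xi> - differential A g p \<xi>"
    by (simp add: differential_chart[OF A \<xi> c f] differential_chart[OF A \<xi> c g] differential_chart[OF A \<xi> c d])
qed

lemma differential_own_chart:
  assumes A: "smooth_atlas A" and \<xi>: "\<xi> \<in> tangent_space A p" and d: "d \<in> A" "p \<in> fst d"
  shows "differential A (snd d) p \<xi> = \<xi> d"
  using differential_chart[OF A \<xi> d diff_fun_chart[OF A d]] tangent_spaceD(1)[OF \<xi> d(1) d(1) d(2) d(2)]
  by simp

section \<open>The Lie bracket\<close>

text \<open>Open neighbourhoods are part of this notion, in contrast to differentiability at \<open>p\<close>, because
  second derivatives at \<open>p\<close> refer to first derivatives near \<open>p\<close>.\<close>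

definition C2_near ::
    "('p, 'm::real_normed_vector) atlas \<Rightarrow> ('p \<Rightarrow> 'a::real_normed_vector) \<Rightarrow> 'p \<Rightarrow> bool"
  where "C2_near A g p \<longleftrightarrow> (\<forall>c\<in>A. p \<in> fst c \<longrightarrow>
    (\<exists>S. open S \<and> snd c p \<in> S \<and> S \<subseteq> snd c ` fst c \<and> Ck_on 2 S (\<lambda>z. g (chart_inv c z))))"

text \<open>The field is tangent everywhere, but differentiability is required only at \<open>p\<close>, which suffices
  for a bracket at \<open>p\<close>.\<close>

definition diff_field ::
    "('p, 'm::real_normed_vector) atlas \<Rightarrow> ('p \<Rightarrow> ('p, 'm) tvec) \<Rightarrow> 'p \<Rightarrow> bool"
  where "diff_field A X p \<longleftrightarrow> (\<forall>q\<in>points A. X q \<in> tangent_space A q) \<and>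
    (\<forall>c\<in>A. p \<in> fst c \<longrightarrow> (\<lambda>z. X (chart_inv c z) c) differentiable (at (snd c p)))"

lemma C2_near_chart:
  assumes A: "smooth_atlas A" and d: "d \<in> A" "p \<in> fst d"
  shows "C2_near A (snd d) p"
  unfolding C2_near_def
proof (intro ballI impI exI conjI)
  fix c assume c: "c \<in> A" "p \<in> fst c"
  show "open (snd c ` (fst c \<inter> fst d))" by (rule smooth_atlas_overlap[OF A c(1) d(1)])
  show "Ck_on 2 (snd c ` (fst c \<inter> fst d)) (\<lambda>z. snd d (chart_inv c z))"
    using smooth_atlas_transition[OF A c(1) d(1)] by (simp add: smooth_on_def o_def)
qed (use d in auto)

lemma C2_near_diff_fun: "C2_near A g p \<Longrightarrow> diff_fun A g p"
  unfolding C2_near_def diff_fun_def by (blast intro: Ck_on_2D(1))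

lemma derivative_along_field:
  assumes A: "smooth_atlas A" and g: "C2_near A g p" and c: "c \<in> A" "p \<in> fst c"
    and X: "\<And>q. q \<in> points A \<Longrightarrow> X q \<in> tangent_space A q"
  obtains S where "open S" "snd c p \<in> S" "Ck_on 2 S (\<lambda>z. g (chart_inv c z))"
    "\<forall>z\<in>S. chart_inv c z \<in> fst c \<and> diff_fun A g (chart_inv c z) \<and>
       differential A g (chart_inv c z) (X (chart_inv c z)) =
       fderiv (\<lambda>z. g (chart_inv c z)) z (X (chart_inv c z) c)"
proof -
  obtain S where S: "open S" "snd c p \<in> S" "S \<subseteq> snd c ` fst c" "Ck_on 2 S (\<lambda>z. g (chart_inv c z))"
    using g c unfolding C2_near_def by blast
  show thesis
  proof (rule that[OF S(1,2,4)], rule ballI)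
    fix z assume z: "z \<in> S"
    then obtain q where q: "q \<in> fst c" "z = snd c q" using S(3) by blast
    have inv: "chart_inv c z = q" using smooth_atlas_chart_inv[OF A c(1) q(1)] q(2) by simp
    have dg: "diff_fun A g q"
      by (rule diff_funI[OF A c(1) q(1)]) (use Ck_on_2D(1)[OF S(4) z] q(2) in simp)
    have "q \<in> points A" using q(1) c(1) by (auto simp: points_def)
    then have "differential A g q (X q) = fderiv (\<lambda>z. g (chart_inv c z)) z (X q c)"
      using differential_chart[OF A X c(1) q(1) dg] q(2) by simp
    then show "chart_inv c z \<in> fst c \<and> diff_fun A g (chart_inv c z) \<and>
       differential A g (chart_inv c z) (X (chart_inv c z)) =
       fderiv (\<lambda>z. g (chart_inv c z)) z (X (chart_inv c z) c)"
      unfolding inv using q(1) dg by blast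
  qed
qed

lemma diff_fun_derivative_along_field:
  fixes A :: "('p, 'm::finite_dim_inner) atlas"
  assumes A: "smooth_atlas A" and p: "p \<in> points A" and g: "C2_near A g p" and X: "diff_field A X p"
  shows "diff_fun A (\<lambda>q. differential A g q (X q)) p"
proof -
  obtain c where c: "c \<in> A" "p \<in> fst c" using p by (auto simp: points_def)
  have X': "\<And>q. q \<in> points A \<Longrightarrow> X q \<in> tangent_space A q"
    "(\<lambda>z. X (chart_inv c z) c) differentiable (at (snd c p))"
    using X c by (auto simp: diff_field_def)
  obtain S where S: "open S" "snd c p \<in> S" "Ck_on 2 S (\<lambda>z. g (chart_inv c z))"
    "\<forall>z\<in>S. chart_inv c z \<in> fst c \<and> diff_fun A g (chart_inv c z) \<and>
       differential A g (chart_inv c z) (X (chart_inv c z)) =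
       fderiv (\<lambda>z. g (chart_inv c z)) z (X (chart_inv c z) c)"
    using derivative_along_field[OF A g c X'(1)] .
  have "(\<lambda>z. fderiv (\<lambda>z. g (chart_inv c z)) z (X (chart_inv c z) c)) differentiable (at (snd c p))"
    using has_derivative_directional[OF S(1,3), of "\<lambda>z. z", OF S(2) has_derivative_ident fderiv_works[OF X'(2)]]
    unfolding differentiable_def by blast
  then have "(\<lambda>z. differential A g (chart_inv c z) (X (chart_inv c z))) differentiable (at (snd c p))"
    by (rule differentiable_cong_ev[rotated]) (use S(1,2,4) in \<open>auto simp: eventually_nhds\<close>)
  then show ?thesis by (rule diff_funI[OF A c])
qed

text \<open>The coordinate identity \<open>fderiv_bracket\<close> in one chart. Only the component of the bracket in that
  chart appears, so that this can be used to prove that the bracket is a tangent vector.\<close>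

lemma lie_bracket_derivative_chart:
  fixes A :: "('p, 'm::finite_dim_inner) atlas" and g :: "'p \<Rightarrow> 'a::real_inner"
  assumes A: "smooth_atlas A" and g: "C2_near A g p" and c: "c \<in> A" "p \<in> fst c"
    and X: "diff_field A X p" and Y: "diff_field A Y p"
  shows "differential A (\<lambda>q. differential A g q (Y q)) p (X p)
      - differential A (\<lambda>q. differential A g q (X q)) p (Y p)
    = fderiv (\<lambda>z. g (chart_inv c z)) (snd c p) (lie_bracket A X Y p c)"
proof -
  note inv = smooth_atlas_chart_inv[OF A c]
  have p: "p \<in> points A" using c by (auto simp: points_def)
  have field: "differential A (\<lambda>q. differential A g q (Z q)) p \<xi> =
      fderiv (\<lambda>z. fderiv (\<lambda>z. g (chart_inv c z)) z (Z (chart_inv c z) c)) (snd c p) (\<xi> c)"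
    "differential A (\<lambda>q. Z q c) p \<xi> = fderiv (\<lambda>z. Z (chart_inv c z) c) (snd c p) (\<xi> c)"
    "(\<lambda>z. Z (chart_inv c z) c) differentiable (at (snd c p))"
    if Z: "diff_field A Z p" and \<xi>: "\<xi> \<in> tangent_space A p" for Z \<xi>
  proof -
    have Z': "\<And>q. q \<in> points A \<Longrightarrow> Z q \<in> tangent_space A q"
      "(\<lambda>z. Z (chart_inv c z) c) differentiable (at (snd c p))"
      using Z c by (auto simp: diff_field_def)
    then show "(\<lambda>z. Z (chart_inv c z) c) differentiable (at (snd c p))" by simp
    obtain S where S: "open S" "snd c p \<in> S" "Ck_on 2 S (\<lambda>z. g (chart_inv c z))"
      "\<forall>z\<in>S. chart_inv c z \<in> fst c \<and> diff_fun A g (chart_inv c z) \<and>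
         differential A g (chart_inv c z) (Z (chart_inv c z)) =
         fderiv (\<lambda>z. g (chart_inv c z)) z (Z (chart_inv c z) c)"
      using derivative_along_field[OF A g c Z'(1)] .
    have "eventually (\<lambda>z. differential A g (chart_inv c z) (Z (chart_inv c z)) =
        fderiv (\<lambda>z. g (chart_inv c z)) z (Z (chart_inv c z) c)) (nhds (snd c p))"
      using S(1,2,4) by (auto simp: eventually_nhds)
    from fderiv_cong[OF this]
    show "differential A (\<lambda>q. differential A g q (Z q)) p \<xi> =
      fderiv (\<lambda>z. fderiv (\<lambda>z. g (chart_inv c z)) z (Z (chart_inv c z) c)) (snd c p) (\<xi> c)"
      using differential_chart[OF A \<xi> c diff_fun_derivative_along_field[OF A p g Z]] by simp
    show "differential A (\<lambda>q. Z q c) p \<xi> = fderiv (\<lambda>z. Z (chart_inv c z) c) (snd c p) (\<xi> c)"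
      by (rule differential_chart[OF A \<xi> c diff_funI[OF A c Z'(2)]])
  qed
  obtain S where S: "open S" "snd c p \<in> S" "Ck_on 2 S (\<lambda>z. g (chart_inv c z))"
    using g c unfolding C2_near_def by blast
  have T: "X p \<in> tangent_space A p" "Y p \<in> tangent_space A p" using X Y p by (auto simp: diff_field_def)
  show ?thesis
    using fderiv_bracket[OF S(1,3,2) field(3)[OF X T(1)] field(3)[OF Y T(1)]] c
    by (simp add: field[OF X T(2)] field[OF Y T(1)] lie_bracket_def inv)
qed

text \<open>The transformation law between charts \<open>c\<close> and \<open>d\<close> is the preceding identity for the function \<open>d\<close>.\<close>

lemma lie_bracket_in_tangent_space:
  fixes A :: "('p, 'm::finite_dim_inner) atlas"
  assumes A: "smooth_atlas A" and X: "diff_field A X p" and Y: "diff_field A Y p"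
  shows "lie_bracket A X Y p \<in> tangent_space A p"
proof (rule tangent_spaceI)
  fix c d assume c: "c \<in> A" and d: "d \<in> A" and pc: "p \<in> fst c" and pd: "p \<in> fst d"
  note inv = smooth_atlas_chart_inv[OF A d pd]
  have p: "p \<in> points A" using c pc by (auto simp: points_def)
  \<comment> \<open>near \<open>p\<close> the component of a vector field in the chart \<open>d\<close> is the derivative of \<open>d\<close> along it\<close>
  have "differential A (\<lambda>q. differential A (snd d) q (Z q)) p \<xi> = differential A (\<lambda>q. Z q d) p \<xi>"
    if Z: "diff_field A Z p" and \<xi>: "\<xi> \<in> tangent_space A p" for Z \<xi>
  proof -
    have Z': "\<And>q. q \<in> points A \<Longrightarrow> Z q \<in> tangent_space A q"
      "(\<lambda>z. Z (chart_inv d z) d) differentiable (at (snd d p))"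
      using Z d pd by (auto simp: diff_field_def)
    have "differential A (snd d) q (Z q) = Z q d" if q: "q \<in> fst d" for q
      using differential_own_chart[OF A Z'(1) d q] q d by (auto simp: points_def)
    then have "eventually (\<lambda>z. differential A (snd d) (chart_inv d z) (Z (chart_inv d z)) = Z (chart_inv d z) d)
        (nhds (snd d p))"
      using diff_into_chart_inv[OF A d pd] d pd
      by (auto simp: diff_into_def inv elim!: eventually_mono)
    from fderiv_cong[OF this] show ?thesis
      using differential_chart[OF A \<xi> d pd diff_fun_derivative_along_field[OF A p C2_near_chart[OF A d pd] Z]]
        differential_chart[OF A \<xi> d pd diff_funI[OF A d pd Z'(2)]] by simp
  qed
  moreover have "X p \<in> tangent_space A p" "Y p \<in> tangent_space A p" using X Y p by (auto simp: diff_field_def)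
  ultimately show "lie_bracket A X Y p d = fderiv (\<lambda>z. snd d (chart_inv c z)) (snd c p) (lie_bracket A X Y p c)"
    using lie_bracket_derivative_chart[OF A C2_near_chart[OF A d pd] c pc X Y] X Y d pd
    by (simp add: lie_bracket_def[of A X Y p])
qed (auto simp: lie_bracket_def)

lemma differential_lie_bracket:
  fixes A :: "('p, 'm::finite_dim_inner) atlas" and g :: "'p \<Rightarrow> 'a::real_inner"
  assumes A: "smooth_atlas A" and p: "p \<in> points A" and g: "C2_near A g p"
    and X: "diff_field A X p" and Y: "diff_field A Y p"
  shows "differential A g p (lie_bracket A X Y p) =
    differential A (\<lambda>q. differential A g q (Y q)) p (X p)
      - differential A (\<lambda>q. differential A g q (X q)) p (Y p)"
proof -
  obtain c where c: "c \<in> A" "p \<in> fst c" using p by (auto simp: points_def)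
  show ?thesis
    using lie_bracket_derivative_chart[OF A g c X Y]
      differential_chart[OF A lie_bracket_in_tangent_space[OF A X Y] c C2_near_diff_fun[OF g]] by simp
qed

section \<open>Local trivializations\<close>

lemma diff_into_eventually_openin:
  assumes A: "smooth_atlas A" and k: "diff_into A k x" and W: "openin (atlas_topology A) W" "k x \<in> W"
  shows "eventually (\<lambda>y. k y \<in> W) (nhds x)"
proof -
  obtain c where c: "c \<in> A" "k x \<in> fst c" using k by (auto simp: diff_into_def points_def)
  then have k': "eventually (\<lambda>y. k y \<in> fst c) (nhds x)" "isCont (\<lambda>y. snd c (k y)) x"
    using k differentiable_imp_continuous_within by (auto simp: diff_into_def)
  have "open (snd c ` (fst c \<inter> W))" using W(1) c(1) openin_atlas_topology[OF A] by blast
  moreover have "snd c (k x) \<in> snd c ` (fst c \<inter> W)" using c W(2) by blast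
  ultimately have "eventually (\<lambda>y. snd c (k y) \<in> snd c ` (fst c \<inter> W)) (nhds x)"
    using eventually_nhds_isCont[of x "\<lambda>y. snd c (k y)"] k'(2) by blast
  with k'(1) show ?thesis
  proof (rule eventually_elim2)
    fix y assume "k y \<in> fst c" "snd c (k y) \<in> snd c ` (fst c \<inter> W)"
    then show "k y \<in> W" using inj_onD[OF smooth_atlas_inj[OF A c(1)]] by blast
  qed
qed

lemma diff_into_cong_ev:
  assumes "eventually (\<lambda>y. k y = l y) (nhds x)" "diff_into B k x"
  shows "diff_into B l x"
proof -
  have x: "k x = l x" using assms(1) eventually_nhds_x_imp_x by fastforce
  have "eventually (\<lambda>y. l y \<in> fst d) (nhds x)" "(\<lambda>y. snd d (l y)) differentiable (at x)"
    if d: "d \<in> B" "l x \<in> fst d" for d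
  proof -
    have k: "eventually (\<lambda>y. k y \<in> fst d) (nhds x)" "(\<lambda>y. snd d (k y)) differentiable (at x)"
      using assms(2) d x by (auto simp: diff_into_def)
    show "eventually (\<lambda>y. l y \<in> fst d) (nhds x)"
      using assms(1) k(1) by (rule eventually_elim2) simp
    show "(\<lambda>y. snd d (l y)) differentiable (at x)"
      by (rule differentiable_cong_ev[OF _ k(2)]) (rule eventually_mono[OF assms(1)], simp)
  qed
  then show ?thesis using assms(2) x by (auto simp: diff_into_def)
qed

lemma diff_into_precompose:
  assumes k: "diff_into B k (f x)" and f: "f differentiable (at x)"
  shows "diff_into B (\<lambda>y. k (f y)) x"
proof -
  have "eventually (\<lambda>y. k (f y) \<in> fst d) (nhds x)" "(\<lambda>y. snd d (k (f y))) differentiable (at x)"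
    if d: "d \<in> B" "k (f x) \<in> fst d" for d
  proof -
    have k': "eventually (\<lambda>y. k y \<in> fst d) (nhds (f x))" "(\<lambda>y. snd d (k y)) differentiable (at (f x))"
      using k d by (auto simp: diff_into_def)
    obtain S where S: "open S" "f x \<in> S" "\<forall>y\<in>S. k y \<in> fst d"
      using k'(1) unfolding eventually_nhds by blast
    have "eventually (\<lambda>y. f y \<in> S) (nhds x)"
      using eventually_nhds_isCont[of x f S] S differentiable_imp_continuous_within[OF f] by blast
    then show "eventually (\<lambda>y. k (f y) \<in> fst d) (nhds x)" using S(3) by (auto elim: eventually_mono)
    show "(\<lambda>y. snd d (k (f y))) differentiable (at x)"
      using has_derivative_compose[OF fderiv_works[OF f] fderiv_works[OF k'(2)]]
      unfolding differentiable_def by blast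
  qed
  then show ?thesis using k by (auto simp: diff_into_def)
qed

lemma smooth_map_C2_near:
  assumes A: "smooth_atlas A" and B: "smooth_atlas B" and f: "smooth_map A B f"
    and d: "d \<in> B" "f p \<in> fst d"
  shows "C2_near A (\<lambda>q. snd d (f q)) p"
  unfolding C2_near_def
proof (intro ballI impI exI conjI)
  fix c assume c: "c \<in> A" "p \<in> fst c"
  show "open (snd c ` (fst c \<inter> f -` fst d))"
    by (rule smooth_map_openin[OF A f openin_atlas_chart[OF B d(1)] c(1)])
  have "smooth_on (snd c ` (fst c \<inter> f -` fst d)) (snd d \<circ> f \<circ> chart_inv c)"
    using f c d unfolding smooth_map_def by blast
  then show "Ck_on 2 (snd c ` (fst c \<inter> f -` fst d)) (\<lambda>z. snd d (f (chart_inv c z)))"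
    by (simp add: smooth_on_def o_def)
qed (use d in auto)

lemma points_restrict_atlas: "points (restrict_atlas A W) = points A \<inter> W"
  by (force simp: points_def restrict_atlas_def)

lemma points_prod_model_atlas: "points (prod_atlas A model_atlas) = points A \<times> UNIV"
  by (force simp: points_def prod_atlas_def model_atlas_def)

lemma restrict_atlasI: "c \<in> A \<Longrightarrow> (fst c \<inter> W, snd c) \<in> restrict_atlas A W"
  unfolding restrict_atlas_def by (cases c) auto

lemma prod_model_atlasI:
  "c \<in> A \<Longrightarrow> (fst c \<times> UNIV, map_prod (snd c) id) \<in> prod_atlas A model_atlas"
  unfolding prod_atlas_def model_atlas_def by (cases c) auto

text \<open>A local trivialization of any of the bundles \<open>E\<close>, its model bundle and the anchored bundle, without
  their fibrewise algebra.\<close>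

locale bundle_trivialization =
  fixes M :: "('p, 'm::finite_dim_inner) atlas"
    and B :: "('p, 'b, 'n::finite_dim_inner, 'z) fbundle_scheme"
    and W :: "'p set" and \<Phi> :: "'b \<Rightarrow> 'f::finite_dim_inner"
  assumes base: "smooth_atlas M" and total: "smooth_atlas (total_atlas B)"
    and proj: "smooth_map (total_atlas B) M (bproj B)" and triv: "local_triv M B W \<Phi>"
begin

lemma openin_W: "openin (atlas_topology M) W"
  using triv by (simp add: local_triv_def)

lemma bproj_points: "e \<in> points (total_atlas B) \<Longrightarrow> bproj B e \<in> points M"
  by (rule smooth_map_points[OF total base proj])

lemma base_chart:
  assumes "e \<in> points (total_atlas B)"
  obtains a where "a \<in> M" "bproj B e \<in> fst a"
  using bproj_points[OF assms] unfolding points_def by blast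

lemma diff_map_bproj: "e \<in> points (total_atlas B) \<Longrightarrow> diff_map (total_atlas B) M (bproj B) e"
  by (rule smooth_map_diff_map[OF total base proj])

lemma bij_triv:
  "bij_betw (\<lambda>e. (bproj B e, \<Phi> e)) (points (total_atlas B) \<inter> bproj B -` W) (W \<times> UNIV)"
proof -
  have "W \<subseteq> points M" using openin_subset[OF openin_W] topspace_atlas_topology[OF base] by simp
  then have "points M \<inter> W = W" by blast
  then show ?thesis
    using triv by (simp add: local_triv_def diffeo_def points_restrict_atlas points_prod_model_atlas)
qed

lemma triv_eqI:
  assumes "e \<in> points (total_atlas B)" "e' \<in> points (total_atlas B)" "bproj B e \<in> W"
    "bproj B e = bproj B e'" "\<Phi> e = \<Phi> e'"
  shows "e = e'"
  by (rule inj_onD[OF bij_betw_imp_inj_on[OF bij_triv]]) (use assms in auto)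

lemma triv_surj:
  assumes "m \<in> W"
  obtains e where "e \<in> points (total_atlas B)" "bproj B e = m" "\<Phi> e = y"
proof -
  have "(m, y) \<in> (\<lambda>e. (bproj B e, \<Phi> e)) ` (points (total_atlas B) \<inter> bproj B -` W)"
    using bij_betw_imp_surj_on[OF bij_triv] assms by simp
  then show ?thesis using that by auto
qed

lemma C2_near_triv:
  assumes e: "bproj B e \<in> W"
  shows "C2_near (total_atlas B) \<Phi> e"
  unfolding C2_near_def
proof (intro ballI impI)
  fix c assume c: "c \<in> total_atlas B" "e \<in> fst c"
  have "e \<in> points (total_atlas B)" using c by (auto simp: points_def)
  then obtain a where a: "a \<in> M" "bproj B e \<in> fst a" using base_chart by blast
  define R where "R = restrict_atlas (total_atlas B) (bproj B -` W)"
  define P :: "('p \<times> 'f, 'm \<times> 'f) atlas" where "P = prod_atlas (restrict_atlas M W) model_atlas"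
  define c' where "c' = (fst c \<inter> bproj B -` W, snd c)"
  define d' :: "('p \<times> 'f, 'm \<times> 'f) chart" where "d' = ((fst a \<inter> W) \<times> UNIV, map_prod (snd a) id)"
  have c': "c' \<in> R" unfolding R_def c'_def by (rule restrict_atlasI[OF c(1)])
  have d': "d' \<in> P" unfolding P_def d'_def using prod_model_atlasI[OF restrict_atlasI[OF a(1)]] by simp
  have "smooth_map R P (\<lambda>e. (bproj B e, \<Phi> e))"
    using triv by (simp add: local_triv_def diffeo_def R_def P_def)
  then have sm: "smooth_on (snd c' ` (fst c' \<inter> (\<lambda>e. (bproj B e, \<Phi> e)) -` fst d'))
      (snd d' \<circ> (\<lambda>e. (bproj B e, \<Phi> e)) \<circ> chart_inv c')"
    using c' d' unfolding smooth_map_def by blast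
  define S where "S = snd c ` (fst c \<inter> bproj B -` (fst a \<inter> W))"
  have S: "snd c' ` (fst c' \<inter> (\<lambda>e. (bproj B e, \<Phi> e)) -` fst d') = S"
    by (auto simp: S_def c'_def d'_def)
  have "open S" unfolding S_def
    by (rule smooth_map_openin[OF total proj _ c(1)])
      (intro openin_Int openin_atlas_chart[OF base a(1)] openin_W)
  have "Ck_on 2 S (\<lambda>z. snd ((snd d' \<circ> (\<lambda>e. (bproj B e, \<Phi> e)) \<circ> chart_inv c') z))"
    using Ck_on_bounded_linear[OF \<open>open S\<close> bounded_linear_snd] sm unfolding S smooth_on_def by blast
  then have "Ck_on 2 S (\<lambda>z. \<Phi> (chart_inv c z))"
  proof (rule Ck_on_cong[OF \<open>open S\<close>, rotated])
    fix z assume "z \<in> S"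
    then obtain q where q: "q \<in> fst c" "bproj B q \<in> W" "z = snd c q" by (auto simp: S_def)
    have "inj_on (snd c') (fst c')"
      using smooth_atlas_inj[OF total c(1)] by (auto simp: c'_def inj_on_def)
    from chart_inv_apply[OF this, of q] q have "chart_inv c' z = q" by (simp add: c'_def)
    then show "snd ((snd d' \<circ> (\<lambda>e. (bproj B e, \<Phi> e)) \<circ> chart_inv c') z) = \<Phi> (chart_inv c z)"
      using smooth_atlas_chart_inv[OF total c(1) q(1)] q(3) by (simp add: d'_def)
  qed
  moreover have "snd c e \<in> S" "S \<subseteq> snd c ` fst c" using c a e by (auto simp: S_def)
  ultimately show "\<exists>S. open S \<and> snd c e \<in> S \<and> S \<subseteq> snd c ` fst c \<and> Ck_on 2 S (\<lambda>z. \<Phi> (chart_inv c z))"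
    using \<open>open S\<close> by blast
qed

lemma diff_fun_triv: "bproj B e \<in> W \<Longrightarrow> diff_fun (total_atlas B) \<Phi> e"
  by (rule C2_near_diff_fun[OF C2_near_triv])

text \<open>The inverse trivialization, seen in a chart \<open>d\<close> of the total space and a chart \<open>a\<close> of the base, as a
  \<open>C\<^sup>2\<close> map \<open>K\<close> on an open set \<open>T\<close>. Openness of \<open>T\<close> is continuity of the inverse trivialization.\<close>

lemma inverse_triv_chart:
  assumes d: "d \<in> total_atlas B" and a: "a \<in> M"
  obtains T K where "open T" "Ck_on 2 T K"
    "\<And>e. e \<in> points (total_atlas B) \<Longrightarrow> bproj B e \<in> fst a \<Longrightarrow> bproj B e \<in> W \<Longrightarrow>
      (snd a (bproj B e), \<Phi> e) \<in> T \<longleftrightarrow> e \<in> fst d"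
    "\<And>e. e \<in> points (total_atlas B) \<Longrightarrow> bproj B e \<in> fst a \<Longrightarrow> bproj B e \<in> W \<Longrightarrow>
      K (snd a (bproj B e), \<Phi> e) = snd d e"
proof -
  define R where "R = restrict_atlas (total_atlas B) (bproj B -` W)"
  define P :: "('p \<times> 'f, 'm \<times> 'f) atlas" where "P = prod_atlas (restrict_atlas M W) model_atlas"
  define F where "F = (\<lambda>e. (bproj B e, \<Phi> e))"
  define G where "G = inv_into (points R) F"
  define c' :: "('p \<times> 'f, 'm \<times> 'f) chart" where "c' = ((fst a \<inter> W) \<times> UNIV, map_prod (snd a) id)"
  define d' where "d' = (fst d \<inter> bproj B -` W, snd d)"
  define T where "T = snd c' ` (fst c' \<inter> G -` fst d')"
  define K where "K = snd d' \<circ> G \<circ> chart_inv c'"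
  have c': "c' \<in> P" unfolding P_def c'_def using prod_model_atlasI[OF restrict_atlasI[OF a]] by simp
  have d': "d' \<in> R" unfolding R_def d'_def by (rule restrict_atlasI[OF d])
  have pR: "points R = points (total_atlas B) \<inter> bproj B -` W" by (simp add: R_def points_restrict_atlas)
  have pP: "points P = (points M \<inter> W) \<times> UNIV"
    by (simp add: P_def points_prod_model_atlas points_restrict_atlas)
  have G: "smooth_map P R G"
    using triv by (simp add: local_triv_def diffeo_def R_def P_def G_def F_def)
  have GF: "G (F e) = e" if "e \<in> points R" for e
    unfolding G_def F_def
    by (rule inv_into_f_f) (use bij_betw_imp_inj_on[OF bij_triv] that pR in simp_all)
  have inj: "inj_on (snd c) (fst c)" if c: "c \<in> P" for c
  proof -
    obtain U \<phi> where "(U, \<phi>) \<in> M" "c = ((U \<inter> W) \<times> UNIV, map_prod \<phi> id)"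
      using c unfolding P_def restrict_atlas_def prod_atlas_def model_atlas_def by blast
    then show ?thesis using smooth_atlas_inj[OF base, of "(U, \<phi>)"] by (auto simp: inj_on_def)
  qed
  have openP: "openin (atlas_topology P) S \<longleftrightarrow> S \<subseteq> points P \<and> (\<forall>c\<in>P. open (snd c ` (fst c \<inter> S)))" for S
    by (rule openin_injective_atlas) (rule inj)
  have "openin (atlas_topology P) (points P)"
    unfolding openP
  proof (intro conjI ballI)
    fix c assume c: "c \<in> P"
    then obtain U \<phi> where U: "(U, \<phi>) \<in> M" "c = ((U \<inter> W) \<times> UNIV, map_prod \<phi> id)"
      unfolding P_def restrict_atlas_def prod_atlas_def model_atlas_def by blast
    have "fst c \<inter> points P = fst c" using c by (auto simp: points_def)
    then have "snd c ` (fst c \<inter> points P) = \<phi> ` (U \<inter> W) \<times> UNIV" using U(2) by force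
    moreover have "open (\<phi> ` (U \<inter> W))"
      using openin_W U(1) unfolding openin_atlas_topology[OF base] by force
    ultimately show "open (snd c ` (fst c \<inter> points P))" by (simp add: open_Times)
  qed simp
  then have top: "topspace (atlas_topology P) = points P"
    using openin_subset openin_topspace[of "atlas_topology P"] openP by blast
  have injR: "inj_on (snd c) (fst c)" if c: "c \<in> R" for c
    using c smooth_atlas_inj[OF total] unfolding R_def restrict_atlas_def by (force simp: inj_on_def)
  have openR: "openin (atlas_topology R) S \<longleftrightarrow> S \<subseteq> points R \<and> (\<forall>c\<in>R. open (snd c ` (fst c \<inter> S)))" for S
    by (rule openin_injective_atlas) (rule injR)
  have "openin (atlas_topology (total_atlas B)) {e \<in> points (total_atlas B). bproj B e \<in> W}"
    by (rule smooth_map_openin_preimage[OF total proj openin_W])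
  from openin_Int[OF openin_atlas_chart[OF total d] this]
  have "openin (atlas_topology (total_atlas B)) (fst d')"
    by (rule back_subst[of "openin _"]) (use d in \<open>auto simp: d'_def points_def\<close>)
  then have "openin (atlas_topology R) (fst d')"
    unfolding openR openin_atlas_topology[OF total]
  proof (elim conjE, intro conjI ballI)
    show "fst d' \<subseteq> points R" using d' by (auto simp: points_def)
    fix c assume "c \<in> R"
    then obtain U \<phi> where U: "(U, \<phi>) \<in> total_atlas B" "c = (U \<inter> bproj B -` W, \<phi>)"
      unfolding R_def restrict_atlas_def by blast
    assume "\<forall>c\<in>total_atlas B. open (snd c ` (fst c \<inter> fst d'))"
    then have "open (\<phi> ` (U \<inter> fst d'))" using U(1) by force
    moreover have "fst c \<inter> fst d' = U \<inter> fst d'" unfolding U(2) d'_def by auto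
    ultimately show "open (snd c ` (fst c \<inter> fst d'))" using U(2) by simp
  qed
  then have "openin (atlas_topology P) {x \<in> points P. G x \<in> fst d'}"
    using openin_continuous_map_preimage[of "atlas_topology P" "atlas_topology R" G "fst d'"] G top
    by (simp add: smooth_map_def)
  then have "open (snd c' ` (fst c' \<inter> {x \<in> points P. G x \<in> fst d'}))"
    unfolding openP using c' by blast
  moreover have "fst c' \<inter> {x \<in> points P. G x \<in> fst d'} = fst c' \<inter> G -` fst d'"
    using c' by (auto simp: points_def)
  ultimately have "open T" by (simp add: T_def)
  have "smooth_on T K" using G c' d' unfolding smooth_map_def T_def K_def by blast
  then have "Ck_on 2 T K" by (simp add: smooth_on_def)
  have Te: "(snd a (bproj B e), \<Phi> e) \<in> T \<longleftrightarrow> e \<in> fst d" and Ke: "K (snd a (bproj B e), \<Phi> e) = snd d e"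
    if e: "e \<in> points (total_atlas B)" "bproj B e \<in> fst a" "bproj B e \<in> W" for e
  proof -
    have Fe: "F e \<in> fst c'" "snd c' (F e) = (snd a (bproj B e), \<Phi> e)" using e by (auto simp: F_def c'_def)
    have GFe: "G (F e) = e" by (rule GF) (use e pR in auto)
    have "snd c' (F e) \<in> T \<longleftrightarrow> F e \<in> G -` fst d'"
      unfolding T_def using Fe(1) inj_onD[OF inj[OF c']] by blast
    then show "(snd a (bproj B e), \<Phi> e) \<in> T \<longleftrightarrow> e \<in> fst d"
      using e GFe by (simp add: Fe(2) d'_def)
    show "K (snd a (bproj B e), \<Phi> e) = snd d e"
      unfolding K_def Fe(2)[symmetric] using chart_inv_apply[OF inj[OF c'] Fe(1)] GFe by (simp add: d'_def)
  qed
  show thesis by (rule that[OF \<open>open T\<close> \<open>Ck_on 2 T K\<close> Te Ke])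
qed

text \<open>Differentiability into the total space may be tested on the base point and the fibre coordinate,
  because the inverse trivialization recovers the point from both. This replaces every explicit
  calculation with charts of the total space.\<close>

lemma diff_into_trivI:
  assumes pts: "eventually (\<lambda>y. q y \<in> points (total_atlas B)) (nhds x)" and W: "bproj B (q x) \<in> W"
    and k: "diff_into M (\<lambda>y. bproj B (q y)) x" and f: "(\<lambda>y. \<Phi> (q y)) differentiable (at x)"
  shows "diff_into (total_atlas B) q x"
proof -
  have qx: "q x \<in> points (total_atlas B)" using pts eventually_nhds_x_imp_x by fastforce
  then obtain a where a: "a \<in> M" "bproj B (q x) \<in> fst a" using base_chart by blast
  define r where "r = (\<lambda>y. (snd a (bproj B (q y)), \<Phi> (q y)))"
  have r: "r differentiable (at x)"
    unfolding r_def differentiable_def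
    using has_derivative_Pair[OF fderiv_works fderiv_works[OF f]] k a by (force simp: diff_into_def)
  have near: "eventually (\<lambda>y. q y \<in> points (total_atlas B) \<and> bproj B (q y) \<in> fst a \<and> bproj B (q y) \<in> W) (nhds x)"
    by (intro eventually_conj pts diff_into_eventually_openin[OF base k] openin_atlas_chart[OF base] openin_W)
      (use a W in auto)
  have "eventually (\<lambda>y. q y \<in> fst d) (nhds x)" "(\<lambda>y. snd d (q y)) differentiable (at x)"
    if d: "d \<in> total_atlas B" "q x \<in> fst d" for d
  proof -
    obtain T K where T: "open T" "Ck_on 2 T K"
      and TK: "\<And>e. e \<in> points (total_atlas B) \<Longrightarrow> bproj B e \<in> fst a \<Longrightarrow> bproj B e \<in> W \<Longrightarrow>
        (snd a (bproj B e), \<Phi> e) \<in> T \<longleftrightarrow> e \<in> fst d"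
      "\<And>e. e \<in> points (total_atlas B) \<Longrightarrow> bproj B e \<in> fst a \<Longrightarrow> bproj B e \<in> W \<Longrightarrow>
        K (snd a (bproj B e), \<Phi> e) = snd d e"
      using inverse_triv_chart[OF d(1) a(1)] by metis
    have rx: "r x \<in> T" using TK(1)[OF qx a(2) W] d(2) by (simp add: r_def)
    have "eventually (\<lambda>y. r y \<in> T) (nhds x)"
      using eventually_nhds_isCont[of x r T] T(1) rx differentiable_imp_continuous_within[OF r] by blast
    with near show "eventually (\<lambda>y. q y \<in> fst d) (nhds x)"
      by (rule eventually_elim2) (auto simp: r_def TK(1))
    have "(\<lambda>y. K (r y)) differentiable (at x)"
      using has_derivative_compose[OF fderiv_works[OF r] fderiv_works[OF Ck_on_2D(1)[OF T(2) rx]]]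
      unfolding differentiable_def by blast
    then show "(\<lambda>y. snd d (q y)) differentiable (at x)"
      by (rule differentiable_cong_ev[rotated]) (rule eventually_mono[OF near], simp add: r_def TK(2))
  qed
  then show ?thesis using qx by (auto simp: diff_into_def)
qed

text \<open>The derivative of the trivialization is injective, since its left inverse is the derivative of \<open>K\<close>.\<close>

lemma tangent_vector_eqI:
  assumes e: "e \<in> points (total_atlas B)" "bproj B e \<in> W"
    and \<xi>: "\<xi> \<in> tangent_space (total_atlas B) e" and \<eta>: "\<eta> \<in> tangent_space (total_atlas B) e"
    and base_eq: "tangent_map (total_atlas B) M (bproj B) e \<xi> = tangent_map (total_atlas B) M (bproj B) e \<eta>"
    and fibre_eq: "differential (total_atlas B) \<Phi> e \<xi> = differential (total_atlas B) \<Phi> e \<eta>"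
  shows "\<xi> = \<eta>"
proof
  fix c
  obtain a where a: "a \<in> M" "bproj B e \<in> fst a" using base_chart[OF e(1)] .
  show "\<xi> c = \<eta> c"
  proof (cases "c \<in> total_atlas B \<and> e \<in> fst c")
    case False
    then show ?thesis using tangent_spaceD(2)[OF \<xi>] tangent_spaceD(2)[OF \<eta>] by simp
  next
    case True
    then have c: "c \<in> total_atlas B" "e \<in> fst c" by auto
    note inv = smooth_atlas_chart_inv[OF total c]
    obtain T K where T: "open T" "Ck_on 2 T K"
      and TK: "\<And>e. e \<in> points (total_atlas B) \<Longrightarrow> bproj B e \<in> fst a \<Longrightarrow> bproj B e \<in> W \<Longrightarrow>
        (snd a (bproj B e), \<Phi> e) \<in> T \<longleftrightarrow> e \<in> fst c"
      "\<And>e. e \<in> points (total_atlas B) \<Longrightarrow> bproj B e \<in> fst a \<Longrightarrow> bproj B e \<in> W \<Longrightarrow>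
        K (snd a (bproj B e), \<Phi> e) = snd c e"
      using inverse_triv_chart[OF c(1) a(1)] by metis
    define k where "k = chart_inv c"
    define r where "r = (\<lambda>z. (snd a (bproj B (k z)), \<Phi> (k z)))"
    have dp: "diff_fun (total_atlas B) (\<lambda>q. snd a (bproj B q)) e"
      by (rule diff_fun_diff_map[OF base diff_map_bproj[OF e(1)] diff_fun_chart[OF base a] total])
    have dPhi: "diff_fun (total_atlas B) \<Phi> e" by (rule diff_fun_triv[OF e(2)])
    have r: "(r has_derivative (\<lambda>u. (fderiv (\<lambda>z. snd a (bproj B (k z))) (snd c e) u,
        fderiv (\<lambda>z. \<Phi> (k z)) (snd c e) u))) (at (snd c e))"
      unfolding r_def using dp dPhi c by (intro has_derivative_Pair fderiv_works) (auto simp: diff_fun_def k_def)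
    have r_apply: "fderiv r (snd c e) (\<zeta> c) =
        (tangent_map (total_atlas B) M (bproj B) e \<zeta> a, differential (total_atlas B) \<Phi> e \<zeta>)"
      if \<zeta>: "\<zeta> \<in> tangent_space (total_atlas B) e" for \<zeta>
      using differential_chart[OF total \<zeta> c dp] differential_chart[OF total \<zeta> c dPhi] a
      by (simp add: fderiv_eqI[OF r] tangent_map_def o_def k_def)
    have rx: "r (snd c e) \<in> T" using TK(1)[OF e(1) a(2) e(2)] c by (simp add: r_def k_def inv)
    have dk: "diff_into (total_atlas B) k (snd c e)" unfolding k_def by (rule diff_into_chart_inv[OF total c])
    have db: "diff_into M (\<lambda>z. bproj B (k z)) (snd c e)"
      using tangent_map_pushforward(1)[OF total base dk] diff_map_bproj[OF e(1)] by (simp add: k_def inv)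
    have near: "eventually (\<lambda>z. bproj B (k z) \<in> fst a \<and> bproj B (k z) \<in> W) (nhds (snd c e))"
      by (intro eventually_conj diff_into_eventually_openin[OF base db] openin_atlas_chart[OF base] openin_W)
        (use a e in \<open>auto simp: k_def inv\<close>)
    have "eventually (\<lambda>z. z \<in> snd c ` fst c) (nhds (snd c e))"
      using smooth_atlas_overlap[OF total c(1) c(1)] c(2) unfolding eventually_nhds by auto
    with near have "eventually (\<lambda>z. K (r z) = z) (nhds (snd c e))"
    proof (rule eventually_elim2)
      fix z assume z: "bproj B (k z) \<in> fst a \<and> bproj B (k z) \<in> W" "z \<in> snd c ` fst c"
      then have kz: "k z \<in> fst c" "snd c (k z) = z"
        using smooth_atlas_chart_inv[OF total c(1)] by (auto simp: k_def)
      then have "k z \<in> points (total_atlas B)" using c(1) by (auto simp: points_def)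
      then show "K (r z) = z" using TK(2)[of "k z"] z(1) kz(2) by (simp add: r_def)
    qed
    from fderiv_cong[OF this] have "fderiv (\<lambda>z. K (r z)) (snd c e) = (\<lambda>u. u)"
      using fderiv_eqI[OF has_derivative_ident] by simp
    moreover have "fderiv (\<lambda>z. K (r z)) (snd c e) = (\<lambda>u. fderiv K (r (snd c e)) (fderiv r (snd c e) u))"
      using fderiv_eqI[OF has_derivative_compose[OF r fderiv_works[OF Ck_on_2D(1)[OF T(2) rx]]]] fderiv_eqI[OF r]
      by simp
    ultimately have left_inv: "fderiv K (r (snd c e)) (fderiv r (snd c e) u) = u" for u by metis
    have "fderiv r (snd c e) (\<xi> c) = fderiv r (snd c e) (\<eta> c)"
      using r_apply[OF \<xi>] r_apply[OF \<eta>] base_eq fibre_eq by simp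
    then show ?thesis by (metis left_inv)
  qed
qed

end

section \<open>Vertical lifts\<close>

lemma diff_into_const: "p \<in> points B \<Longrightarrow> diff_into B (\<lambda>_. p) x"
  by (simp add: diff_into_def)

text \<open>Simultaneous trivializations of an affine bundle and its model bundle for which \<open>\<Phi>\<close> is affine along
  the fibres with linear part \<open>\<Phi>b\<close>. A vector bundle regarded as an affine bundle is the case \<open>\<Phi> = \<Phi>b\<close>,
  which makes all results available for the linear covariant derivative too.\<close>

locale affine_trivialization =
  E: bundle_trivialization M E W \<Phi> + Eb: bundle_trivialization M Eb W \<Phi>b
  for M :: "('p, 'm::finite_dim_inner) atlas"
    and E :: "('p, 'b, 'n::finite_dim_inner, 'c) abundle"
    and Eb :: "('p, 'c, 'k::finite_dim_inner, 'f::finite_dim_inner) vbundle"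
    and W and \<Phi> :: "'b \<Rightarrow> 'f" and \<Phi>b :: "'c \<Rightarrow> 'f" +
  assumes translate_fibre: "\<And>e a. bproj E e \<in> W \<Longrightarrow> e \<in> points (total_atlas E) \<Longrightarrow>
      a \<in> fibre Eb (bproj E e) \<Longrightarrow> translate E e a \<in> fibre E (bproj E e)"
    and triv_translate: "\<And>e a. bproj E e \<in> W \<Longrightarrow> e \<in> points (total_atlas E) \<Longrightarrow>
      a \<in> fibre Eb (bproj E e) \<Longrightarrow> \<Phi> (translate E e a) = \<Phi> e + \<Phi>b a"
    and scale_fibre: "\<And>m r a. m \<in> W \<Longrightarrow> a \<in> fibre Eb m \<Longrightarrow> vscale Eb r a \<in> fibre Eb m"
    and triv_scale: "\<And>m r a. m \<in> W \<Longrightarrow> a \<in> fibre Eb m \<Longrightarrow> \<Phi>b (vscale Eb r a) = r *\<^sub>R \<Phi>b a"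
begin

context
  fixes e a
  assumes e: "e \<in> points (total_atlas E)" "bproj E e \<in> W" and a: "a \<in> fibre Eb (bproj E e)"
begin

lemma line_points: "translate E e (vscale Eb t a) \<in> points (total_atlas E)"
  and line_bproj: "bproj E (translate E e (vscale Eb t a)) = bproj E e"
  and line_triv: "\<Phi> (translate E e (vscale Eb t a)) = \<Phi> e + t *\<^sub>R \<Phi>b a"
  using translate_fibre[OF e(2,1) scale_fibre[OF e(2) a]] triv_translate[OF e(2,1) scale_fibre[OF e(2) a]]
    triv_scale[OF e(2) a] by (auto simp: fibre_def)

lemma line_0: "translate E e (vscale Eb 0 a) = e"
  by (rule E.triv_eqI) (use e in \<open>simp_all add: line_points line_bproj line_triv\<close>)

lemma diff_into_line: "diff_into (total_atlas E) (\<lambda>t. translate E e (vscale Eb t a)) t"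
proof (rule E.diff_into_trivI)
  show "diff_into M (\<lambda>t. bproj E (translate E e (vscale Eb t a))) t"
    using diff_into_const[OF E.bproj_points[OF e(1)]] by (simp add: line_bproj)
  show "(\<lambda>t. \<Phi> (translate E e (vscale Eb t a))) differentiable (at t)"
    by (simp add: line_triv)
qed (use e in \<open>simp_all add: line_points line_bproj\<close>)

lemma vlift_eq_pushforward:
  "vlift E Eb e a = pushforward (total_atlas E) (\<lambda>t. translate E e (vscale Eb t a)) 0 1"
proof
  fix c
  have "fderiv (\<lambda>t. snd c (translate E e (vscale Eb t a))) 0 1
      = vector_derivative (\<lambda>t. snd c (translate E e (vscale Eb t a))) (at 0)"
    if "c \<in> total_atlas E" "translate E e (vscale Eb 0 a) \<in> fst c"
    using diff_into_line[of 0] that by (simp add: frechet_derivative_eq_vector_derivative diff_into_def)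
  then show "vlift E Eb e a c = pushforward (total_atlas E) (\<lambda>t. translate E e (vscale Eb t a)) 0 1 c"
    by (simp add: vlift_def velocity_def pushforward_def)
qed

lemma vlift_in_tangent_space: "vlift E Eb e a \<in> tangent_space (total_atlas E) e"
  using pushforward_in_tangent_space[OF E.total diff_into_line, of 0] by (simp add: vlift_eq_pushforward line_0)

lemma derivative_along_line:
  assumes g: "diff_fun (total_atlas E) g e"
  shows "((\<lambda>t. g (translate E e (vscale Eb t a))) has_vector_derivative
    differential (total_atlas E) g e (vlift E Eb e a)) (at 0)"
proof -
  define D where "D = (\<lambda>u. differential (total_atlas E) g e (pushforward (total_atlas E) (\<lambda>t. translate E e (vscale Eb t a)) 0 u))"
  have der: "((\<lambda>t. g (translate E e (vscale Eb t a))) has_derivative D) (at 0)"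
    using has_derivative_diff_fun[OF E.total diff_into_line, of g 0] g by (simp add: line_0 D_def)
  have "D u = u *\<^sub>R D 1" for u
    using linear_scale[OF has_derivative_linear[OF der], of u 1] by simp
  then have "D = (\<lambda>u. u *\<^sub>R D 1)" by (rule ext)
  then have "((\<lambda>t. g (translate E e (vscale Eb t a))) has_vector_derivative D 1) (at 0)"
    using der unfolding has_vector_derivative_def by metis
  then show ?thesis by (simp only: D_def vlift_eq_pushforward)
qed

lemma tangent_map_vlift: "tangent_map (total_atlas E) M (bproj E) e (vlift E Eb e a) = (\<lambda>_. 0)"
proof
  fix d
  have "differential (total_atlas E) (\<lambda>q. snd d (bproj E q)) e (vlift E Eb e a) = 0"
    if d: "d \<in> M" "bproj E e \<in> fst d"
  proof -
    have "((\<lambda>t. snd d (bproj E (translate E e (vscale Eb t a)))) has_vector_derivative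
        differential (total_atlas E) (\<lambda>q. snd d (bproj E q)) e (vlift E Eb e a)) (at 0)"
      by (rule derivative_along_line[OF diff_fun_diff_map[OF E.base E.diff_map_bproj[OF e(1)]
          diff_fun_chart[OF E.base d] E.total]])
    then show ?thesis
      using vector_derivative_unique_at[OF _ has_vector_derivative_const] by (simp add: line_bproj)
  qed
  then show "tangent_map (total_atlas E) M (bproj E) e (vlift E Eb e a) d = 0"
    by (simp add: tangent_map_def o_def)
qed

lemma differential_vlift: "differential (total_atlas E) \<Phi> e (vlift E Eb e a) = \<Phi>b a"
proof -
  have "((\<lambda>t. \<Phi> e + t *\<^sub>R \<Phi>b a) has_vector_derivative \<Phi>b a) (at 0)"
    by (auto intro!: derivative_eq_intros)
  then show ?thesis
    using vector_derivative_unique_at[OF derivative_along_line[OF E.diff_fun_triv[OF e(2)]]]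
    by (simp add: line_triv)
qed

text \<open>The vertical lift of \<open>a\<close> and \<open>Q\<close> have the same projection to the base, so that only the fibre
  components \<open>\<Phi>b a\<close> and \<open>d\<Phi>(Q)\<close> need to agree.\<close>

lemma vlift_eq_iff:
  assumes "vertical M E e Q"
  shows "vlift E Eb e a = Q \<longleftrightarrow> \<Phi>b a = differential (total_atlas E) \<Phi> e Q"
  using E.tangent_vector_eqI[OF e vlift_in_tangent_space, of Q] assms tangent_map_vlift differential_vlift
  by (auto simp: vertical_def)

end

text \<open>In a chart, the line through \<open>q\<close> in the direction \<open>b q\<close> is the image under \<open>K\<close> of a straight line in
  the fibre coordinate, so the vertical lift at \<open>q\<close> is \<open>DK\<close> applied to \<open>(0, \<Phi>b (b q))\<close>. This depends
  differentiably on \<open>q\<close> because \<open>K\<close> is \<open>C\<^sup>2\<close>.\<close>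

lemma vlift_field_differentiable:
  assumes e: "bproj E e \<in> W" and c: "c \<in> total_atlas E" "e \<in> fst c"
    and b: "\<And>q. q \<in> points (total_atlas E) \<Longrightarrow> bproj E q \<in> W \<Longrightarrow> b q \<in> fibre Eb (bproj E q)"
    and db: "diff_fun (total_atlas E) (\<lambda>q. \<Phi>b (b q)) e"
  shows "(\<lambda>z. vlift E Eb (chart_inv c z) (b (chart_inv c z)) c) differentiable (at (snd c e))"
proof -
  have pe: "e \<in> points (total_atlas E)" using c by (auto simp: points_def)
  note inv = smooth_atlas_chart_inv[OF E.total c]
  obtain a where a: "a \<in> M" "bproj E e \<in> fst a" using E.base_chart[OF pe] .
  obtain T K where T: "open T" "Ck_on 2 T K"
    and TK: "\<And>e. e \<in> points (total_atlas E) \<Longrightarrow> bproj E e \<in> fst a \<Longrightarrow> bproj E e \<in> W \<Longrightarrow>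
      (snd a (bproj E e), \<Phi> e) \<in> T \<longleftrightarrow> e \<in> fst c"
    "\<And>e. e \<in> points (total_atlas E) \<Longrightarrow> bproj E e \<in> fst a \<Longrightarrow> bproj E e \<in> W \<Longrightarrow>
      K (snd a (bproj E e), \<Phi> e) = snd c e"
    using E.inverse_triv_chart[OF c(1) a(1)] by metis
  define k where "k = chart_inv c"
  define r where "r = (\<lambda>q. (snd a (bproj E q), \<Phi> q))"
  define u where "u = (\<lambda>z. (0::'m, \<Phi>b (b (k z))))"
  have formula: "vlift E Eb q (b q) c = fderiv K (r q) (0, \<Phi>b (b q))"
    if q: "q \<in> fst c" "bproj E q \<in> fst a" "bproj E q \<in> W" for q
  proof -
    have pq: "q \<in> points (total_atlas E)" using q(1) c(1) by (auto simp: points_def)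
    note line = line_points[OF pq q(3) b[OF pq q(3)]] line_bproj[OF pq q(3) b[OF pq q(3)]]
      line_triv[OF pq q(3) b[OF pq q(3)]]
    have rq: "r q \<in> T" using TK(1)[OF pq q(2,3)] q(1) by (simp add: r_def)
    have "((\<lambda>t. r q + t *\<^sub>R (0, \<Phi>b (b q))) has_derivative (\<lambda>t. t *\<^sub>R (0, \<Phi>b (b q)))) (at (0::real))"
      by (auto intro!: derivative_eq_intros)
    moreover have "(K has_derivative fderiv K (r q)) (at (r q + 0 *\<^sub>R (0, \<Phi>b (b q))))"
      using fderiv_works[OF Ck_on_2D(1)[OF T(2) rq]] by (simp add: zero_prod_def[symmetric])
    ultimately have "((\<lambda>t. K (r q + t *\<^sub>R (0, \<Phi>b (b q)))) has_derivative
        (\<lambda>t. fderiv K (r q) (t *\<^sub>R (0, \<Phi>b (b q))))) (at 0)"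
      using has_derivative_compose by blast
    moreover have "K (r q + t *\<^sub>R (0, \<Phi>b (b q))) = snd c (translate E q (vscale Eb t (b q)))" for t
      using TK(2)[OF line(1), of t] q by (simp add: r_def line)
    ultimately have "((\<lambda>t. snd c (translate E q (vscale Eb t (b q)))) has_derivative
        (\<lambda>t. fderiv K (r q) (t *\<^sub>R (0, \<Phi>b (b q))))) (at 0)" by simp
    from fderiv_eqI[OF this] show ?thesis
      using q c line_0[OF pq q(3) b[OF pq q(3)]] by (simp add: vlift_eq_pushforward[OF pq q(3) b[OF pq q(3)]] pushforward_def)
  qed
  have dk: "diff_into (total_atlas E) k (snd c e)" unfolding k_def by (rule diff_into_chart_inv[OF E.total c])
  have db': "diff_into M (\<lambda>z. bproj E (k z)) (snd c e)"
    using tangent_map_pushforward(1)[OF E.total E.base dk] E.diff_map_bproj[OF pe] by (simp add: k_def inv)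
  have near: "eventually (\<lambda>z. k z \<in> fst c \<and> bproj E (k z) \<in> fst a \<and> bproj E (k z) \<in> W) (nhds (snd c e))"
    by (intro eventually_conj diff_into_eventually_openin[OF E.base db'] diff_into_eventually_openin[OF E.total dk]
        openin_atlas_chart[OF E.base] openin_atlas_chart[OF E.total] E.openin_W)
      (use a e c in \<open>auto simp: k_def inv\<close>)
  have dr: "(\<lambda>z. r (k z)) differentiable (at (snd c e))"
    unfolding r_def
    by (rule differentiable_Pair)
      (use diff_fun_diff_map[OF E.base E.diff_map_bproj[OF pe] diff_fun_chart[OF E.base a] E.total]
        E.diff_fun_triv[OF e] c in \<open>simp_all add: diff_fun_def k_def\<close>)
  have du: "u differentiable (at (snd c e))"
    unfolding u_def
    by (rule differentiable_Pair) (use db c in \<open>simp_all add: diff_fun_def k_def\<close>)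
  have "r (k (snd c e)) \<in> T" using TK(1)[OF pe a(2) e] c by (simp add: r_def k_def inv)
  from has_derivative_directional[OF T(1,2), of "\<lambda>z. r (k z)", OF this fderiv_works[OF dr] fderiv_works[OF du]]
  have "(\<lambda>z. fderiv K (r (k z)) (u z)) differentiable (at (snd c e))"
    unfolding differentiable_def by blast
  then show ?thesis
  proof (rule differentiable_cong_ev[rotated])
    show "eventually (\<lambda>z. fderiv K (r (k z)) (u z) = vlift E Eb (chart_inv c z) (b (chart_inv c z)) c)
      (nhds (snd c e))"
      by (rule eventually_mono[OF near]) (simp add: formula u_def k_def)
  qed
qed

end

section \<open>Horizontal lifts\<close>

text \<open>The horizontal field is the smooth map \<open>h\<close> after \<open>q \<mapsto> (q, s(\<pi> q))\<close>, which is differentiable into the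
  fibre product. The hypothesis on tangent spaces ensures that the values of \<open>h\<close> lie in the domains of
  the charts of the tangent bundle.\<close>

lemma hor_field_differentiable:
  fixes M :: "('p, 'm::finite_dim_inner) atlas"
    and B :: "('p, 'b, 'n::finite_dim_inner, 'z) fbundle_scheme"
    and V :: "('p, 'd, 'l::finite_dim_inner, 'w::finite_dim_inner) vbundle"
  assumes V: "bundle_trivialization M V W \<Psi>" "(W, \<Psi>) \<in> vtrivs V"
    and B: "smooth_atlas (total_atlas B)" and proj: "smooth_map (total_atlas B) M (bproj B)"
    and h: "smooth_map (pullback_atlas B V) (tangent_atlas (total_atlas B)) (\<lambda>(e, v). (e, h e v))"
    and h_tangent: "\<And>q v. q \<in> points (total_atlas B) \<Longrightarrow> v \<in> fibre V (bproj B q) \<Longrightarrow>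
      h q v \<in> tangent_space (total_atlas B) q"
    and s: "s \<in> Sec M V" and e: "bproj B e \<in> W" and c: "c \<in> total_atlas B" "e \<in> fst c"
  shows "(\<lambda>z. hor_field B h s (chart_inv c z) c) differentiable (at (snd c e))"
proof -
  interpret V: bundle_trivialization M V W \<Psi> by (rule V(1))
  have pe: "e \<in> points (total_atlas B)" using c by (auto simp: points_def)
  note inv = smooth_atlas_chart_inv[OF B c]
  have bp: "bproj B q \<in> points M" if "q \<in> points (total_atlas B)" for q
    using smooth_map_points[OF B V.base proj that] .
  have s': "smooth_map M (total_atlas V) s" "\<And>m. m \<in> points M \<Longrightarrow> bproj V (s m) = m"
    using s by (auto simp: Sec_def)
  have sf: "s m \<in> fibre V m" if "m \<in> points M" for m
    using smooth_map_points[OF V.base V.total s'(1) that] s'(2)[OF that] by (simp add: fibre_def)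
  define k where "k = chart_inv c"
  define C where "C = ({(q, v). q \<in> fst c \<and> bproj B q \<in> W \<and> v \<in> fibre V (bproj B q)}, map_prod (snd c) \<Psi>)"
  define D where "D = ({(p, \<xi>). p \<in> fst c \<and> \<xi> \<in> tangent_space (total_atlas B) p}, \<lambda>(p, \<xi> :: ('b, 'n) tvec). (snd c p, \<xi> c))"
  define f where "f = (\<lambda>(e, v). (e, h e v))"
  define l where "l = (\<lambda>z. (z, \<Psi> (s (bproj B (k z)))))"
  have C: "C \<in> pullback_atlas B V"
    unfolding C_def pullback_atlas_def using c(1) V(2) by (cases c) auto
  have D: "D \<in> tangent_atlas (total_atlas B)" unfolding D_def tangent_atlas_def using c(1) by blast
  have injC: "inj_on (snd C) (fst C)"
  proof (rule inj_onI)
    fix x y assume xy: "x \<in> fst C" "y \<in> fst C" "snd C x = snd C y"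
    then have "fst x = fst y"
      using inj_onD[OF smooth_atlas_inj[OF B c(1)]] by (auto simp: C_def)
    then show "x = y"
      using xy V.triv_eqI[of "snd x" "snd y"] by (auto simp: C_def fibre_def)
  qed
  have mem: "(q, s (bproj B q)) \<in> fst C" "f (q, s (bproj B q)) \<in> fst D"
    if q: "q \<in> fst c" "bproj B q \<in> W" for q
  proof -
    have pq: "q \<in> points (total_atlas B)" using q c(1) by (auto simp: points_def)
    show "(q, s (bproj B q)) \<in> fst C" "f (q, s (bproj B q)) \<in> fst D"
      using q sf[OF bp[OF pq]] h_tangent[OF pq sf[OF bp[OF pq]]] by (simp_all add: C_def D_def f_def)
  qed
  have "smooth_on (snd C ` (fst C \<inter> f -` fst D)) (snd D \<circ> f \<circ> chart_inv C)"
    using h C D unfolding smooth_map_def f_def by blast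
  moreover have "snd C (e, s (bproj B e)) \<in> snd C ` (fst C \<inter> f -` fst D)"
    using mem[OF c(2) e] by blast
  ultimately have "(snd D \<circ> f \<circ> chart_inv C) differentiable (at (snd C (e, s (bproj B e))))"
    by (rule smooth_onD)
  then have dH: "(snd D \<circ> f \<circ> chart_inv C) differentiable (at (l (snd c e)))"
    by (simp add: C_def l_def k_def inv)
  have dk: "diff_into (total_atlas B) k (snd c e)" unfolding k_def by (rule diff_into_chart_inv[OF B c])
  have dp: "diff_into M (\<lambda>z. bproj B (k z)) (snd c e)"
    using tangent_map_pushforward(1)[OF B V.base dk] smooth_map_diff_map[OF B V.base proj pe] by (simp add: k_def inv)
  have "diff_into (total_atlas V) (\<lambda>z. s (bproj B (k z))) (snd c e)"
    using tangent_map_pushforward(1)[OF V.base V.total dp] smooth_map_diff_map[OF V.base V.total s'(1) bp[OF pe]]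
    by (simp add: k_def inv)
  from has_derivative_diff_fun[OF V.total this, of \<Psi>]
  have "\<exists>D. ((\<lambda>z. \<Psi> (s (bproj B (k z)))) has_derivative D) (at (snd c e))"
    using V.diff_fun_triv e s'(2)[OF bp[OF pe]] by (auto simp: k_def inv)
  then have dl: "l differentiable (at (snd c e))"
    unfolding l_def differentiable_def using has_derivative_Pair[OF has_derivative_ident] by blast
  have "(\<lambda>z. snd ((snd D \<circ> f \<circ> chart_inv C) (l z))) differentiable (at (snd c e))"
    using has_derivative_snd[OF has_derivative_compose[OF fderiv_works[OF dl] fderiv_works[OF dH]]]
    unfolding differentiable_def by blast
  moreover have "eventually (\<lambda>z. z \<in> snd c ` fst c \<and> bproj B (k z) \<in> W) (nhds (snd c e))"
  proof (rule eventually_conj)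
    show "eventually (\<lambda>z. z \<in> snd c ` fst c) (nhds (snd c e))"
      using smooth_atlas_overlap[OF B c(1) c(1)] c(2) unfolding eventually_nhds by auto
    show "eventually (\<lambda>z. bproj B (k z) \<in> W) (nhds (snd c e))"
      by (rule diff_into_eventually_openin[OF V.base dp V.openin_W]) (simp add: k_def inv e)
  qed
  then have "eventually (\<lambda>z. snd ((snd D \<circ> f \<circ> chart_inv C) (l z)) = hor_field B h s (chart_inv c z) c)
      (nhds (snd c e))"
  proof (rule eventually_mono)
    fix z assume z: "z \<in> snd c ` fst c \<and> bproj B (k z) \<in> W"
    then obtain q where q: "q \<in> fst c" "z = snd c q" "k z = q"
      using smooth_atlas_chart_inv[OF B c(1)] by (auto simp: k_def)
    have "l z = snd C (q, s (bproj B q))" using q by (simp add: l_def C_def)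
    moreover have "chart_inv C (snd C (q, s (bproj B q))) = (q, s (bproj B q))"
      by (rule chart_inv_apply[OF injC mem(1)]) (use q z in auto)
    ultimately show "snd ((snd D \<circ> f \<circ> chart_inv C) (l z)) = hor_field B h s (chart_inv c z) c"
      using q(3) by (simp add: D_def f_def hor_field_def k_def)
  qed
  ultimately show ?thesis by (rule differentiable_cong_ev[rotated])
qed

section \<open>Brackets of projectable, fibrewise affine fields with vertical lifts\<close>

text \<open>Additivity carries the derivative at \<open>0\<close> to every point, so that \<open>f t = t D\<close>.\<close>

lemma additive_derivative_at_0:
  fixes f :: "real \<Rightarrow> 'a::real_normed_vector"
  assumes add: "\<And>s t. f (s + t) = f s + f t" and D: "(f has_vector_derivative D) (at 0)"
  shows "f 1 = D"
proof -
  have f0: "f 0 = 0" using add[of 0 0] by simp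
  have "((\<lambda>t. f t - t *\<^sub>R D) has_vector_derivative 0) (at t within UNIV)" for t
  proof -
    have "((\<lambda>s. s - t) has_vector_derivative 1 - 0) (at t)"
      unfolding has_vector_derivative_def by (auto intro!: derivative_eq_intros)
    then have "((\<lambda>s. f (s - t)) has_vector_derivative D) (at t)"
      using vector_diff_chain_at[of "\<lambda>s. s - t" 1 t f D] D by (simp add: o_def)
    then have "((\<lambda>s. f t + f (s - t)) has_vector_derivative D) (at t)"
      by (auto intro!: derivative_eq_intros)
    moreover have "(\<lambda>s. f t + f (s - t)) = f" by (simp add: add[symmetric])
    ultimately have "(f has_vector_derivative D) (at t)" by simp
    then show ?thesis by (auto intro!: derivative_eq_intros)
  qed
  from has_vector_derivative_zero_constant[OF convex_UNIV this]
  obtain k where "\<And>t. f t - t *\<^sub>R D = k" by auto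
  from this[of 0] this[of 1] show ?thesis by (simp add: f0)
qed

context affine_trivialization
begin

text \<open>The field \<open>X\<close> stands for a horizontal lift: it projects to \<open>\<xi>\<close>, and its fibre component is affine on
  the fibre through \<open>e\<close> with linear part \<open>\<beta>\<close>.\<close>

context
  fixes X :: "'b \<Rightarrow> ('b, 'n) tvec" and \<xi> :: "'p \<Rightarrow> ('p, 'm) tvec" and \<beta> :: "'c \<Rightarrow> 'f" and e
  assumes e: "e \<in> points (total_atlas E)" "bproj E e \<in> W" and X: "diff_field (total_atlas E) X e"
    and projects: "\<And>q. q \<in> points (total_atlas E) \<Longrightarrow> bproj E q \<in> W \<Longrightarrow>
      tangent_map (total_atlas E) M (bproj E) q (X q) = \<xi> (bproj E q)"
    and affine: "\<And>q a. q \<in> points (total_atlas E) \<Longrightarrow> bproj E q = bproj E e \<Longrightarrow> a \<in> fibre Eb (bproj E e) \<Longrightarrow>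
      differential (total_atlas E) \<Phi> (translate E q a) (X (translate E q a))
        = differential (total_atlas E) \<Phi> q (X q) + \<beta> a"
begin

text \<open>Along \<open>t \<mapsto> e + t a\<close> the fibre component of \<open>X\<close> grows by \<open>\<beta>(t a)\<close>. Comparing the steps \<open>s\<close>, \<open>t\<close> and
  \<open>s + t\<close> shows that this is additive in \<open>t\<close>, and it is differentiable at \<open>0\<close> because \<open>X\<close> is.\<close>

lemma derivative_of_affine_component:
  assumes a: "a \<in> fibre Eb (bproj E e)"
  shows "differential (total_atlas E) (\<lambda>q. differential (total_atlas E) \<Phi> q (X q)) e (vlift E Eb e a) = \<beta> a"
proof -
  define H where "H = (\<lambda>q. differential (total_atlas E) \<Phi> q (X q))"
  define f where "f = (\<lambda>t. \<beta> (vscale Eb t a))"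
  define l where "l = (\<lambda>t. translate E e (vscale Eb t a))"
  have l: "l t \<in> points (total_atlas E)" "bproj E (l t) = bproj E e" "\<Phi> (l t) = \<Phi> e + t *\<^sub>R \<Phi>b a" for t
    using line_points[OF e a] line_bproj[OF e a] line_triv[OF e a] by (simp_all add: l_def)
  have sa: "vscale Eb t a \<in> fibre Eb (bproj E e)" for t by (rule scale_fibre[OF e(2) a])
  have Hl: "H (l t) = H e + f t" for t
    using affine[OF e(1) refl sa] by (simp add: H_def l_def f_def)
  have "f (s + t) = f s + f t" for s t
  proof -
    have "translate E (l s) (vscale Eb t a) = l (s + t)"
    proof (rule E.triv_eqI)
      have a': "a \<in> fibre Eb (bproj E (l s))" and W': "bproj E (l s) \<in> W" using a l e by simp_all
      show "translate E (l s) (vscale Eb t a) \<in> points (total_atlas E)"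
        by (rule line_points[OF l(1) W' a'])
      show "bproj E (translate E (l s) (vscale Eb t a)) \<in> W"
        "bproj E (translate E (l s) (vscale Eb t a)) = bproj E (l (s + t))"
        using line_bproj[OF l(1) W' a'] l(2) e by simp_all
      show "\<Phi> (translate E (l s) (vscale Eb t a)) = \<Phi> (l (s + t))"
        using line_triv[OF l(1) W' a'] l(3) by (simp add: scaleR_add_left)
    qed (rule l(1))
    then have "H (l (s + t)) = H (l s) + f t"
      using affine[OF l(1) l(2) sa, of s t] by (simp add: H_def f_def)
    then show ?thesis by (simp add: Hl)
  qed
  moreover have "(f has_vector_derivative differential (total_atlas E) H e (vlift E Eb e a)) (at 0)"
  proof -
    have "diff_fun (total_atlas E) H e"
      unfolding H_def by (rule diff_fun_derivative_along_field[OF E.total e(1) E.C2_near_triv[OF e(2)] X])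
    from derivative_along_line[OF e a this]
    have "((\<lambda>t. H e + f t - H e) has_vector_derivative differential (total_atlas E) H e (vlift E Eb e a) - 0) (at 0)"
      by (intro has_vector_derivative_diff has_vector_derivative_const) (simp add: Hl[unfolded l_def])
    then show ?thesis by simp
  qed
  ultimately have "f 1 = differential (total_atlas E) H e (vlift E Eb e a)" by (rule additive_derivative_at_0)
  moreover have "vscale Eb 1 a = a"
    by (rule Eb.triv_eqI) (use a sa[of 1] e triv_scale[OF e(2) a] in \<open>auto simp: fibre_def\<close>)
  ultimately show ?thesis by (simp add: f_def H_def)
qed

context
  fixes b
  assumes b: "\<And>q. q \<in> points (total_atlas E) \<Longrightarrow> bproj E q \<in> W \<Longrightarrow> b q \<in> fibre Eb (bproj E q)"
    and Y: "diff_field (total_atlas E) (\<lambda>q. vlift E Eb q (b q)) e"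
begin

text \<open>For \<open>g\<close> a chart of the base composed with the projection, \<open>dg(Y)\<close> vanishes near \<open>e\<close> and \<open>dg(X)\<close> is
  constant along the line \<open>e + t b(e)\<close>, so both terms of \<open>dg([X, Y])\<close> are zero.\<close>

lemma bracket_vertical:
  "vertical M E e (lie_bracket (total_atlas E) X (\<lambda>q. vlift E Eb q (b q)) e)"
  unfolding vertical_def
proof (intro conjI ext)
  let ?Z = "lie_bracket (total_atlas E) X (\<lambda>q. vlift E Eb q (b q)) e"
  show "?Z \<in> tangent_space (total_atlas E) e" by (rule lie_bracket_in_tangent_space[OF E.total X Y])
  fix d
  have "differential (total_atlas E) (\<lambda>q. snd d (bproj E q)) e ?Z = 0" if d: "d \<in> M" "bproj E e \<in> fst d"
  proof -
    let ?g = "\<lambda>q. snd d (bproj E q)"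
    have C2: "C2_near (total_atlas E) ?g e" by (rule smooth_map_C2_near[OF E.total E.base E.proj d])
    define N where "N = {q \<in> points (total_atlas E). bproj E q \<in> fst d \<inter> W}"
    have N: "openin (atlas_topology (total_atlas E)) N"
      unfolding N_def
      by (intro smooth_map_openin_preimage[OF E.total E.proj] openin_Int openin_atlas_chart[OF E.base d(1)] E.openin_W)
    have eN: "e \<in> N" using d e by (simp add: N_def)
    have 0: "differential (total_atlas E) ?g q (vlift E Eb q (b q)) = 0" if "q \<in> N" for q
      using fun_cong[OF tangent_map_vlift[of q "b q"], of d] that b[of q] d
      by (simp add: N_def tangent_map_def o_def)
    have 1: "differential (total_atlas E) (\<lambda>q. differential (total_atlas E) ?g q (vlift E Eb q (b q))) e (X e) = 0"
      by (rule trans[OF differential_cong[OF E.total N eN 0] differential_const])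
    let ?H = "\<lambda>q. differential (total_atlas E) ?g q (X q)"
    have H: "?H q = \<xi> (bproj E q) d" if "q \<in> N" for q
      using fun_cong[OF projects[of q], of d] that d by (simp add: N_def tangent_map_def o_def)
    have "((\<lambda>t. ?H (translate E e (vscale Eb t (b e)))) has_vector_derivative
        differential (total_atlas E) ?H e (vlift E Eb e (b e))) (at 0)"
      by (rule derivative_along_line[OF e b[OF e] diff_fun_derivative_along_field[OF E.total e(1) C2 X]])
    moreover have "?H (translate E e (vscale Eb t (b e))) = \<xi> (bproj E e) d" for t
      using H[of "translate E e (vscale Eb t (b e))"] line_points[OF e b[OF e]] line_bproj[OF e b[OF e]] e d
      by (simp add: N_def)
    ultimately have "differential (total_atlas E) ?H e (vlift E Eb e (b e)) = 0"
      using vector_derivative_unique_at[OF _ has_vector_derivative_const] by simp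
    with 1 show ?thesis by (simp add: differential_lie_bracket[OF E.total e(1) C2 X Y])
  qed
  then show "tangent_map (total_atlas E) M (bproj E) e ?Z d = 0"
    by (simp add: tangent_map_def o_def)
qed

text \<open>For \<open>g = \<Phi>\<close> one has \<open>dg(Y) = \<Phi>b \<circ> b\<close> near \<open>e\<close>, and the derivative of \<open>dg(X)\<close> along \<open>Y\<close> is \<open>\<beta>(b e)\<close>.\<close>

lemma bracket_fibre_component:
  "differential (total_atlas E) \<Phi> e (lie_bracket (total_atlas E) X (\<lambda>q. vlift E Eb q (b q)) e)
    = differential (total_atlas E) (\<lambda>q. \<Phi>b (b q)) e (X e) - \<beta> (b e)"
proof -
  have N: "openin (atlas_topology (total_atlas E)) {q \<in> points (total_atlas E). bproj E q \<in> W}"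
    by (rule smooth_map_openin_preimage[OF E.total E.proj E.openin_W])
  have "differential (total_atlas E) (\<lambda>q. differential (total_atlas E) \<Phi> q (vlift E Eb q (b q))) e (X e)
      = differential (total_atlas E) (\<lambda>q. \<Phi>b (b q)) e (X e)"
    by (rule differential_cong[OF E.total N]) (use e differential_vlift b in auto)
  then show ?thesis
    by (simp add: differential_lie_bracket[OF E.total e(1) E.C2_near_triv[OF e(2)] X Y]
      derivative_of_affine_component[OF b[OF e]])
qed

end

end

text \<open>This description depends only on the base point of \<open>e\<close> and the fibre component of \<open>Q\<close>. It makes
  vertical parts at different points of a fibre comparable: if the fibre components agree, the two
  descriptions are the same term.\<close>

lemma vert_part_eq_THE:
  assumes e: "e \<in> points (total_atlas E)" "bproj E e \<in> W" and Q: "vertical M E e Q"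
  shows "vert_part E Eb e Q =
    (THE a. a \<in> fibre Eb (bproj E e) \<and> \<Phi>b a = differential (total_atlas E) \<Phi> e Q)"
  unfolding vert_part_def using vlift_eq_iff[OF e _ Q] by metis

end

section \<open>Affine connections\<close>

context affine_trivialization
begin

text \<open>Here \<open>\<zeta>\<close> is the tangent vector of the fibre product in the definition of an affine connection. The
  last claim differentiates \<open>\<Phi>(e + a) = \<Phi> e + \<Phi>b a\<close> in the direction \<open>\<zeta>\<close>. The first two hold because
  \<open>X\<close> and \<open>Y\<close> are images of \<open>\<zeta>\<close> under derivatives of maps from a vector space, namely of the two
  projections in a chart.\<close>

lemma affine_connection_components:
  assumes e: "e \<in> points (total_atlas E)" "bproj E e \<in> W" and a: "a \<in> fibre Eb (bproj E e)"
    and trivs: "\<And>W' \<Psi>. (W', \<Psi>) \<in> vtrivs Eb \<Longrightarrow> bundle_trivialization M Eb W' \<Psi>"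
    and cover: "points M \<subseteq> (\<Union>(W', \<Psi>)\<in>vtrivs Eb. W')"
    and X: "tangent_map (pullback_atlas E Eb) (total_atlas E) fst (e, a) \<zeta> = X"
    and Y: "tangent_map (pullback_atlas E Eb) (total_atlas Eb) snd (e, a) \<zeta> = Y"
    and Z: "tangent_map (pullback_atlas E Eb) (total_atlas E) (\<lambda>(x, y). translate E x y) (e, a) \<zeta> = Z"
  shows "X \<in> tangent_space (total_atlas E) e"
    and "Y \<in> tangent_space (total_atlas Eb) a"
    and "differential (total_atlas E) \<Phi> (translate E e a) Z
      = differential (total_atlas E) \<Phi> e X + differential (total_atlas Eb) \<Phi>b a Y"
proof -
  define c where "c = (SOME c. c \<in> pullback_atlas E Eb \<and> (e, a) \<in> fst c)"
  have "\<exists>c. c \<in> pullback_atlas E Eb \<and> (e, a) \<in> fst c"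
  proof -
    obtain U \<phi> where U: "(U, \<phi>) \<in> total_atlas E" "e \<in> U" using e(1) by (auto simp: points_def)
    obtain W' \<Psi> where W': "(W', \<Psi>) \<in> vtrivs Eb" "bproj E e \<in> W'"
      using cover E.bproj_points[OF e(1)] by blast
    let ?c = "({(q, v). q \<in> U \<and> bproj E q \<in> W' \<and> v \<in> fibre Eb (bproj E q)}, map_prod \<phi> \<Psi>)"
    have "?c \<in> pullback_atlas E Eb"
      unfolding pullback_atlas_def using U(1) W'(1) by blast
    moreover have "(e, a) \<in> fst ?c"
      using U(2) W'(2) a by simp
    ultimately show ?thesis by blast
  qed
  then have c: "c \<in> pullback_atlas E Eb" "(e, a) \<in> fst c"
    using someI_ex[of "\<lambda>c. c \<in> pullback_atlas E Eb \<and> (e, a) \<in> fst c"] by (simp_all add: c_def)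
  then obtain U \<phi> W' \<Psi> where U: "(U, \<phi>) \<in> total_atlas E" and W': "(W', \<Psi>) \<in> vtrivs Eb"
    and c_eq: "c = ({(q, v). q \<in> U \<and> bproj E q \<in> W' \<and> v \<in> fibre Eb (bproj E q)}, map_prod \<phi> \<Psi>)"
    unfolding pullback_atlas_def by blast
  interpret F: bundle_trivialization M Eb W' \<Psi> by (rule trivs[OF W'])
  have eU: "e \<in> U" "bproj E e \<in> W'" using c(2) by (simp_all add: c_eq)
  have pU: "q \<in> points (total_atlas E)" if "q \<in> U" for q using U that by (force simp: points_def)
  define k where "k = chart_inv c"
  define x where "x = snd c (e, a)"
  have x: "x = (\<phi> e, \<Psi> a)" by (simp add: x_def c_eq)
  have inj: "inj_on (snd c) (fst c)"
  proof (rule inj_onI)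
    fix x y assume xy: "x \<in> fst c" "y \<in> fst c" "snd c x = snd c y"
    then have "fst x = fst y"
      using inj_onD[OF smooth_atlas_inj[OF E.total U]] by (auto simp: c_eq)
    then show "x = y"
      using xy F.triv_eqI[of "snd x" "snd y"] by (auto simp: c_eq fibre_def)
  qed
  have kx: "k x = (e, a)" unfolding k_def x_def by (rule chart_inv_apply[OF inj c(2)])
  \<comment> \<open>\<open>S\<close> lies in the image of the chart, and \<open>k\<close> inverts the chart on \<open>S\<close>\<close>
  define S where "S = \<phi> ` (U \<inter> bproj E -` W') \<times> (UNIV :: 'f set)"
  have "open (\<phi> ` (U \<inter> bproj E -` W'))"
    using smooth_map_openin[OF E.total E.proj F.openin_W U] by simp
  then have "open S" by (simp add: S_def open_Times)
  have xS: "x \<in> S" using eU by (auto simp: S_def x)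
  have kS: "\<exists>q v. q \<in> U \<and> bproj E q \<in> W' \<and> v \<in> fibre Eb (bproj E q) \<and> k z = (q, v) \<and> z = (\<phi> q, \<Psi> v)"
    if z: "z \<in> S" for z
  proof -
    obtain q w where q: "q \<in> U" "bproj E q \<in> W'" "z = (\<phi> q, w)" using z by (auto simp: S_def)
    obtain v where v: "v \<in> points (total_atlas Eb)" "bproj Eb v = bproj E q" "\<Psi> v = w"
      using F.triv_surj[OF q(2)] .
    have mem: "(q, v) \<in> fst c" using q v by (simp add: c_eq fibre_def)
    have "k (snd c (q, v)) = (q, v)" unfolding k_def by (rule chart_inv_apply[OF inj mem])
    then show ?thesis using q v mem by (auto simp: c_eq)
  qed
  have ev: "eventually P (nhds x)" if "\<And>q v. q \<in> U \<Longrightarrow> bproj E q \<in> W' \<Longrightarrow> v \<in> fibre Eb (bproj E q) \<Longrightarrow>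
      k (\<phi> q, \<Psi> v) = (q, v) \<Longrightarrow> P (\<phi> q, \<Psi> v)" for P
    unfolding eventually_nhds using \<open>open S\<close> xS kS that by metis
  have inv: "chart_inv (U, \<phi>) (\<phi> q) = q" if "q \<in> U" for q
    using smooth_atlas_chart_inv[OF E.total U] that by simp
  have d1: "diff_into (total_atlas E) (\<lambda>z. fst (k z)) x"
  proof (rule diff_into_cong_ev)
    show "diff_into (total_atlas E) (\<lambda>z. chart_inv (U, \<phi>) (fst z)) x"
      by (rule diff_into_precompose)
        (use diff_into_chart_inv[OF E.total U, of e] eU x in \<open>auto intro: bounded_linear_fst bounded_linear_imp_differentiable\<close>)
    show "eventually (\<lambda>z. chart_inv (U, \<phi>) (fst z) = fst (k z)) (nhds x)"
      by (rule ev) (simp add: inv)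
  qed
  have dp: "diff_into M (\<lambda>z. bproj E (fst (k z))) x"
    using tangent_map_pushforward(1)[OF E.total E.base d1] E.diff_map_bproj[OF e(1)] by (simp add: kx)
  have d2: "diff_into (total_atlas Eb) (\<lambda>z. snd (k z)) x"
  proof (rule F.diff_into_trivI)
    show "eventually (\<lambda>z. snd (k z) \<in> points (total_atlas Eb)) (nhds x)"
      by (rule ev) (auto simp: fibre_def)
    show "bproj Eb (snd (k x)) \<in> W'" using a eU by (simp add: kx fibre_def)
    show "diff_into M (\<lambda>z. bproj Eb (snd (k z))) x"
      by (rule diff_into_cong_ev[OF _ dp], rule ev) (auto simp: fibre_def)
    show "(\<lambda>z. \<Psi> (snd (k z))) differentiable (at x)"
      by (rule differentiable_cong_ev[of snd], rule ev)
        (auto intro: bounded_linear_snd bounded_linear_imp_differentiable)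
  qed
  have "eventually (\<lambda>z. bproj E (fst (k z)) \<in> W) (nhds x)"
    by (rule diff_into_eventually_openin[OF E.base dp E.openin_W]) (simp add: kx e)
  moreover have "eventually (\<lambda>z. fst (k z) \<in> points (total_atlas E) \<and> snd (k z) \<in> fibre Eb (bproj E (fst (k z)))) (nhds x)"
    by (rule ev) (simp add: pU)
  ultimately have "eventually (\<lambda>z. translate E (fst (k z)) (snd (k z)) \<in> fibre E (bproj E (fst (k z))) \<and>
      \<Phi> (translate E (fst (k z)) (snd (k z))) = \<Phi> (fst (k z)) + \<Phi>b (snd (k z))) (nhds x)"
    by (rule eventually_elim2) (simp add: translate_fibre triv_translate)
  note tr = eventually_mono[OF this]
  have h1: "((\<lambda>z. \<Phi> (fst (k z))) has_derivative (\<lambda>u. differential (total_atlas E) \<Phi> e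
      (pushforward (total_atlas E) (\<lambda>z. fst (k z)) x u))) (at x)"
    using has_derivative_diff_fun[OF E.total d1, of \<Phi>] E.diff_fun_triv[OF e(2)] by (simp add: kx)
  have h2: "((\<lambda>z. \<Phi>b (snd (k z))) has_derivative (\<lambda>u. differential (total_atlas Eb) \<Phi>b a
      (pushforward (total_atlas Eb) (\<lambda>z. snd (k z)) x u))) (at x)"
    using has_derivative_diff_fun[OF Eb.total d2, of \<Phi>b] Eb.diff_fun_triv[of a] a e by (simp add: kx fibre_def)
  have "eventually (\<lambda>z. \<Phi> (fst (k z)) + \<Phi>b (snd (k z)) = \<Phi> (translate E (fst (k z)) (snd (k z)))) (nhds x)"
    by (rule tr) simp
  from has_derivative_transform_ev[OF this has_derivative_add[OF h1 h2]]
  have h12: "((\<lambda>z. \<Phi> (translate E (fst (k z)) (snd (k z)))) has_derivative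
     (\<lambda>u. differential (total_atlas E) \<Phi> e (pushforward (total_atlas E) (\<lambda>z. fst (k z)) x u) +
          differential (total_atlas Eb) \<Phi>b a (pushforward (total_atlas Eb) (\<lambda>z. snd (k z)) x u))) (at x)" .
  have te: "bproj E (translate E e a) = bproj E e" using translate_fibre[OF e(2,1) a] by (simp add: fibre_def)
  have d3: "diff_into (total_atlas E) (\<lambda>z. translate E (fst (k z)) (snd (k z))) x"
  proof (rule E.diff_into_trivI)
    show "eventually (\<lambda>z. translate E (fst (k z)) (snd (k z)) \<in> points (total_atlas E)) (nhds x)"
      by (rule tr) (simp add: fibre_def)
    show "diff_into M (\<lambda>z. bproj E (translate E (fst (k z)) (snd (k z)))) x"
      by (rule diff_into_cong_ev[OF _ dp], rule tr) (simp add: fibre_def)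
    show "(\<lambda>z. \<Phi> (translate E (fst (k z)) (snd (k z)))) differentiable (at x)"
      using h12 unfolding differentiable_def by blast
  qed (simp add: kx te e)
  have h3: "((\<lambda>z. \<Phi> (translate E (fst (k z)) (snd (k z)))) has_derivative
      (\<lambda>u. differential (total_atlas E) \<Phi> (translate E e a)
        (pushforward (total_atlas E) (\<lambda>z. translate E (fst (k z)) (snd (k z))) x u))) (at x)"
    using has_derivative_diff_fun[OF E.total d3, of \<Phi>] E.diff_fun_triv[of "translate E e a"] e te by (simp add: kx)
  have ci: "chart_inv c (snd c (e, a)) = (e, a)" by (rule chart_inv_apply[OF inj c(2)])
  note pushforward = tangent_map_some_chart[OF c_def ci, folded k_def x_def]
  have X': "X = pushforward (total_atlas E) (\<lambda>z. fst (k z)) x (\<zeta> c)" unfolding X[symmetric] by (rule pushforward)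
  have Y': "Y = pushforward (total_atlas Eb) (\<lambda>z. snd (k z)) x (\<zeta> c)" unfolding Y[symmetric] by (rule pushforward)
  have Z': "Z = pushforward (total_atlas E) (\<lambda>z. translate E (fst (k z)) (snd (k z))) x (\<zeta> c)"
    unfolding Z[symmetric] by (rule trans[OF pushforward]) (simp add: case_prod_beta)
  show "X \<in> tangent_space (total_atlas E) e" using pushforward_in_tangent_space[OF E.total d1] by (simp add: X' kx)
  show "Y \<in> tangent_space (total_atlas Eb) a" using pushforward_in_tangent_space[OF Eb.total d2] by (simp add: Y' kx)
  show "differential (total_atlas E) \<Phi> (translate E e a) Z
      = differential (total_atlas E) \<Phi> e X + differential (total_atlas Eb) \<Phi>b a Y"
    using fun_cong[OF trans[OF fderiv_eqI[OF h3, symmetric] fderiv_eqI[OF h12]], of "\<zeta> c"]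
    by (simp add: X' Y' Z')
qed

end

lemma tangent_map_section:
  assumes M: "smooth_atlas M" and B: "smooth_atlas (total_atlas B)"
    and proj: "smooth_map (total_atlas B) M (bproj B)" and \<sigma>: "\<sigma> \<in> Sec M B"
    and m: "m \<in> points M" and \<xi>: "\<xi> \<in> tangent_space M m"
  shows "tangent_map (total_atlas B) M (bproj B) (\<sigma> m) (tangent_map M (total_atlas B) \<sigma> m \<xi>) = \<xi>"
proof
  fix d
  have \<sigma>': "smooth_map M (total_atlas B) \<sigma>" "\<And>m. m \<in> points M \<Longrightarrow> bproj B (\<sigma> m) = m"
    using \<sigma> by (auto simp: Sec_def)
  have p: "\<sigma> m \<in> points (total_atlas B)" by (rule smooth_map_points[OF M B \<sigma>'(1) m])
  have "differential (total_atlas B) (\<lambda>q. snd d (bproj B q)) (\<sigma> m) (tangent_map M (total_atlas B) \<sigma> m \<xi>) = \<xi> d"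
    if d: "d \<in> M" "m \<in> fst d"
  proof -
    have g: "diff_fun (total_atlas B) (\<lambda>q. snd d (bproj B q)) (\<sigma> m)"
      by (rule diff_fun_diff_map[OF M smooth_map_diff_map[OF B M proj p] diff_fun_chart[OF M d(1)] B])
        (simp add: \<sigma>'(2)[OF m] d)
    have "openin (atlas_topology M) (points M)"
      using openin_topspace[of "atlas_topology M"] topspace_atlas_topology[OF M] by simp
    from differential_cong[OF M this m, of "\<lambda>q. snd d (bproj B (\<sigma> q))" "snd d" \<xi>]
    show ?thesis
      using differential_tangent_map[OF M B \<xi> m smooth_map_diff_map[OF M B \<sigma>'(1) m] g] \<sigma>'(2)
        differential_own_chart[OF M \<xi> d] by simp
  qed
  then show "tangent_map (total_atlas B) M (bproj B) (\<sigma> m) (tangent_map M (total_atlas B) \<sigma> m \<xi>) d = \<xi> d"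
    using tangent_spaceD(2)[OF \<xi>, of d] \<sigma>'(2)[OF m] by (simp add: tangent_map_def[of "total_atlas B"] o_def)
qed

text \<open>Both vectors project to \<open>\<xi>\<close>, the first because \<open>\<sigma>\<close> is a section.\<close>

lemma covariant_derivative_vertical:
  assumes M: "smooth_atlas M" and B: "smooth_atlas (total_atlas B)"
    and proj: "smooth_map (total_atlas B) M (bproj B)" and \<sigma>: "\<sigma> \<in> Sec M B"
    and m: "m \<in> points M" and \<xi>: "\<xi> \<in> tangent_space M m"
    and \<eta>: "\<eta> \<in> tangent_space (total_atlas B) (\<sigma> m)"
    and over: "tangent_map (total_atlas B) M (bproj B) (\<sigma> m) \<eta> = \<xi>"
  shows "vertical M B (\<sigma> m) (\<lambda>c. tangent_map M (total_atlas B) \<sigma> m \<xi> c - \<eta> c)"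
proof -
  have \<sigma>': "smooth_map M (total_atlas B) \<sigma>" using \<sigma> by (simp add: Sec_def)
  have p: "\<sigma> m \<in> points (total_atlas B)" by (rule smooth_map_points[OF M B \<sigma>' m])
  have T: "tangent_map M (total_atlas B) \<sigma> m \<xi> \<in> tangent_space (total_atlas B) (\<sigma> m)"
    by (rule tangent_map_in_tangent_space[OF M B \<xi> m smooth_map_diff_map[OF M B \<sigma>' m]])
  show ?thesis
    using tangent_space_diff[OF B T \<eta>] tangent_map_diff[OF B M p T \<eta> smooth_map_diff_map[OF B M proj p]]
    by (simp add: vertical_def tangent_map_section[OF M B proj \<sigma> m \<xi>] over)
qed

section \<open>Covariant derivatives as brackets\<close>

lemma Sec_fibre:
  assumes "smooth_atlas M" "smooth_atlas (total_atlas B)" "\<sigma> \<in> Sec M B" "m \<in> points M"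
  shows "\<sigma> m \<in> fibre B m"
  using assms smooth_map_points[OF assms(1,2)] by (auto simp: Sec_def fibre_def)

lemma vector_bundle_trivialization:
  assumes "vector_bundle M B" "(W, \<Psi>) \<in> vtrivs B"
  shows "bundle_trivialization M B W \<Psi>"
  using assms
  by unfold_locales (auto simp: vector_bundle_def smooth_manifold_def linear_triv_def)

text \<open>The same linear trivialization \<open>\<Phi>b\<close> serves the affine bundle and the model bundle regarded as an
  affine bundle, so that fibre components of both covariant derivatives are comparable.\<close>

lemma affine_bundle_trivialization:
  assumes EEb: "affine_bundle M E Eb" and m: "m \<in> points M"
  obtains W \<Phi> \<Phi>b where "m \<in> W" "affine_trivialization M E Eb W \<Phi> \<Phi>b"
    "affine_trivialization M (self_affine Eb) Eb W \<Phi>b \<Phi>b"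
proof -
  obtain W \<Phi> \<Phi>b where W: "m \<in> W" "local_triv M E W \<Phi>" "linear_triv M Eb W \<Phi>b"
    and \<Phi>: "\<forall>x\<in>W. \<forall>e\<in>fibre E x. \<forall>a\<in>fibre Eb x. \<Phi> (translate E e a) = \<Phi> e + \<Phi>b a"
    using EEb m unfolding affine_bundle_def by blast
  have Eb: "vector_bundle M Eb" and sE: "smooth_atlas (total_atlas E)" and pE: "smooth_map (total_atlas E) M (bproj E)"
    using EEb by (auto simp: affine_bundle_def smooth_manifold_def)
  have sM: "smooth_atlas M" and sEb: "smooth_atlas (total_atlas Eb)"
    and pEb: "smooth_map (total_atlas Eb) M (bproj Eb)"
    using Eb by (auto simp: vector_bundle_def smooth_manifold_def)
  have lE: "bundle_trivialization M E W \<Phi>" using sM sE pE W(2) by unfold_locales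
  have lb: "local_triv M Eb W \<Phi>b" using W(3) by (simp add: linear_triv_def)
  have lEb: "bundle_trivialization M Eb W \<Phi>b" using sM sEb pEb lb by unfold_locales
  have lS: "bundle_trivialization M (self_affine Eb) W \<Phi>b"
    using sM sEb pEb lb by unfold_locales (simp_all add: self_affine_def local_triv_def)
  have WM: "W \<subseteq> points M"
    using openin_subset[OF bundle_trivialization.openin_W[OF lE]] topspace_atlas_topology[OF sM] by simp
  have aff: "affine_space_on (fibre E x) (fibre Eb x) (translate E) (vadd Eb)"
    and vec: "vector_space_on (fibre Eb x) (vadd Eb) (vscale Eb)" if "x \<in> W" for x
    using EEb Eb WM that unfolding affine_bundle_def vector_bundle_def by blast+
  have tr: "translate E e a \<in> fibre E x" if "x \<in> W" "e \<in> fibre E x" "a \<in> fibre Eb x" for x e a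
    using aff[OF that(1)] that(2,3) unfolding affine_space_on_def by blast
  have add: "vadd Eb e a \<in> fibre Eb x" if "x \<in> W" "e \<in> fibre Eb x" "a \<in> fibre Eb x" for x e a
    using vec[OF that(1)] that(2,3) unfolding vector_space_on_def by blast
  have scale: "vscale Eb r a \<in> fibre Eb x" if "x \<in> W" "a \<in> fibre Eb x" for x r a
    using vec[OF that(1)] that(2) unfolding vector_space_on_def by blast
  have lin: "\<Phi>b (vadd Eb a b) = \<Phi>b a + \<Phi>b b" "\<Phi>b (vscale Eb r a) = r *\<^sub>R \<Phi>b a"
    if "x \<in> W" "a \<in> fibre Eb x" "b \<in> fibre Eb x" for x a b r
    using W(3) that unfolding linear_triv_def by blast+
  have fib: "fibre (self_affine Eb) x = fibre Eb x" for x by (simp add: fibre_def self_affine_def)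
  have self: "bproj (self_affine Eb) = bproj Eb" "total_atlas (self_affine Eb) = total_atlas Eb"
    "translate (self_affine Eb) = vadd Eb"
    by (simp_all add: self_affine_def)
  have "affine_trivialization M E Eb W \<Phi> \<Phi>b"
  proof (intro affine_trivialization.intro affine_trivialization_axioms.intro lE lEb)
    fix e a assume *: "bproj E e \<in> W" "e \<in> points (total_atlas E)" "a \<in> fibre Eb (bproj E e)"
    then have "e \<in> fibre E (bproj E e)" by (simp add: fibre_def)
    then show "translate E e a \<in> fibre E (bproj E e)" "\<Phi> (translate E e a) = \<Phi> e + \<Phi>b a"
      using tr * \<Phi> by blast+
  qed (use scale lin(2) in blast)+
  moreover have "affine_trivialization M (self_affine Eb) Eb W \<Phi>b \<Phi>b"
  proof (intro affine_trivialization.intro affine_trivialization_axioms.intro lS lEb, unfold self fib)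
    fix e a assume *: "bproj Eb e \<in> W" "e \<in> points (total_atlas Eb)" "a \<in> fibre Eb (bproj Eb e)"
    then have "e \<in> fibre Eb (bproj Eb e)" by (simp add: fibre_def)
    then show "vadd Eb e a \<in> fibre Eb (bproj Eb e)" "\<Phi>b (vadd Eb e a) = \<Phi>b e + \<Phi>b a"
      using add lin(1) * by blast+
  qed (use scale lin(2) in blast)+
  ultimately show ?thesis using that W(1) by blast
qed

lemma point_diff:
  assumes EEb: "affine_bundle M E Eb" and m: "m \<in> points M" and e: "e \<in> fibre E m" "e' \<in> fibre E m"
  shows "point_diff E Eb e' e \<in> fibre Eb m" "translate E e (point_diff E Eb e' e) = e'"
proof -
  have "affine_space_on (fibre E m) (fibre Eb m) (translate E) (vadd Eb)"
    using EEb m by (simp add: affine_bundle_def)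
  then have "\<exists>!a. a \<in> fibre Eb m \<and> translate E e a = e'"
    using e by (simp add: affine_space_on_def)
  from theI'[OF this] show "point_diff E Eb e' e \<in> fibre Eb m" "translate E e (point_diff E Eb e' e) = e'"
    using e(1) by (simp_all add: point_diff_def fibre_def)
qed

theorem proposition5:
  fixes M :: "('p, 'm::finite_dim_inner) atlas"
    and E :: "('p, 'b, 'n::finite_dim_inner, 'c) abundle"
    and Eb :: "('p, 'c, 'k::finite_dim_inner, 'f::finite_dim_inner) vbundle"
    and V :: "('p, 'd, 'l::finite_dim_inner, 'w::finite_dim_inner) vbundle"
    and \<rho> :: "'d \<Rightarrow> ('p, 'm) tvec"
    and h :: "'b \<Rightarrow> 'd \<Rightarrow> ('b, 'n) tvec"
    and hb :: "'c \<Rightarrow> 'd \<Rightarrow> ('c, 'k) tvec"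
    and s :: "'p \<Rightarrow> 'd" and \<sigma>b :: "'p \<Rightarrow> 'c" and \<sigma> :: "'p \<Rightarrow> 'b"
  assumes "affine_bundle M E Eb"
    and "vector_bundle M V"
    and "anchor M V \<rho>"
    and "affine_rho_connection M V \<rho> E Eb h hb"
    and "s \<in> Sec M V" and "\<sigma>b \<in> Sec M Eb" and "\<sigma> \<in> Sec M E"
  shows "\<forall>e\<in>points (total_atlas E).
      vertical M E e (lie_bracket (total_atlas E) (hor_field E h s) (vlift_vsec E Eb \<sigma>b) e) \<and>
      vertical M E e (lie_bracket (total_atlas E) (hor_field E h s) (vlift_asec E Eb \<sigma>) e) \<and>
      nabla_bar M \<rho> Eb hb s \<sigma>b (bproj E e) =
        vert_part E Eb e (lie_bracket (total_atlas E) (hor_field E h s) (vlift_vsec E Eb \<sigma>b) e) \<and>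
      nabla M \<rho> E Eb h s \<sigma> (bproj E e) =
        vert_part E Eb e (lie_bracket (total_atlas E) (hor_field E h s) (vlift_asec E Eb \<sigma>) e)"
proof
  fix e assume e: "e \<in> points (total_atlas E)"
  note EEb = assms(1) and V = assms(2) and s = assms(5) and \<sigma>b = assms(6) and \<sigma> = assms(7)
  have Eb: "vector_bundle M Eb" and sE: "smooth_atlas (total_atlas E)" and pE: "smooth_map (total_atlas E) M (bproj E)"
    using EEb by (auto simp: affine_bundle_def smooth_manifold_def)
  have sM: "smooth_atlas M" and sEb: "smooth_atlas (total_atlas Eb)"
    and pEb: "smooth_map (total_atlas Eb) M (bproj Eb)"
    using Eb by (auto simp: vector_bundle_def smooth_manifold_def)
  have sV: "smooth_atlas (total_atlas V)" using V by (auto simp: vector_bundle_def smooth_manifold_def)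
  have bp: "bproj E q \<in> points M" if "q \<in> points (total_atlas E)" for q
    by (rule smooth_map_points[OF sE sM pE that])
  have h: "rho_connection M V \<rho> E h" and hb: "rho_connection M V \<rho> Eb hb"
    using assms(4) by (auto simp: affine_rho_connection_def linear_rho_connection_def)
  have h_smooth: "smooth_map (pullback_atlas E V) (tangent_atlas (total_atlas E)) (\<lambda>(e, v). (e, h e v))"
    using h by (simp add: rho_connection_def)
  have h_proj: "tangent_map (total_atlas E) M (bproj E) q (h q v) = \<rho> v"
    if "q \<in> points (total_atlas E)" "v \<in> fibre V (bproj E q)" for q v
    using h that by (simp add: rho_connection_def)
  have hb_proj: "tangent_map (total_atlas Eb) M (bproj Eb) a (hb a v) = \<rho> v"
    if "a \<in> points (total_atlas Eb)" "v \<in> fibre V (bproj Eb a)" for a v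
    using hb that by (simp add: rho_connection_def)
  have cover: "points M \<subseteq> (\<Union>(W', \<Psi>)\<in>vtrivs Eb. W')" "points M \<subseteq> (\<Union>(W', \<Psi>)\<in>vtrivs V. W')"
    using Eb V unfolding vector_bundle_def by blast+

  have components: "h q v \<in> tangent_space (total_atlas E) q" "hb a v \<in> tangent_space (total_atlas Eb) a"
    "differential (total_atlas E) \<Phi> (translate E q a) (h (translate E q a) v)
      = differential (total_atlas E) \<Phi> q (h q v) + differential (total_atlas Eb) \<Phi>b a (hb a v)"
    if *: "affine_trivialization M E Eb W \<Phi> \<Phi>b" "q \<in> points (total_atlas E)" "bproj E q \<in> W"
      "a \<in> fibre Eb (bproj E q)" "v \<in> fibre V (bproj E q)" for W \<Phi> \<Phi>b q a v
  proof -
    have "q \<in> fibre E (bproj E q)" using * by (simp add: fibre_def)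
    then obtain \<zeta> where \<zeta>:
      "tangent_map (pullback_atlas E Eb) (total_atlas E) fst (q, a) \<zeta> = h q v"
      "tangent_map (pullback_atlas E Eb) (total_atlas Eb) snd (q, a) \<zeta> = hb a v"
      "tangent_map (pullback_atlas E Eb) (total_atlas E) (\<lambda>(x, y). translate E x y) (q, a) \<zeta> = h (translate E q a) v"
      using assms(4) *(4,5) bp[OF *(2)] unfolding affine_rho_connection_def by metis
    note ** = affine_trivialization.affine_connection_components[OF *(1-4)
        vector_bundle_trivialization[OF Eb] cover(1) \<zeta>]
    show "h q v \<in> tangent_space (total_atlas E) q" "hb a v \<in> tangent_space (total_atlas Eb) a"
      "differential (total_atlas E) \<Phi> (translate E q a) (h (translate E q a) v)
        = differential (total_atlas E) \<Phi> q (h q v) + differential (total_atlas Eb) \<Phi>b a (hb a v)"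
      by (rule **; assumption)+
  qed
  \<comment> \<open>any translation vector in the fibre exhibits \<open>h q v\<close> as the projection of some \<open>\<zeta>\<close>\<close>
  have h_tangent: "h q v \<in> tangent_space (total_atlas E) q"
    if q: "q \<in> points (total_atlas E)" "v \<in> fibre V (bproj E q)" for q v
  proof -
    obtain W \<Phi> \<Phi>b where W: "bproj E q \<in> W" "affine_trivialization M E Eb W \<Phi> \<Phi>b"
      using affine_bundle_trivialization[OF EEb bp[OF q(1)]] by metis
    interpret affine_trivialization M E Eb W \<Phi> \<Phi>b by (rule W(2))
    obtain a where "a \<in> points (total_atlas Eb)" "bproj Eb a = bproj E q"
      using Eb.triv_surj[OF W(1)] by metis
    then show ?thesis using components(1)[OF W(2) q(1) W(1) _ q(2), of a] by (simp add: fibre_def)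
  qed

  define m where "m = bproj E e"
  define v where "v = s m"
  have m: "m \<in> points M" using bp[OF e] by (simp add: m_def)
  have v: "v \<in> fibre V m" unfolding v_def by (rule Sec_fibre[OF sM sV s m])
  obtain W \<Phi> \<Phi>b where mW: "m \<in> W" and triv: "affine_trivialization M E Eb W \<Phi> \<Phi>b"
    and self_triv: "affine_trivialization M (self_affine Eb) Eb W \<Phi>b \<Phi>b"
    using affine_bundle_trivialization[OF EEb m] .
  interpret T: affine_trivialization M E Eb W \<Phi> \<Phi>b by (rule triv)
  interpret S: affine_trivialization M "self_affine Eb" Eb W \<Phi>b \<Phi>b by (rule self_triv)
  have eW: "bproj E e \<in> W" using mW by (simp add: m_def)
  define X where "X = hor_field E h s"
  define \<beta> where "\<beta> = (\<lambda>a. differential (total_atlas Eb) \<Phi>b a (hb a v))"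
  have X_eq: "X q = h q (s (bproj E q))" for q by (simp add: X_def hor_field_def)
  have sf: "s (bproj E q) \<in> fibre V (bproj E q)" if "q \<in> points (total_atlas E)" for q
    by (rule Sec_fibre[OF sM sV s bp[OF that]])
  have X: "diff_field (total_atlas E) X e"
  proof -
    obtain W' \<Psi> where W': "(W', \<Psi>) \<in> vtrivs V" "bproj E e \<in> W'" using cover(2) bp[OF e] by blast
    have "(\<lambda>z. X (chart_inv c z) c) differentiable (at (snd c e))" if "c \<in> total_atlas E" "e \<in> fst c" for c
      unfolding X_def
      by (rule hor_field_differentiable[OF vector_bundle_trivialization[OF V W'(1)] W'(1) sE pE h_smooth
            h_tangent s W'(2) that])
    then show ?thesis using h_tangent[OF _ sf] by (simp add: diff_field_def X_eq)
  qed
  have projects: "tangent_map (total_atlas E) M (bproj E) q (X q) = \<rho> (s (bproj E q))"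
    if "q \<in> points (total_atlas E)" for q
    using h_proj[OF that sf[OF that]] by (simp add: X_eq)
  have affine: "differential (total_atlas E) \<Phi> (translate E q a) (X (translate E q a))
      = differential (total_atlas E) \<Phi> q (X q) + \<beta> a"
    if q: "q \<in> points (total_atlas E)" "bproj E q = bproj E e" and a: "a \<in> fibre Eb (bproj E e)" for q a
  proof -
    have qW: "bproj E q \<in> W" and a': "a \<in> fibre Eb (bproj E q)" using q a eW by simp_all
    have "bproj E (translate E q a) = m"
      using T.translate_fibre[OF qW q(1) a'] q(2) by (simp add: fibre_def m_def)
    then show ?thesis
      using components(3)[OF triv q(1) qW a', of v] v q(2) by (simp add: X_eq \<beta>_def v_def m_def)
  qed
  \<comment> \<open>tangency at points outside \<open>W\<close> needs the trivializations around those points\<close>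
  have Y: "diff_field (total_atlas E) (\<lambda>q. vlift E Eb q (b q)) e"
    if b: "\<And>q. q \<in> points (total_atlas E) \<Longrightarrow> b q \<in> fibre Eb (bproj E q)"
      and db: "diff_fun (total_atlas E) (\<lambda>q. \<Phi>b (b q)) e" for b
  proof -
    have "vlift E Eb q (b q) \<in> tangent_space (total_atlas E) q" if q: "q \<in> points (total_atlas E)" for q
    proof -
      obtain W' \<Phi>' \<Phi>b' where W': "bproj E q \<in> W'" "affine_trivialization M E Eb W' \<Phi>' \<Phi>b'"
        using affine_bundle_trivialization[OF EEb bp[OF q]] by metis
      show ?thesis by (rule affine_trivialization.vlift_in_tangent_space[OF W'(2) q W'(1) b[OF q]])
    qed
    moreover have "(\<lambda>z. vlift E Eb (chart_inv c z) (b (chart_inv c z)) c) differentiable (at (snd c e))"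
      if "c \<in> total_atlas E" "e \<in> fst c" for c
      by (rule T.vlift_field_differentiable[OF eW that _ db]) (rule b)
    ultimately show ?thesis by (simp add: diff_field_def)
  qed
  have \<rho>v: "\<rho> v \<in> tangent_space M m" "tangent_map (total_atlas E) M (bproj E) e (X e) = \<rho> v"
    using tangent_map_in_tangent_space[OF sE sM h_tangent[OF e] e T.E.diff_map_bproj[OF e], of v]
      h_proj[OF e] v projects[OF e] by (simp_all add: m_def v_def)
  have Xe: "X e \<in> tangent_space (total_atlas E) e" using X e by (simp add: diff_field_def)

  have bracket: "vertical M E e (lie_bracket (total_atlas E) X (\<lambda>q. vlift E Eb q (b q)) e)"
    "vert_part E Eb e (lie_bracket (total_atlas E) X (\<lambda>q. vlift E Eb q (b q)) e) =
      (THE a. a \<in> fibre Eb m \<and> \<Phi>b a = differential (total_atlas E) (\<lambda>q. \<Phi>b (b q)) e (X e) - \<beta> (b e))"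
    if b: "\<And>q. q \<in> points (total_atlas E) \<Longrightarrow> b q \<in> fibre Eb (bproj E q)"
      and db: "diff_fun (total_atlas E) (\<lambda>q. \<Phi>b (b q)) e" for b
  proof -
    have proj: "tangent_map (total_atlas E) M (bproj E) q (X q) = (\<lambda>x. \<rho> (s x)) (bproj E q)"
      if "q \<in> points (total_atlas E)" "bproj E q \<in> W" for q
      using projects[OF that(1)] .
    show vert: "vertical M E e (lie_bracket (total_atlas E) X (\<lambda>q. vlift E Eb q (b q)) e)"
      by (rule T.bracket_vertical[of e X "\<lambda>x. \<rho> (s x)" \<beta> b, OF e eW X proj affine b Y[OF b db]]; assumption)
    have "differential (total_atlas E) \<Phi> e (lie_bracket (total_atlas E) X (\<lambda>q. vlift E Eb q (b q)) e)
        = differential (total_atlas E) (\<lambda>q. \<Phi>b (b q)) e (X e) - \<beta> (b e)"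
      by (rule T.bracket_fibre_component[of e X "\<lambda>x. \<rho> (s x)" \<beta> b, OF e eW X proj affine b Y[OF b db]]; assumption)
    then show "vert_part E Eb e (lie_bracket (total_atlas E) X (\<lambda>q. vlift E Eb q (b q)) e) =
      (THE a. a \<in> fibre Eb m \<and> \<Phi>b a = differential (total_atlas E) (\<lambda>q. \<Phi>b (b q)) e (X e) - \<beta> (b e))"
      by (simp add: T.vert_part_eq_THE[OF e eW vert] m_def)
  qed
  have \<sigma>b': "smooth_map M (total_atlas Eb) \<sigma>b" and \<sigma>': "smooth_map M (total_atlas E) \<sigma>"
    using \<sigma>b \<sigma> by (simp_all add: Sec_def)
  note \<sigma>b_fibre = Sec_fibre[OF sM sEb \<sigma>b] and \<sigma>_fibre = Sec_fibre[OF sM sE \<sigma>]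
  have \<sigma>b_diff: "diff_map M (total_atlas Eb) \<sigma>b m" and \<sigma>_diff: "diff_map M (total_atlas E) \<sigma> m"
    by (rule smooth_map_diff_map[OF sM sEb \<sigma>b' m], rule smooth_map_diff_map[OF sM sE \<sigma>' m])
  have \<sigma>bm: "\<sigma>b m \<in> points (total_atlas Eb)" "bproj Eb (\<sigma>b m) = m"
    and \<sigma>m: "\<sigma> m \<in> points (total_atlas E)" "bproj E (\<sigma> m) = m"
    using \<sigma>b_fibre[OF m] \<sigma>_fibre[OF m] by (simp_all add: fibre_def)
  \<comment> \<open>the derivative along \<open>X\<close> of the pullback of \<open>g \<circ> \<tau>\<close>, for a section \<open>\<tau>\<close>\<close>
  have pull: "diff_fun (total_atlas E) (\<lambda>q. g (\<tau> (bproj E q))) e"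
    "differential (total_atlas E) (\<lambda>q. g (\<tau> (bproj E q))) e (X e)
      = differential A g (\<tau> m) (tangent_map M A \<tau> m (\<rho> v))"
    if "smooth_atlas A" "diff_map M A \<tau> m" "diff_fun A g (\<tau> m)"
    for A :: "('y, 'z::real_normed_vector) atlas" and \<tau> and g :: "'y \<Rightarrow> 'f"
  proof -
    have d: "diff_fun M (\<lambda>x. g (\<tau> x)) m" by (rule diff_fun_diff_map[OF that(1,2,3) sM])
    then show "diff_fun (total_atlas E) (\<lambda>q. g (\<tau> (bproj E q))) e"
      using diff_fun_diff_map[OF sM T.E.diff_map_bproj[OF e] _ sE, of "\<lambda>x. g (\<tau> x)"] by (simp add: m_def)
    show "differential (total_atlas E) (\<lambda>q. g (\<tau> (bproj E q))) e (X e)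
      = differential A g (\<tau> m) (tangent_map M A \<tau> m (\<rho> v))"
      using differential_tangent_map[OF sE sM Xe e T.E.diff_map_bproj[OF e], of "\<lambda>x. g (\<tau> x)"] d
        differential_tangent_map[OF sM that(1) \<rho>v(1) m that(2,3)] \<rho>v(2) by (simp add: m_def)
  qed

  have d\<Phi>b: "diff_fun (total_atlas Eb) \<Phi>b (\<sigma>b m)" and d\<Phi>: "diff_fun (total_atlas E) \<Phi> (\<sigma> m)"
    using T.Eb.diff_fun_triv T.E.diff_fun_triv \<sigma>bm(2) \<sigma>m(2) mW by simp_all
  define Qb where "Qb = (\<lambda>c. tangent_map M (total_atlas Eb) \<sigma>b m (\<rho> v) c - hb (\<sigma>b m) v c)"
  define Q where "Q = (\<lambda>c. tangent_map M (total_atlas E) \<sigma> m (\<rho> v) c - h (\<sigma> m) v c)"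
  have hb_t: "hb (\<sigma>b m) v \<in> tangent_space (total_atlas Eb) (\<sigma>b m)"
    using components(2)[OF triv e eW, of "\<sigma>b m" v] \<sigma>b_fibre[OF m] v by (simp add: m_def)
  have h_t: "h (\<sigma> m) v \<in> tangent_space (total_atlas E) (\<sigma> m)"
    using h_tangent[OF \<sigma>m(1)] v \<sigma>m(2) by simp
  have "vertical M Eb (\<sigma>b m) Qb"
    unfolding Qb_def
    by (rule covariant_derivative_vertical[OF sM sEb pEb \<sigma>b m \<rho>v(1) hb_t hb_proj]) (use \<sigma>bm v in simp_all)
  then have Qb_vert: "vertical M (self_affine Eb) (\<sigma>b m) Qb" by (simp add: vertical_def self_affine_def)
  have Q_vert: "vertical M E (\<sigma> m) Q"
    unfolding Q_def
    by (rule covariant_derivative_vertical[OF sM sE pE \<sigma> m \<rho>v(1) h_t h_proj]) (use \<sigma>m v in simp_all)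
  have Qb_comp: "differential (total_atlas Eb) \<Phi>b (\<sigma>b m) Qb =
      differential (total_atlas Eb) \<Phi>b (\<sigma>b m) (tangent_map M (total_atlas Eb) \<sigma>b m (\<rho> v)) - \<beta> (\<sigma>b m)"
    unfolding Qb_def \<beta>_def
    by (rule differential_diff[OF sEb \<sigma>bm(1) tangent_map_in_tangent_space[OF sM sEb \<rho>v(1) m \<sigma>b_diff] hb_t d\<Phi>b])
  have Q_comp: "differential (total_atlas E) \<Phi> (\<sigma> m) Q =
      differential (total_atlas E) \<Phi> (\<sigma> m) (tangent_map M (total_atlas E) \<sigma> m (\<rho> v))
        - differential (total_atlas E) \<Phi> (\<sigma> m) (h (\<sigma> m) v)"
    unfolding Q_def
    by (rule differential_diff[OF sE \<sigma>m(1) tangent_map_in_tangent_space[OF sM sE \<rho>v(1) m \<sigma>_diff] h_t d\<Phi>])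

  define b1 where "b1 = (\<lambda>q. \<sigma>b (bproj E q))"
  have b1: "b1 q \<in> fibre Eb (bproj E q)" if "q \<in> points (total_atlas E)" for q
    unfolding b1_def by (rule \<sigma>b_fibre[OF bp[OF that]])
  have db1: "diff_fun (total_atlas E) (\<lambda>q. \<Phi>b (b1 q)) e"
    unfolding b1_def by (rule pull(1)[OF sEb \<sigma>b_diff d\<Phi>b])
  have Y1: "vlift_vsec E Eb \<sigma>b = (\<lambda>q. vlift E Eb q (b1 q))" by (simp add: vlift_vsec_def b1_def fun_eq_iff)
  have vert1: "vertical M E e (lie_bracket (total_atlas E) X (vlift_vsec E Eb \<sigma>b) e)"
    unfolding Y1 by (rule bracket(1)[OF b1 db1])
  have comp1: "differential (total_atlas E) (\<lambda>q. \<Phi>b (b1 q)) e (X e) - \<beta> (b1 e)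
      = differential (total_atlas Eb) \<Phi>b (\<sigma>b m) Qb"
    using pull(2)[OF sEb \<sigma>b_diff d\<Phi>b] by (simp add: Qb_comp b1_def m_def[symmetric])
  have "vert_part E Eb e (lie_bracket (total_atlas E) X (vlift_vsec E Eb \<sigma>b) e) =
      (THE a. a \<in> fibre Eb m \<and> \<Phi>b a = differential (total_atlas Eb) \<Phi>b (\<sigma>b m) Qb)"
    unfolding Y1 comp1[symmetric] by (rule bracket(2)[OF b1 db1])
  also have "\<dots> = nabla_bar M \<rho> Eb hb s \<sigma>b m"
    using S.vert_part_eq_THE[OF _ _ Qb_vert] \<sigma>bm mW
    by (simp add: nabla_bar_def nabla_def self_affine_def Qb_def v_def)
  finally have nabla_bar: "nabla_bar M \<rho> Eb hb s \<sigma>b m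
    = vert_part E Eb e (lie_bracket (total_atlas E) X (vlift_vsec E Eb \<sigma>b) e)" by simp

  define b2 where "b2 = (\<lambda>q. point_diff E Eb (\<sigma> (bproj E q)) q)"
  have b2: "b2 q \<in> fibre Eb (bproj E q)" "translate E q (b2 q) = \<sigma> (bproj E q)"
    if "q \<in> points (total_atlas E)" for q
    using point_diff[OF EEb bp[OF that] _ \<sigma>_fibre[OF bp[OF that]], of q] that by (simp_all add: b2_def fibre_def)
  have b2_comp: "\<Phi>b (b2 q) = \<Phi> (\<sigma> (bproj E q)) - \<Phi> q"
    if "q \<in> points (total_atlas E)" "bproj E q \<in> W" for q
    using T.triv_translate[OF that(2,1) b2(1)[OF that(1)]] b2(2)[OF that(1)] by simp
  have N: "openin (atlas_topology (total_atlas E)) {q \<in> points (total_atlas E). bproj E q \<in> W}"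
    "e \<in> {q \<in> points (total_atlas E). bproj E q \<in> W}"
    using smooth_map_openin_preimage[OF sE pE T.E.openin_W] e eW by auto
  note diff2 = differential_fun_diff[OF sE e Xe pull(1)[OF sE \<sigma>_diff d\<Phi>] T.E.diff_fun_triv[OF eW]]
  have db2: "diff_fun (total_atlas E) (\<lambda>q. \<Phi>b (b2 q)) e"
    by (rule diff_fun_cong[OF sE N diff2(1)]) (simp add: b2_comp)
  have comp2: "differential (total_atlas E) (\<lambda>q. \<Phi>b (b2 q)) e (X e) =
      differential (total_atlas E) \<Phi> (\<sigma> m) (tangent_map M (total_atlas E) \<sigma> m (\<rho> v))
        - differential (total_atlas E) \<Phi> e (X e)"
    using differential_cong[OF sE N, of "\<lambda>q. \<Phi>b (b2 q)" "\<lambda>q. \<Phi> (\<sigma> (bproj E q)) - \<Phi> q"]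
      diff2(2) pull(2)[OF sE \<sigma>_diff d\<Phi>] by (simp add: b2_comp)
  \<comment> \<open>\<open>\<sigma> m = e + b2 e\<close>, so the value of \<open>d\<Phi>(X)\<close> at \<open>\<sigma> m\<close> comes from that at \<open>e\<close>\<close>
  have "differential (total_atlas E) \<Phi> (\<sigma> m) (h (\<sigma> m) v) = differential (total_atlas E) \<Phi> e (X e) + \<beta> (b2 e)"
    using affine[OF e refl b2(1)[OF e]] b2(2)[OF e] \<sigma>m(2) by (simp add: X_eq m_def v_def)
  then have comp2': "differential (total_atlas E) (\<lambda>q. \<Phi>b (b2 q)) e (X e) - \<beta> (b2 e)
      = differential (total_atlas E) \<Phi> (\<sigma> m) Q"
    by (simp add: comp2 Q_comp)
  have Y2: "vlift_asec E Eb \<sigma> = (\<lambda>q. vlift E Eb q (b2 q))" by (simp add: vlift_asec_def b2_def fun_eq_iff)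
  have vert2: "vertical M E e (lie_bracket (total_atlas E) X (vlift_asec E Eb \<sigma>) e)"
    unfolding Y2 by (rule bracket(1)[OF b2(1) db2])
  have "vert_part E Eb e (lie_bracket (total_atlas E) X (vlift_asec E Eb \<sigma>) e) =
      (THE a. a \<in> fibre Eb m \<and> \<Phi>b a = differential (total_atlas E) \<Phi> (\<sigma> m) Q)"
    unfolding Y2 comp2'[symmetric] by (rule bracket(2)[OF b2(1) db2])
  also have "\<dots> = nabla M \<rho> E Eb h s \<sigma> m"
    using T.vert_part_eq_THE[OF \<sigma>m(1) _ Q_vert] \<sigma>m(2) mW by (simp add: nabla_def Q_def v_def)
  finally have nabla: "nabla M \<rho> E Eb h s \<sigma> m
    = vert_part E Eb e (lie_bracket (total_atlas E) X (vlift_asec E Eb \<sigma>) e)" by simp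

  show "vertical M E e (lie_bracket (total_atlas E) (hor_field E h s) (vlift_vsec E Eb \<sigma>b) e) \<and>
      vertical M E e (lie_bracket (total_atlas E) (hor_field E h s) (vlift_asec E Eb \<sigma>) e) \<and>
      nabla_bar M \<rho> Eb hb s \<sigma>b (bproj E e) =
        vert_part E Eb e (lie_bracket (total_atlas E) (hor_field E h s) (vlift_vsec E Eb \<sigma>b) e) \<and>
      nabla M \<rho> E Eb h s \<sigma> (bproj E e) =
        vert_part E Eb e (lie_bracket (total_atlas E) (hor_field E h s) (vlift_asec E Eb \<sigma>) e)"
    using vert1 vert2 nabla_bar nabla unfolding X_def m_def by (intro conjI)
qed

end
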